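(* Let $S$ be a tame $d$-sphere, let $\ell$ be an integer with $0 \leq \ell \leq d/2-1$, and let $m=f_0(S)$. Then $$\sum_{i=0}^{\ell} (-1)^{\ell-i}\sigma_i(S) \;\leq\; \frac{m+1}{d+3}\sum_{i=0}^{\ell+1}(-1)^{\ell+1-i}\frac{g_i(S)}{\binom{d+2}{i}}.$$ Equality holds here if and only if $S$ is $(\ell+1)$-stacked.
   Context: All simplicial complexes are finite and abstract, and the empty set is a face (of dimension $-1$) of every simplicial complex. A field $\mathbb{F}$ is fixed and all homology is simplicial homology with coefficients in $\mathbb{F}$. $V(X)$ is the vertex set of $X$; for any set $A$, $X[A]=\{\alpha\in X:\alpha\subseteq A\}$. Bistellar moves. For a non-empty finite set $\alpha$, $\overline{\alpha}$ (resp. $\partial\alpha$) is the simplicial complex whose faces are all subsets (resp. all proper subsets) of $\alpha$. $X_1*X_2$ (join) has as faces the disjoint unions of a face of $X_1$ with a face of $X_2$. Let $\alpha,\beta$ be disjoint non-empty finite sets with $\#(\alpha)+\#(\beta)=d+2$ and let $X$ be a $d$-dimensional simplicial complex. $X$ admits the bistellar move $\alpha\mapsto\beta$ if $X[\alpha\cup\beta]=\overline{\alpha}*\partial\beta$; the result of the move is $Y=(X\setminus(\overline{\alpha}*\partial\beta))\cup(\overline{\beta}*\partial\alpha)$. The index of the move is $t=\#(\beta)-1$. (When $t=0$, $\beta$ consists of a new vertex not in $V(X)$; when $t=d$, the unique vertex in $\alpha$ is deleted.) Tame spheres. $S^d_{d+2}$ denotes the standard $d$-sphere $\partial\alpha$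 with $\#(\alpha)=d+2$. A tame $d$-sphere is a $d$-dimensional simplicial complex obtainable from $S^d_{d+2}$ by a finite sequence of bistellar moves, each of index $<d/2$. $g$-vector. For a $d$-dimensional complex $X$, $f_i(X)$ is the number of $i$-dimensional faces ($-1\le i\le d$), and $g_j(X)=\sum_{i=-1}^{j-1}(-1)^{j-i-1}\binom{d-i+1}{j-i-1}f_i(X)$ for $0\le j\le d+1$. Sigma-vector. $\beta_i(X)=\dim_{\mathbb F}H_i(X)$ (unreduced). Reduced Betti numbers: $\tilde\beta_0(X)=\beta_0(X)-1$ (so $\tilde\beta_0(\{\emptyset\})=-1$) and $\tilde\beta_i(X)=\beta_i(X)$ for $i\ge1$. Then $\sigma_i(X)=\sum_{A\subseteq V(X)}\tilde\beta_i(X[A])\big/\binom{f_0(X)}{\#(A)}$ for $i\ge 0$ (the sum includes $A=\emptyset$). Homology manifolds (over $\mathbb{F}$). A homology $d$-manifold is a pure $d$-dimensional simplicial complex $\Delta$ in which the link of each non-empty face $\alpha$ has the $\mathbb{F}$-homology either of a sphere of dimension $d-\#(\alpha)$ (where $\{\emptyset\}$ counts as the $(-1)$-sphere) or of a point; its boundary $\partial\Delta$ consists of $\emptyset$ and the faces whose links have the homology of a point. It is closed if $\partial\Delta=\{\emptyset\}$; otherwise $\partial\Delta$ is required to be a closed homology $(d-1)$-manifold. A homology $d$-sphere is a closed homology $d$-manifold with the $\mathbb{F}$-homology of the $d$-sphere. A homology $d$-ball is a homology $d$-manifold with the $\mathbb{F}$-homology of a point whose boundary is a homology $(d-1)$-sphere.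 Stackedness. $\mathrm{Skel}_k(X)$ is the subcomplex of faces of $X$ of dimension $\le k$. A homology $d$-sphere $S$ is $k$-stacked ($0\le k\le d$) if there is a homology $(d+1)$-ball $\Delta$ with $\partial\Delta=S$ and $\mathrm{Skel}_{d-k}(\Delta)=\mathrm{Skel}_{d-k}(S)$. *)

theory Defs
  imports "Jordan_Normal_Form.VS_Connect"
begin

section \<open>Simplicial complexes\<close>

definition simplicial_complex :: "'v set set \<Rightarrow> bool" where
  "simplicial_complex X \<longleftrightarrow>
     finite X \<and> {} \<in> X \<and> (\<forall>\<alpha>\<in>X. finite \<alpha> \<and> (\<forall>\<beta>. \<beta> \<subseteq> \<alpha> \<longrightarrow> \<beta> \<in> X))"

definition vertices :: "'v set set \<Rightarrow> 'v set" where
  "vertices X = \<Union>X"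

definition face_dim :: "'v set \<Rightarrow> int" where
  "face_dim \<alpha> = int (card \<alpha>) - 1"

definition complex_of_dim :: "int \<Rightarrow> 'v set set \<Rightarrow> bool" where
  "complex_of_dim d X \<longleftrightarrow>
     simplicial_complex X \<and> (\<forall>\<alpha>\<in>X. face_dim \<alpha> \<le> d) \<and> (\<exists>\<alpha>\<in>X. face_dim \<alpha> = d)"

definition pure_complex_of_dim :: "int \<Rightarrow> 'v set set \<Rightarrow> bool" where
  "pure_complex_of_dim d X \<longleftrightarrow>
     complex_of_dim d X \<and> (\<forall>\<alpha>\<in>X. \<exists>\<beta>\<in>X. \<alpha> \<subseteq> \<beta> \<and> face_dim \<beta> = d)"

definition induced :: "'v set set \<Rightarrow> 'v set \<Rightarrow> 'v set set" where
  "induced X A = {\<alpha> \<in> X. \<alpha> \<subseteq> A}"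

definition skeleton :: "int \<Rightarrow> 'v set set \<Rightarrow> 'v set set" where
  "skeleton k X = {\<alpha> \<in> X. face_dim \<alpha> \<le> k}"

definition link :: "'v set set \<Rightarrow> 'v set \<Rightarrow> 'v set set" where
  "link X \<alpha> = {\<beta> \<in> X. \<beta> \<inter> \<alpha> = {} \<and> \<beta> \<union> \<alpha> \<in> X}"

definition full_simplex :: "'v set \<Rightarrow> 'v set set" where
  "full_simplex \<alpha> = {\<gamma>. \<gamma> \<subseteq> \<alpha>}"

definition simplex_boundary :: "'v set \<Rightarrow> 'v set set" where
  "simplex_boundary \<alpha> = {\<gamma>. \<gamma> \<subset> \<alpha>}"

text \<open>Only used for complexes with disjoint vertex sets, so that the union of a face of the one
  with a face of the other is automatically a disjoint union.\<close>

definition join :: "'v set set \<Rightarrow> 'v set set \<Rightarrow> 'v set set" where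
  "join X Y = {\<alpha> \<union> \<beta> | \<alpha> \<beta>. \<alpha> \<in> X \<and> \<beta> \<in> Y}"


section \<open>Bistellar moves and tame spheres\<close>

text \<open>For \<open>\<beta> = {b}\<close> the last condition forces \<open>b\<close> to be a new vertex, since then
  \<open>{b}\<close> is not a face of \<open>join (full_simplex \<alpha>) (simplex_boundary \<beta>) = full_simplex \<alpha>\<close>.\<close>

definition admits_move :: "nat \<Rightarrow> 'v set set \<Rightarrow> 'v set \<Rightarrow> 'v set \<Rightarrow> bool" where
  "admits_move d X \<alpha> \<beta> \<longleftrightarrow>
     complex_of_dim (int d) X \<and>
     finite \<alpha> \<and> finite \<beta> \<and> \<alpha> \<noteq> {} \<and> \<beta> \<noteq> {} \<and> \<alpha> \<inter> \<beta> = {} \<and> card \<alpha> + card \<beta> = d + 2 \<and>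
     induced X (\<alpha> \<union> \<beta>) = join (full_simplex \<alpha>) (simplex_boundary \<beta>)"

definition bistellar_move :: "'v set set \<Rightarrow> 'v set \<Rightarrow> 'v set \<Rightarrow> 'v set set" where
  "bistellar_move X \<alpha> \<beta> =
     (X - join (full_simplex \<alpha>) (simplex_boundary \<beta>)) \<union>
     join (full_simplex \<beta>) (simplex_boundary \<alpha>)"

definition move_index :: "'v set \<Rightarrow> nat" where
  "move_index \<beta> = card \<beta> - 1"

inductive tamely_obtainable :: "nat \<Rightarrow> 'v set set \<Rightarrow> bool" for d :: nat where
  standard: "finite \<alpha> \<Longrightarrow> card \<alpha> = d + 2 \<Longrightarrow> tamely_obtainable d (simplex_boundary \<alpha>)"
| move: "tamely_obtainable d X \<Longrightarrow> admits_move d X \<alpha> \<beta> \<Longrightarrow> real (move_index \<beta>) < real d / 2 \<Longrightarrow>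
    tamely_obtainable d (bistellar_move X \<alpha> \<beta>)"

definition tame_sphere :: "nat \<Rightarrow> 'v set set \<Rightarrow> bool" where
  "tame_sphere d X \<longleftrightarrow> complex_of_dim (int d) X \<and> tamely_obtainable d X"


section \<open>The g-vector\<close>

definition f_num :: "int \<Rightarrow> 'v set set \<Rightarrow> nat" where
  "f_num i X = card {\<alpha> \<in> X. face_dim \<alpha> = i}"

definition g_num :: "nat \<Rightarrow> nat \<Rightarrow> 'v set set \<Rightarrow> int" where
  "g_num d j X =
     (\<Sum>i = -1..int j - 1.
        (-1) ^ nat (int j - i - 1) *
        int (nat (int d - i + 1) choose nat (int j - i - 1)) * int (f_num i X))"


section \<open>Simplicial homology with coefficients in a field\<close>

text \<open>The vertices are linearly ordered and every face is oriented by increasing order of its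
  vertices, so that an \<open>i\<close>-chain is a function on the \<open>i\<close>-faces. As usual, the homology does not
  depend, up to isomorphism, on the order chosen. Chains are extended by \<open>0\<close> to all sets.\<close>

definition simplicial_chains :: "nat \<Rightarrow> 'v set set \<Rightarrow> ('v set \<Rightarrow> 'f::field) set" where
  "simplicial_chains i X = {c. \<forall>\<alpha>. c \<alpha> \<noteq> 0 \<longrightarrow> \<alpha> \<in> X \<and> face_dim \<alpha> = int i}"

text \<open>If \<open>v\<close> is a vertex outside \<open>\<tau>\<close> with exactly \<open>k\<close> elements of \<open>\<tau>\<close> below it, then \<open>\<tau>\<close> is
  obtained from \<open>\<tau> \<union> {v}\<close> by omitting the vertex number \<open>k\<close> (counting from \<open>0\<close>), so \<open>\<tau>\<close> has
  coefficient \<open>(-1)\<^sup>k\<close> in the boundary of \<open>\<tau> \<union> {v}\<close>. The case \<open>\<tau> = {}\<close> makes the boundary of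
  every \<open>0\<close>-chain zero, as the homology is not reduced.\<close>

definition chain_boundary ::
    "'v::linorder set set \<Rightarrow> ('v set \<Rightarrow> 'f::field) \<Rightarrow> 'v set \<Rightarrow> 'f" where
  "chain_boundary X c \<tau> =
     (if \<tau> = {} then 0
      else \<Sum>v \<in> vertices X - \<tau>. (-1) ^ card {w \<in> \<tau>. w < v} * c (insert v \<tau>))"

definition cycles :: "nat \<Rightarrow> 'v::linorder set set \<Rightarrow> ('v set \<Rightarrow> 'f::field) set" where
  "cycles i X = {c \<in> simplicial_chains i X. chain_boundary X c = (\<lambda>_. 0)}"

definition boundaries :: "nat \<Rightarrow> 'v::linorder set set \<Rightarrow> ('v set \<Rightarrow> 'f::field) set" where
  "boundaries i X = chain_boundary X ` simplicial_chains (Suc i) X"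

definition chain_coset :: "('v set \<Rightarrow> 'f::field) \<Rightarrow> ('v set \<Rightarrow> 'f) set \<Rightarrow> ('v set \<Rightarrow> 'f) set" where
  "chain_coset z B = {\<lambda>\<alpha>. z \<alpha> + b \<alpha> | b. b \<in> B}"

text \<open>The quotient of the cycles by the boundaries; the fields \<open>mult\<close> and \<open>one\<close> of the record
  play no role for vector spaces.\<close>

definition homology_space ::
    "nat \<Rightarrow> 'v::linorder set set \<Rightarrow> ('f::field, ('v set \<Rightarrow> 'f) set) module" where
  "homology_space i X =
     \<lparr> carrier = {chain_coset z (boundaries i X) | z. z \<in> cycles i X},
       mult = undefined,
       one = undefined,
       zero = boundaries i X,
       add = (\<lambda>U W. {\<lambda>\<alpha>. u \<alpha> + w \<alpha> | u w. u \<in> U \<and> w \<in> W}),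
       smult = (\<lambda>a U. {\<lambda>\<alpha>. a * u \<alpha> + b \<alpha> | u b. u \<in> U \<and> b \<in> boundaries i X}) \<rparr>"

definition betti :: "'f::field itself \<Rightarrow> nat \<Rightarrow> 'v::linorder set set \<Rightarrow> nat" where
  "betti F i X = vectorspace.dim (class_ring :: 'f ring)
     (homology_space i X :: ('f, ('v set \<Rightarrow> 'f) set) module)"

definition reduced_betti :: "'f::field itself \<Rightarrow> nat \<Rightarrow> 'v::linorder set set \<Rightarrow> int" where
  "reduced_betti F i X = (if i = 0 then int (betti F 0 X) - 1 else int (betti F i X))"

definition sigma_num :: "'f::field itself \<Rightarrow> nat \<Rightarrow> 'v::linorder set set \<Rightarrow> real" where
  "sigma_num F i X =
     (\<Sum>A \<in> Pow (vertices X).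
        real_of_int (reduced_betti F i (induced X A)) / real (f_num 0 X choose card A))"


section \<open>Homology manifolds and stackedness\<close>

text \<open>Homology spaces of finite complexes are finite-dimensional, so they are isomorphic iff their
  dimensions agree.\<close>

definition same_homology ::
    "'f::field itself \<Rightarrow> 'v::linorder set set \<Rightarrow> 'w::linorder set set \<Rightarrow> bool" where
  "same_homology F X Y \<longleftrightarrow> (\<forall>i. betti F i X = betti F i Y)"

text \<open>For \<open>k = -1\<close> the standard sphere is \<open>{{}}\<close>, all of whose unreduced homology vanishes;
  \<open>{{}}\<close> is the only complex with this property.\<close>

definition has_sphere_homology :: "'f::field itself \<Rightarrow> int \<Rightarrow> 'v::linorder set set \<Rightarrow> bool" where
  "has_sphere_homology F k X \<longleftrightarrow> same_homology F X (simplex_boundary {..<nat (k + 2)})"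

definition has_point_homology :: "'f::field itself \<Rightarrow> 'v::linorder set set \<Rightarrow> bool" where
  "has_point_homology F X \<longleftrightarrow> same_homology F X (full_simplex {0::nat})"

definition manifold_boundary :: "'f::field itself \<Rightarrow> 'v::linorder set set \<Rightarrow> 'v set set" where
  "manifold_boundary F X = {{}} \<union> {\<alpha> \<in> X. \<alpha> \<noteq> {} \<and> has_point_homology F (link X \<alpha>)}"

definition manifold_links :: "'f::field itself \<Rightarrow> int \<Rightarrow> 'v::linorder set set \<Rightarrow> bool" where
  "manifold_links F d X \<longleftrightarrow>
     (\<forall>\<alpha>\<in>X. \<alpha> \<noteq> {} \<longrightarrow>
        has_sphere_homology F (d - int (card \<alpha>)) (link X \<alpha>) \<or> has_point_homology F (link X \<alpha>))"

definition closed_homology_manifold ::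
    "'f::field itself \<Rightarrow> int \<Rightarrow> 'v::linorder set set \<Rightarrow> bool" where
  "closed_homology_manifold F d X \<longleftrightarrow>
     pure_complex_of_dim d X \<and> manifold_links F d X \<and> manifold_boundary F X = {{}}"

definition homology_manifold :: "'f::field itself \<Rightarrow> int \<Rightarrow> 'v::linorder set set \<Rightarrow> bool" where
  "homology_manifold F d X \<longleftrightarrow>
     pure_complex_of_dim d X \<and> manifold_links F d X \<and>
     (manifold_boundary F X = {{}} \<or> closed_homology_manifold F (d - 1) (manifold_boundary F X))"

definition homology_sphere :: "'f::field itself \<Rightarrow> int \<Rightarrow> 'v::linorder set set \<Rightarrow> bool" where
  "homology_sphere F d X \<longleftrightarrow> closed_homology_manifold F d X \<and> has_sphere_homology F d X"

definition homology_ball :: "'f::field itself \<Rightarrow> int \<Rightarrow> 'v::linorder set set \<Rightarrow> bool" where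
  "homology_ball F d X \<longleftrightarrow>
     homology_manifold F d X \<and> has_point_homology F X \<and>
     homology_sphere F (d - 1) (manifold_boundary F X)"

text \<open>As \<open>k \<le> d\<close>, the condition on skeleta forces the ball to have the same vertices as the sphere;
  hence no ball is lost by taking its vertices from the same type.\<close>

definition k_stacked :: "'f::field itself \<Rightarrow> nat \<Rightarrow> nat \<Rightarrow> 'v::linorder set set \<Rightarrow> bool" where
  "k_stacked F d k S \<longleftrightarrow>
     k \<le> d \<and> homology_sphere F (int d) S \<and>
     (\<exists>\<Delta>. homology_ball F (int d + 1) \<Delta> \<and> manifold_boundary F \<Delta> = S \<and>
          skeleton (int d - int k) \<Delta> = skeleton (int d - int k) S)"


section \<open>The homology spaces are vector spaces\<close>

lemma chain_boundary_lin:
  fixes c e :: "'v::linorder set \<Rightarrow> 'b::field"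
  shows "chain_boundary X (\<lambda>\<alpha>. a * c \<alpha> + b * e \<alpha>) = (\<lambda>\<tau>. a * chain_boundary X c \<tau> + b * chain_boundary X e \<tau>)"
proof (rule ext)
  fix \<tau>
  have "(-1) ^ k * (a * x + b * y) = a * ((-1) ^ k * x) + b * ((-1) ^ k * y)" for k and x y :: 'b
    by (simp add: algebra_simps)
  then show "chain_boundary X (\<lambda>\<alpha>. a * c \<alpha> + b * e \<alpha>) \<tau> =
      a * chain_boundary X c \<tau> + b * chain_boundary X e \<tau>"
    by (cases "\<tau> = {}") (simp_all only: chain_boundary_def sum_distrib_left sum.distrib if_True if_False, simp)
qed

lemma chains_lin:
  "c \<in> simplicial_chains i X \<Longrightarrow> e \<in> simplicial_chains i X \<Longrightarrow> (\<lambda>\<alpha>. a * c \<alpha> + b * e \<alpha>) \<in> simplicial_chains i X"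
proof -
  assume c: "c \<in> simplicial_chains i X" and e: "e \<in> simplicial_chains i X"
  have "\<alpha> \<in> X \<and> face_dim \<alpha> = int i" if "a * c \<alpha> + b * e \<alpha> \<noteq> 0" for \<alpha>
  proof -
    from that have "c \<alpha> \<noteq> 0 \<or> e \<alpha> \<noteq> 0" by auto
    with c e show ?thesis unfolding simplicial_chains_def by blast
  qed
  then show ?thesis unfolding simplicial_chains_def by blast
qed

lemma cycles_lin:
  "c \<in> cycles i X \<Longrightarrow> e \<in> cycles i X \<Longrightarrow> (\<lambda>\<alpha>. a * c \<alpha> + b * e \<alpha>) \<in> cycles i X"
  by (simp add: cycles_def chains_lin chain_boundary_lin)

lemma boundaries_lin:
  assumes "c \<in> boundaries i X" "e \<in> boundaries i X"
  shows "(\<lambda>\<alpha>. a * c \<alpha> + b * e \<alpha>) \<in> boundaries i X"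
proof -
  from assms obtain c' e' where *: "c' \<in> simplicial_chains (Suc i) X" "e' \<in> simplicial_chains (Suc i) X"
    "c = chain_boundary X c'" "e = chain_boundary X e'"
    by (auto simp: boundaries_def)
  have "(\<lambda>\<alpha>. a * c \<alpha> + b * e \<alpha>) = chain_boundary X (\<lambda>\<alpha>. a * c' \<alpha> + b * e' \<alpha>)"
    by (simp add: * chain_boundary_lin)
  with * show ?thesis by (auto simp: boundaries_def intro!: chains_lin)
qed

lemma zero_chains: "(\<lambda>_. 0) \<in> simplicial_chains i X"
  by (simp add: simplicial_chains_def)

lemma chain_boundary_zero: "chain_boundary X (\<lambda>_. 0) = (\<lambda>_. 0)"
  by (rule ext) (simp add: chain_boundary_def)

lemma zero_cycles: "(\<lambda>_. 0) \<in> cycles i X"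
  by (simp add: cycles_def zero_chains chain_boundary_zero)

lemma zero_boundaries: "(\<lambda>_. 0) \<in> boundaries i X"
  unfolding boundaries_def
  by (rule image_eqI[where x = "\<lambda>_. 0"]) (simp_all add: chain_boundary_zero zero_chains)

lemma chain_coset_iff: "u \<in> chain_coset z B \<longleftrightarrow> (\<lambda>\<alpha>. u \<alpha> - z \<alpha>) \<in> B"
proof
  assume "(\<lambda>\<alpha>. u \<alpha> - z \<alpha>) \<in> B"
  moreover have "u = (\<lambda>\<alpha>. z \<alpha> + (\<lambda>\<alpha>. u \<alpha> - z \<alpha>) \<alpha>)" by simp
  ultimately show "u \<in> chain_coset z B"
    unfolding chain_coset_def by (intro CollectI exI[of _ "\<lambda>\<alpha>. u \<alpha> - z \<alpha>"]) simp
qed (auto simp: chain_coset_def)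

lemma chain_coset_zero: "chain_coset (\<lambda>_. 0) B = B"
  by (simp add: set_eq_iff chain_coset_iff)

lemma homology_addI:
  "u \<in> U \<Longrightarrow> w \<in> W \<Longrightarrow> (\<lambda>\<alpha>. u \<alpha> + w \<alpha>) \<in> U \<oplus>\<^bsub>homology_space i X\<^esub> W"
  unfolding homology_space_def by auto

lemma homology_smultI:
  "u \<in> U \<Longrightarrow> b \<in> boundaries i X \<Longrightarrow>
     (\<lambda>\<alpha>. a * u \<alpha> + b \<alpha>) \<in> a \<odot>\<^bsub>homology_space i X\<^esub> U"
  unfolding homology_space_def by auto

lemma homology_add:
  "chain_coset y (boundaries i X) \<oplus>\<^bsub>homology_space i X\<^esub> chain_coset z (boundaries i X)
     = chain_coset (\<lambda>\<alpha>. y \<alpha> + z \<alpha>) (boundaries i X)"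
proof (intro Set.set_eqI iffI)
  fix t assume "t \<in> chain_coset y (boundaries i X) \<oplus>\<^bsub>homology_space i X\<^esub> chain_coset z (boundaries i X)"
  then obtain u w where t: "t = (\<lambda>\<alpha>. u \<alpha> + w \<alpha>)"
    and "(\<lambda>\<alpha>. u \<alpha> - y \<alpha>) \<in> boundaries i X" "(\<lambda>\<alpha>. w \<alpha> - z \<alpha>) \<in> boundaries i X"
    by (auto simp: homology_space_def chain_coset_iff)
  from boundaries_lin[OF this(2,3), of 1 1] show "t \<in> chain_coset (\<lambda>\<alpha>. y \<alpha> + z \<alpha>) (boundaries i X)"
    by (simp add: t chain_coset_iff algebra_simps)
next
  fix t assume t: "t \<in> chain_coset (\<lambda>\<alpha>. y \<alpha> + z \<alpha>) (boundaries i X)"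
  have "y \<in> chain_coset y (boundaries i X)" by (simp add: chain_coset_iff zero_boundaries)
  moreover have "(\<lambda>\<alpha>. t \<alpha> - y \<alpha>) \<in> chain_coset z (boundaries i X)"
    using t by (simp add: chain_coset_iff algebra_simps)
  ultimately have "(\<lambda>\<alpha>. y \<alpha> + (t \<alpha> - y \<alpha>)) \<in>
      chain_coset y (boundaries i X) \<oplus>\<^bsub>homology_space i X\<^esub> chain_coset z (boundaries i X)"
    by (rule homology_addI)
  then show "t \<in> chain_coset y (boundaries i X) \<oplus>\<^bsub>homology_space i X\<^esub> chain_coset z (boundaries i X)"
    by simp
qed

lemma homology_smult:
  "a \<odot>\<^bsub>homology_space i X\<^esub> chain_coset z (boundaries i X)
     = chain_coset (\<lambda>\<alpha>. a * z \<alpha>) (boundaries i X)"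
proof (intro Set.set_eqI iffI)
  fix t assume "t \<in> a \<odot>\<^bsub>homology_space i X\<^esub> chain_coset z (boundaries i X)"
  then obtain u b where t: "t = (\<lambda>\<alpha>. a * u \<alpha> + b \<alpha>)"
    and "(\<lambda>\<alpha>. u \<alpha> - z \<alpha>) \<in> boundaries i X" "b \<in> boundaries i X"
    by (auto simp: homology_space_def chain_coset_iff)
  from boundaries_lin[OF this(2,3), of a 1] show "t \<in> chain_coset (\<lambda>\<alpha>. a * z \<alpha>) (boundaries i X)"
    by (simp add: t chain_coset_iff algebra_simps)
next
  fix t assume t: "t \<in> chain_coset (\<lambda>\<alpha>. a * z \<alpha>) (boundaries i X)"
  have "z \<in> chain_coset z (boundaries i X)" by (simp add: chain_coset_iff zero_boundaries)
  moreover have "(\<lambda>\<alpha>. t \<alpha> - a * z \<alpha>) \<in> boundaries i X"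
    using t by (simp add: chain_coset_iff)
  ultimately have "(\<lambda>\<alpha>. a * z \<alpha> + (t \<alpha> - a * z \<alpha>)) \<in>
      a \<odot>\<^bsub>homology_space i X\<^esub> chain_coset z (boundaries i X)"
    by (rule homology_smultI)
  then show "t \<in> a \<odot>\<^bsub>homology_space i X\<^esub> chain_coset z (boundaries i X)"
    by simp
qed

lemma homology_carrier:
  "carrier (homology_space i X) = (\<lambda>z. chain_coset z (boundaries i X)) ` cycles i X"
  by (auto simp: homology_space_def)

lemma homology_zero:
  "\<zero>\<^bsub>homology_space i X\<^esub> = chain_coset (\<lambda>_. 0) (boundaries i X)"
  by (simp add: homology_space_def chain_coset_zero)

lemma vectorspace_homology_space:
  "vectorspace (class_ring :: 'f::field ring)
     (homology_space i X :: ('f, ('v::linorder set \<Rightarrow> 'f) set) module)"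
proof -
  let ?H = "homology_space i X :: ('f, ('v set \<Rightarrow> 'f) set) module"
  have add: "(\<lambda>\<alpha>. y \<alpha> + z \<alpha>) \<in> cycles i X" if "y \<in> cycles i X" "z \<in> cycles i X" for y z :: "'v set \<Rightarrow> 'f"
    using cycles_lin[OF that, of 1 1] by simp
  have mul: "(\<lambda>\<alpha>. a * z \<alpha>) \<in> cycles i X" if "z \<in> cycles i X" for a and z :: "'v set \<Rightarrow> 'f"
    using cycles_lin[OF that that, of a 0] by simp
  have inv: "\<exists>w\<in>cycles i X. chain_coset (\<lambda>\<alpha>. z \<alpha> + w \<alpha>) (boundaries i X) =
      chain_coset (\<lambda>_. 0) (boundaries i X)" if "z \<in> cycles i X" for z :: "'v set \<Rightarrow> 'f"
    using mul[OF that, of "-1"] by (intro bexI[of _ "\<lambda>\<alpha>. - z \<alpha>"]) auto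
  have ag: "abelian_group ?H"
    by (rule abelian_groupI)
      (auto simp: homology_carrier homology_add homology_zero zero_cycles add inv algebra_simps)
  have cr: "Ring.field (class_ring :: 'f ring)" by (rule class_field.field_axioms)
  then have "cring (class_ring :: 'f ring)"
    by (simp add: Ring.field_def domain_def)
  then have "Module.module (class_ring :: 'f ring) ?H"
    using ag by (intro Module.moduleI)
      (auto simp: homology_carrier homology_add homology_smult mul algebra_simps)
  with cr show ?thesis by (simp add: vectorspace_def)
qed

end

theory Submission
  imports Defs "HOL-Library.Function_Algebras" "HOL-Computational_Algebra.Polynomial"
begin

text \<open>Put \<open>k = l + 1\<close> and \<open>D = d + 2\<close>, and divide both sides by \<open>m + 1\<close>. Since
  \<open>1 / ((m + 1) * (m choose a))\<close> is the integral of \<open>x ^ a * (1 - x) ^ (m - a)\<close> over the unit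
  interval, the left side becomes an average, over random vertex subsets \<open>A\<close>, of the alternating
  sum of the reduced Betti numbers of \<open>S[A]\<close> in dimensions \<open>-1, ..., l\<close>. Such an average does not
  change when points that are not vertices are allowed into \<open>A\<close> (\<open>weighted_sum_extend\<close>), so it can
  be compared along the sequence of moves that produces \<open>S\<close>, although the vertex set grows.

  A move \<open>\<alpha> \<mapsto> \<beta>\<close> from \<open>X\<close> to \<open>Y\<close> is best seen through the complex \<open>Z\<close> obtained from either of
  them by filling in the whole simplex on \<open>U = \<alpha> \<union> \<beta>\<close>. The faces that \<open>Z[A]\<close> has beyond those of
  \<open>X[A]\<close> are those that contain \<open>\<beta>\<close>, and they cancel in pairs unless \<open>A \<inter> U = \<beta>\<close>, when \<open>\<beta>\<close> is the
  only new face (\<open>face_betti_induced_same\<close>, \<open>induced_attach\<close>). Attaching one face with \<open>n\<close>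
  vertices either creates a class of dimension \<open>n - 1\<close> or kills one of dimension \<open>n - 2\<close>. In both
  cases the alternating sum changes by \<open>(-1) ^ (k - n)\<close> if \<open>n \<le> k\<close>; it drops by at most one if
  \<open>n = k + 1\<close>, and does not change if \<open>n > k + 1\<close> (\<open>alt_betti_attach\<close>). Between \<open>Y\<close> and \<open>Z\<close> the
  same happens with \<open>\<alpha>\<close>, which is too large to matter. The subsets with \<open>A \<inter> U = \<beta>\<close> have total
  weight \<open>1 / ((D + 1) * (D choose card \<beta>))\<close>, and the move raises \<open>g\<close> by one at index \<open>card \<beta>\<close>;
  so for \<open>card \<beta> \<le> k\<close> both sides change by the same amount. For \<open>card \<beta> = k + 1\<close> the left side
  drops strictly, because \<open>A = \<beta>\<close> turns the boundary of a simplex into the simplex, and the right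
  side stays. As both sides agree for the standard sphere, this gives the inequality.

  Equality holds as long as no move has \<open>card \<beta> = k + 1\<close>. Gluing on the simplices \<open>U\<close> of moves with
  \<open>card \<beta> \<le> k\<close> builds a ball \<open>\<Delta>\<close> (\<open>flip_ball\<close>) with boundary \<open>X\<close> whose interior faces have more than
  \<open>d + 1 - k\<close> vertices and whose missing faces have at most \<open>k + 1\<close>. The first property makes \<open>X\<close>
  \<open>k\<close>-stacked; the second excludes a move with \<open>card \<beta> > k + 1\<close> as the next one, as \<open>\<beta>\<close> would be a
  missing face. Conversely, in a ball that shows \<open>S\<close> to be \<open>k\<close>-stacked, the Euler characteristics of
  the links bound the degree of the h-polynomial by \<open>k\<close>, which forces \<open>g\<close> to vanish at index \<open>k + 1\<close>
  (\<open>k_stacked_g_num_zero\<close>); but every move with \<open>card \<beta> = k + 1\<close> raises this entry by one and no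
  move lowers it.\<close>

section \<open>Finite-dimensional spaces of functions\<close>

definition fscale :: "'f::field \<Rightarrow> ('a \<Rightarrow> 'f) \<Rightarrow> 'a \<Rightarrow> 'f" where
  "fscale a c = (\<lambda>x. a * c x)"

lemma fscale_apply: "fscale a c x = a * c x"
  by (simp add: fscale_def)

interpretation fv: vector_space "fscale :: 'f::field \<Rightarrow> ('a \<Rightarrow> 'f) \<Rightarrow> 'a \<Rightarrow> 'f"
  by unfold_locales (auto simp: fun_eq_iff fscale_apply algebra_simps)

text \<open>Independence and spanning are both meant modulo \<open>W\<close>: \<open>C\<close> represents a basis of the quotient
  of \<open>V\<close> by \<open>W\<close>. This form lets a basis of a homology space be read off from chains.\<close>

lemma complement_basis:
  fixes V W :: "('a \<Rightarrow> 'f::field) set"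
  assumes V: "fv.subspace V" and W: "fv.subspace W" "W \<subseteq> V" and T: "finite T" "V \<subseteq> fv.span T"
  obtains C where "finite C" "C \<subseteq> V" "fv.dim V = fv.dim W + card C"
    "\<And>v. v \<in> V \<Longrightarrow> \<exists>a. v - (\<Sum>c\<in>C. fscale (a c) c) \<in> W"
    "\<And>a c. (\<Sum>c\<in>C. fscale (a c) c) \<in> W \<Longrightarrow> c \<in> C \<Longrightarrow> a c = 0"
proof -
  obtain A where A: "A \<subseteq> W" "fv.independent A" "W \<subseteq> fv.span A" "card A = fv.dim W"
    using fv.basis_exists[of W] by blast
  have "A \<subseteq> V" using A W by blast
  then obtain B where B: "A \<subseteq> B" "B \<subseteq> V" "fv.independent B" "V \<subseteq> fv.span B"
    using fv.maximal_independent_subset_extend A(2) by blast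
  have finB: "finite B" using fv.independent_span_bound T B by blast
  have finA: "finite A" using finB B finite_subset by blast
  have spA: "fv.span A = W" using A W by (simp add: fv.span_minimal subset_antisym)
  have cB: "card B = fv.dim V" by (rule fv.basis_card_eq_dim[OF B(2) B(4) B(3)])
  have split: "(\<Sum>c\<in>B. g c) = (\<Sum>c\<in>A. g c) + (\<Sum>c\<in>B - A. g c)" for g :: "_ \<Rightarrow> 'a \<Rightarrow> 'f"
    using sum.subset_diff[OF B(1) finB, of g] by (simp add: add.commute)
  show thesis
  proof (rule that[of "B - A"])
    show "finite (B - A)" "B - A \<subseteq> V" using finB B by auto
    show "fv.dim V = fv.dim W + card (B - A)"
      using cB A(4) card_Diff_subset[OF finA B(1)] card_mono[OF finB B(1)] by simp
  next
    fix v assume "v \<in> V"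
    then have "v \<in> fv.span B" using B by blast
    then obtain u where u: "v = (\<Sum>c\<in>B. fscale (u c) c)"
      unfolding fv.span_finite[OF finB] by blast
    have "v - (\<Sum>c\<in>B - A. fscale (u c) c) = (\<Sum>c\<in>A. fscale (u c) c)"
      unfolding u split by simp
    also have "\<dots> \<in> W"
      unfolding spA[symmetric] fv.span_finite[OF finA] by blast
    finally show "\<exists>a. v - (\<Sum>c\<in>B - A. fscale (a c) c) \<in> W" by blast
  next
    fix a c assume a: "(\<Sum>c\<in>B - A. fscale (a c) c) \<in> W" and c: "c \<in> B - A"
    then obtain u where u: "(\<Sum>c\<in>B - A. fscale (a c) c) = (\<Sum>c\<in>A. fscale (u c) c)"
      unfolding spA[symmetric] fv.span_finite[OF finA] by blast
    \<comment> \<open>Moving everything to one side gives a vanishing combination of the basis \<open>B\<close>.\<close>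
    define r where "r = (\<lambda>c. if c \<in> A then u c else - a c)"
    have "(\<Sum>c\<in>B. fscale (r c) c) = (\<Sum>c\<in>A. fscale (u c) c) + (\<Sum>c\<in>B - A. fscale (- a c) c)"
      unfolding split r_def by (auto intro!: arg_cong2[where f="(+)"] sum.cong)
    also have "(\<Sum>c\<in>B - A. fscale (- a c) c) = - (\<Sum>c\<in>B - A. fscale (a c) c)"
      by (simp add: sum_negf[symmetric] fv.scale_minus_left)
    finally have "(\<Sum>c\<in>B. fscale (r c) c) = 0" by (simp only: u add.right_inverse)
    then have "r c = 0"
      using fv.independentD[OF B(3) finB subset_refl, of r c] c by blast
    then show "a c = 0" using c by (simp add: r_def)
  qed
qed

lemma dim_mono_finite:
  fixes V W :: "('a \<Rightarrow> 'f::field) set"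
  assumes "fv.subspace V" "fv.subspace W" "W \<subseteq> V" "finite T" "V \<subseteq> fv.span T"
  shows "fv.dim W \<le> fv.dim V"
  using complement_basis[OF assms] by (metis le_add1)

text \<open>The dimension count behind every change of homology below: \<open>x\<close> spans a complement of \<open>W\<close>
  in \<open>V\<close>.\<close>

lemma dim_one_more:
  fixes V W :: "('a \<Rightarrow> 'f::field) set"
  assumes W: "fv.subspace W" "W \<subseteq> V" and T: "finite T" "W \<subseteq> fv.span T"
    and x: "x \<in> V" "x \<notin> W" and V: "\<And>v. v \<in> V \<Longrightarrow> \<exists>a. v - fscale a x \<in> W"
  shows "fv.dim V = Suc (fv.dim W)"
proof -
  obtain A where A: "A \<subseteq> W" "fv.independent A" "W \<subseteq> fv.span A" "card A = fv.dim W"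
    using fv.basis_exists[of W] by blast
  have finA: "finite A" using fv.independent_span_bound T A by blast
  have spA: "fv.span A = W" using A W by (simp add: fv.span_minimal subset_antisym)
  show ?thesis
  proof (rule fv.dim_unique)
    show "insert x A \<subseteq> V" using x A W by auto
    show "V \<subseteq> fv.span (insert x A)"
      unfolding fv.span_insert spA using V by auto
    show "fv.independent (insert x A)"
      using A x spA by (simp add: fv.independent_insertI)
    show "card (insert x A) = Suc (fv.dim W)"
      using A x finA by (subst card_insert_disjoint) auto
  qed
qed

section \<open>Betti numbers as differences of dimensions\<close>

text \<open>Linear combinations in the record \<open>homology_space\<close> can be computed on representatives. The
  coefficients are indexed by cosets, hence the injectivity.\<close>

lemma homology_lincomb:
  fixes a :: "(('v::linorder set \<Rightarrow> 'f::field) set) \<Rightarrow> 'f" and X :: "'v set set"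
  assumes "finite C" "C \<subseteq> cycles i X" "inj_on (\<lambda>z. chain_coset z (boundaries i X)) C"
  shows "module.lincomb (homology_space i X) a ((\<lambda>z. chain_coset z (boundaries i X)) ` C)
       = chain_coset (\<Sum>c\<in>C. fscale (a (chain_coset c (boundaries i X))) c) (boundaries i X)
    \<and> (\<Sum>c\<in>C. fscale (a (chain_coset c (boundaries i X))) c) \<in> cycles i X"
  using assms
proof (induction C rule: finite_induct)
  case empty
  interpret H: vectorspace "class_ring :: 'f ring" "homology_space i X :: ('f, ('v set \<Rightarrow> 'f) set) module"
    by (rule vectorspace_homology_space)
  show ?case
    by (simp add: H.lincomb_def homology_zero zero_fun_def zero_cycles)
next
  case (insert c C)
  interpret H: vectorspace "class_ring :: 'f ring" "homology_space i X :: ('f, ('v set \<Rightarrow> 'f) set) module"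
    by (rule vectorspace_homology_space)
  let ?q = "\<lambda>z. chain_coset z (boundaries i X)"
  let ?s = "\<Sum>c\<in>C. fscale (a (?q c)) c"
  have IH: "H.lincomb a (?q ` C) = ?q ?s" "?s \<in> cycles i X"
    using insert by auto
  have notin: "?q c \<notin> ?q ` C" using insert by auto
  have "H.lincomb a (?q ` insert c C) = H.lincomb a (?q ` C \<union> {?q c})" by simp
  also have "\<dots> = (a (?q c) \<odot>\<^bsub>homology_space i X\<^esub> ?q c) \<oplus>\<^bsub>homology_space i X\<^esub> H.lincomb a (?q ` C)"
    using insert notin by (intro H.lincomb_insert) (auto simp: homology_carrier)
  also have "\<dots> = ?q (\<lambda>\<alpha>. a (?q c) * c \<alpha> + ?s \<alpha>)"
    unfolding IH homology_smult homology_add ..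
  also have "(\<lambda>\<alpha>. a (?q c) * c \<alpha> + ?s \<alpha>) = (\<Sum>c\<in>insert c C. fscale (a (?q c)) c)"
    using insert by (simp add: fun_eq_iff fscale_apply)
  finally have 1: "H.lincomb a (?q ` insert c C) = ?q (\<Sum>c\<in>insert c C. fscale (a (?q c)) c)" .
  have "(\<lambda>\<alpha>. a (?q c) * c \<alpha> + 1 * ?s \<alpha>) \<in> cycles i X"
    by (intro cycles_lin IH) (use insert in auto)
  also have "(\<lambda>\<alpha>. a (?q c) * c \<alpha> + 1 * ?s \<alpha>) = (\<Sum>c\<in>insert c C. fscale (a (?q c)) c)"
    using insert by (simp add: fun_eq_iff fscale_apply)
  finally show ?case using 1 by blast
qed

lemma subspace_cycles: "fv.subspace (cycles i X)"
proof (rule fv.subspaceI)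
  show "0 \<in> cycles i X" using zero_cycles by (simp add: zero_fun_def)
  show "c + e \<in> cycles i X" if "c \<in> cycles i X" "e \<in> cycles i X" for c e
    using cycles_lin[OF that, of 1 1] by (simp add: plus_fun_def)
  show "fscale a c \<in> cycles i X" if "c \<in> cycles i X" for a c
    using cycles_lin[OF that that, of a 0] by (simp add: fscale_def)
qed

lemma subspace_boundaries: "fv.subspace (boundaries i X)"
proof (rule fv.subspaceI)
  show "0 \<in> boundaries i X" using zero_boundaries by (simp add: zero_fun_def)
  show "c + e \<in> boundaries i X" if "c \<in> boundaries i X" "e \<in> boundaries i X" for c e
    using boundaries_lin[OF that, of 1 1] by (simp add: plus_fun_def)
  show "fscale a c \<in> boundaries i X" if "c \<in> boundaries i X" for a c
    using boundaries_lin[OF that that, of a 0] by (simp add: fscale_def)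
qed

text \<open>The cosets of a basis of the cycles modulo the boundaries form a basis of the homology
  space. From here on only dimensions of spaces of chains are used.\<close>

lemma betti_eq_dim_diff:
  fixes X :: "'v::linorder set set"
  assumes sub: "boundaries i X \<subseteq> (cycles i X :: ('v set \<Rightarrow> 'f::field) set)"
    and T: "finite T" "(cycles i X :: ('v set \<Rightarrow> 'f) set) \<subseteq> fv.span T"
  shows "betti TYPE('f) i X + fv.dim (boundaries i X :: ('v set \<Rightarrow> 'f) set) = fv.dim (cycles i X :: ('v set \<Rightarrow> 'f) set)"
proof -
  interpret H: vectorspace "class_ring :: 'f ring" "homology_space i X :: ('f, ('v set \<Rightarrow> 'f) set) module"
    by (rule vectorspace_homology_space)
  let ?Z = "cycles i X :: ('v set \<Rightarrow> 'f) set" and ?B = "boundaries i X :: ('v set \<Rightarrow> 'f) set"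
  let ?q = "\<lambda>z. chain_coset z ?B"
  obtain C where C: "finite C" "C \<subseteq> ?Z" "fv.dim ?Z = fv.dim ?B + card C"
    "\<And>v. v \<in> ?Z \<Longrightarrow> \<exists>a. v - (\<Sum>c\<in>C. fscale (a c) c) \<in> ?B"
    "\<And>a c. (\<Sum>c\<in>C. fscale (a c) c) \<in> ?B \<Longrightarrow> c \<in> C \<Longrightarrow> a c = 0"
    by (rule complement_basis[OF subspace_cycles subspace_boundaries sub T]) blast
  have eqI: "?q u = ?q z" if "u - z \<in> ?B" for u z
  proof -
    have sb: "fv.subspace ?B" by (rule subspace_boundaries)
    have "t - z \<in> ?B \<longleftrightarrow> t - u \<in> ?B" for t
    proof
      assume "t - z \<in> ?B"
      from fv.subspace_diff[OF sb this that] show "t - u \<in> ?B" by simp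
    next
      assume "t - u \<in> ?B"
      from fv.subspace_add[OF sb this that] show "t - z \<in> ?B" by simp
    qed
    then show ?thesis
      by (auto simp: set_eq_iff chain_coset_iff fun_diff_def)
  qed
  have eqD: "u - z \<in> ?B" if "?q u = ?q z" for u z
  proof -
    have "u \<in> ?q u" by (simp add: chain_coset_iff zero_boundaries)
    then show ?thesis using that by (simp add: chain_coset_iff fun_diff_def)
  qed
  have inj: "inj_on ?q C"
  proof (rule inj_onI, rule ccontr)
    fix u z assume uz: "u \<in> C" "z \<in> C" "?q u = ?q z" "u \<noteq> z"
    \<comment> \<open>Two representatives of one coset would be dependent modulo the boundaries.\<close>
    define a where "a = (\<lambda>c. if c = u then 1 else if c = z then - 1 else (0::'f))"
    have "(\<Sum>c\<in>C. fscale (a c) c) = (\<Sum>c\<in>{u, z}. fscale (a c) c)"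
      using C uz by (intro sum.mono_neutral_right) (auto simp: a_def fun_eq_iff fscale_apply)
    also have "\<dots> = u - z" using uz by (auto simp: a_def fun_eq_iff fscale_apply)
    also have "\<dots> \<in> ?B" using eqD uz by blast
    finally have "a u = 0" using C(5) uz by blast
    then show False by (simp add: a_def)
  qed
  note lc = homology_lincomb[OF C(1,2) inj]
  have "H.basis (?q ` C)"
    unfolding H.basis_def
  proof (intro conjI)
    show sub: "?q ` C \<subseteq> carrier (homology_space i X)"
      using C(2) by (auto simp: homology_carrier)
    show "H.lin_indpt (?q ` C)"
    proof (rule H.finite_lin_indpt2)
      show "finite (?q ` C)" using C by blast
      show "?q ` C \<subseteq> carrier (homology_space i X)" by (rule sub)
      fix a assume "H.lincomb a (?q ` C) = \<zero>\<^bsub>homology_space i X\<^esub>"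
      then have "?q (\<Sum>c\<in>C. fscale (a (?q c)) c) = ?q 0"
        using lc[of a] by (simp add: homology_zero zero_fun_def)
      from eqD[OF this] have "(\<Sum>c\<in>C. fscale (a (?q c)) c) \<in> ?B" by simp
      from C(5)[OF this] show "\<forall>v\<in>?q ` C. a v = \<zero>\<^bsub>class_ring\<^esub>"
        by auto
    qed
    show "H.gen_set (?q ` C)"
    proof
      show "H.span (?q ` C) \<subseteq> carrier (homology_space i X)"
        by (rule H.span_is_subset2[OF sub])
      show "carrier (homology_space i X) \<subseteq> H.span (?q ` C)"
      proof
        fix h assume "h \<in> carrier (homology_space i X :: ('f, ('v set \<Rightarrow> 'f) set) module)"
        then obtain z where z: "z \<in> ?Z" "h = ?q z" by (auto simp: homology_carrier)
        from C(4)[OF z(1)] obtain a where a: "z - (\<Sum>c\<in>C. fscale (a c) c) \<in> ?B" by blast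
        define b where "b = (\<lambda>h. a (the_inv_into C ?q h))"
        have "h = ?q (\<Sum>c\<in>C. fscale (a c) c)" using eqI a z by blast
        also have "(\<Sum>c\<in>C. fscale (a c) c) = (\<Sum>c\<in>C. fscale (b (?q c)) c)"
          using the_inv_into_f_f[OF inj] by (intro sum.cong refl) (simp add: b_def)
        also have "?q \<dots> = H.lincomb b (?q ` C)" by (rule conjunct1[OF lc, symmetric])
        finally show "h \<in> H.span (?q ` C)"
          unfolding H.span_def using C(1) by (intro CollectI exI[of _ b] exI[of _ "?q ` C"]) auto
      qed
    qed
  qed
  then have "H.dim = card (?q ` C)" using C by (intro H.dim_basis) auto
  then show ?thesis using C inj by (simp add: betti_def card_image)
qed

section \<open>Augmented simplicial homology\<close>

text \<open>Chains are graded by the number of vertices, starting with the empty face, so that degree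
  \<open>n\<close> computes reduced homology in dimension \<open>n - 1\<close>. With this grading dimension \<open>0\<close> behaves like
  every other one, and \<open>{{}}\<close> is an ordinary sphere, of dimension \<open>-1\<close>.\<close>

definition face_chains :: "nat \<Rightarrow> 'v set set \<Rightarrow> ('v set \<Rightarrow> 'f::field) set" where
  "face_chains n K = {c. \<forall>\<alpha>. c \<alpha> \<noteq> 0 \<longrightarrow> \<alpha> \<in> K \<and> card \<alpha> = n}"

text \<open>The sum runs over the support of the chain, so the boundary does not depend on an ambient
  complex; chains of nested complexes then share one boundary operator. For infinite support the sum
  would be \<open>0\<close> by default, which never happens for chains of a finite complex.\<close>

definition face_bdry :: "('v::linorder set \<Rightarrow> 'f::field) \<Rightarrow> 'v set \<Rightarrow> 'f" where
  "face_bdry c \<tau> = (\<Sum>v | v \<notin> \<tau> \<and> c (insert v \<tau>) \<noteq> 0. (-1) ^ card {w \<in> \<tau>. w < v} * c (insert v \<tau>))"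

definition face_cycles :: "nat \<Rightarrow> 'v::linorder set set \<Rightarrow> ('v set \<Rightarrow> 'f::field) set" where
  "face_cycles n K = {c \<in> face_chains n K. face_bdry c = 0}"

definition face_boundaries :: "nat \<Rightarrow> 'v::linorder set set \<Rightarrow> ('v set \<Rightarrow> 'f::field) set" where
  "face_boundaries n K = face_bdry ` face_chains (Suc n) K"

definition face_betti :: "'f::field itself \<Rightarrow> nat \<Rightarrow> 'v::linorder set set \<Rightarrow> nat" where
  "face_betti F n K = fv.dim (face_cycles n K :: ('v set \<Rightarrow> 'f) set) - fv.dim (face_boundaries n K :: ('v set \<Rightarrow> 'f) set)"

lemma simplicial_finite: "simplicial_complex K \<Longrightarrow> finite K"
  and simplicial_empty: "simplicial_complex K \<Longrightarrow> {} \<in> K"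
  and simplicial_face_finite: "simplicial_complex K \<Longrightarrow> \<alpha> \<in> K \<Longrightarrow> finite \<alpha>"
  and simplicial_subset: "simplicial_complex K \<Longrightarrow> \<alpha> \<in> K \<Longrightarrow> \<beta> \<subseteq> \<alpha> \<Longrightarrow> \<beta> \<in> K"
  by (auto simp: simplicial_complex_def)

lemma finite_vertices: "simplicial_complex K \<Longrightarrow> finite (vertices K)"
  by (auto simp: simplicial_complex_def vertices_def)

lemma face_chains_D: "c \<in> face_chains n K \<Longrightarrow> c \<alpha> \<noteq> 0 \<Longrightarrow> \<alpha> \<in> K \<and> card \<alpha> = n"
  by (simp add: face_chains_def)

lemma face_bdry_chain:
  assumes K: "simplicial_complex K" and c: "c \<in> face_chains n K"
  shows "face_bdry c \<tau> = (\<Sum>v\<in>vertices K - \<tau>. (-1) ^ card {w \<in> \<tau>. w < v} * c (insert v \<tau>))"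
  unfolding face_bdry_def
proof (rule sum.mono_neutral_left)
  show "finite (vertices K - \<tau>)" using finite_vertices[OF K] by simp
  show "{v. v \<notin> \<tau> \<and> c (insert v \<tau>) \<noteq> 0} \<subseteq> vertices K - \<tau>"
  proof safe
    fix v assume "c (insert v \<tau>) \<noteq> 0"
    then have "insert v \<tau> \<in> K" using face_chains_D[OF c] by blast
    then show "v \<in> vertices K" unfolding vertices_def by blast
  qed
qed auto

lemma subspace_face_chains: "fv.subspace (face_chains n K)"
proof (rule fv.subspaceI)
  show "c + e \<in> face_chains n K" if "c \<in> face_chains n K" "e \<in> face_chains n K" for c e
  proof -
    have "c \<alpha> \<noteq> 0 \<or> e \<alpha> \<noteq> 0" if "(c + e) \<alpha> \<noteq> 0" for \<alpha>
      using that by auto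
    then show ?thesis using that unfolding face_chains_def by blast
  qed
qed (auto simp: face_chains_def fscale_apply)

lemma face_bdry_lin:
  assumes K: "simplicial_complex K" and c: "c \<in> face_chains n K" and e: "e \<in> face_chains n K"
  shows face_bdry_add: "face_bdry (c + e) = face_bdry c + face_bdry e"
    and face_bdry_scale: "face_bdry (fscale a c) = fscale a (face_bdry c)"
    and face_bdry_diff: "face_bdry (c - e) = face_bdry c - face_bdry e"
proof -
  note s = subspace_face_chains[of n K]
  show "face_bdry (c + e) = face_bdry c + face_bdry e"
    by (rule ext) (simp add: face_bdry_chain[OF K fv.subspace_add[OF s c e]] face_bdry_chain[OF K c]
        face_bdry_chain[OF K e] algebra_simps sum.distrib)
  show "face_bdry (c - e) = face_bdry c - face_bdry e"
    by (rule ext) (simp add: face_bdry_chain[OF K fv.subspace_diff[OF s c e]] face_bdry_chain[OF K c]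
        face_bdry_chain[OF K e] algebra_simps sum_subtractf)
  show "face_bdry (fscale a c) = fscale a (face_bdry c)"
    by (rule ext) (simp add: face_bdry_chain[OF K fv.subspace_scale[OF s c]] face_bdry_chain[OF K c]
        fscale_apply sum_distrib_left algebra_simps)
qed

lemma face_bdry_zero: "face_bdry 0 = 0"
  by (rule ext) (simp add: face_bdry_def)

lemma face_bdry_in_chains:
  assumes K: "simplicial_complex K" and c: "c \<in> face_chains (Suc n) K"
  shows "face_bdry c \<in> face_chains n K"
  unfolding face_chains_def
proof (intro CollectI allI impI)
  fix \<tau> assume "face_bdry c \<tau> \<noteq> 0"
  then obtain v where v: "v \<notin> \<tau>" "c (insert v \<tau>) \<noteq> 0"
    unfolding face_bdry_def by (metis (mono_tags, lifting) mem_Collect_eq sum.neutral mult_zero_right)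
  have "insert v \<tau> \<in> K" "card (insert v \<tau>) = Suc n" using face_chains_D[OF c v(2)] by auto
  then show "\<tau> \<in> K \<and> card \<tau> = n"
    using simplicial_subset[OF K, of "insert v \<tau>" \<tau>] simplicial_face_finite[OF K, of "insert v \<tau>"] v by auto
qed

lemma face_bdry_chains_0:
  assumes K: "simplicial_complex K" and c: "c \<in> face_chains 0 K"
  shows "face_bdry c = 0"
proof (rule ext)
  fix \<tau>
  have "{v. v \<notin> \<tau> \<and> c (insert v \<tau>) \<noteq> 0} = {}"
    using face_chains_D[OF c] simplicial_face_finite[OF K] by fastforce
  then show "face_bdry c \<tau> = 0 \<tau>" unfolding face_bdry_def by (simp only: sum.empty zero_fun_apply)
qed

text \<open>Adding first \<open>u\<close> and then \<open>v\<close> to \<open>\<tau>\<close> gives the opposite sign to adding first \<open>v\<close> and then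
  \<open>u\<close>. The terms are paired by comparing \<open>u\<close> with \<open>v\<close>, which also works in characteristic two.\<close>

lemma face_bdry_twice:
  fixes K :: "'v::linorder set set" and c :: "'v set \<Rightarrow> 'f::field"
  assumes K: "simplicial_complex K" and c: "c \<in> face_chains n K"
  shows "face_bdry (face_bdry c) = 0"
proof (cases n)
  case 0
  then show ?thesis using face_bdry_chains_0 K c by (metis face_bdry_zero)
next
  case (Suc m)
  show ?thesis
  proof (rule ext)
    fix \<tau>
    let ?V = "vertices K - \<tau>"
    define s where "s = (\<lambda>(\<tau>::'v set) v. (-1::'f) ^ card {w \<in> \<tau>. w < v})"
    have finV: "finite ?V" using finite_vertices[OF K] by simp
    note face_bdry_m = face_bdry_chain[OF K face_bdry_in_chains[OF K c[unfolded Suc]]]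
    show "face_bdry (face_bdry c) \<tau> = 0 \<tau>"
    proof (cases "finite \<tau>")
      case False
      have "face_bdry c (insert v \<tau>) = 0" for v
        using face_chains_D[OF face_bdry_in_chains[OF K c[unfolded Suc]], of "insert v \<tau>"]
          simplicial_face_finite[OF K, of "insert v \<tau>"] False by auto
      then show ?thesis by (simp add: face_bdry_m)
    next
      case True
      define g where "g = (\<lambda>u v. s \<tau> u * (s (insert u \<tau>) v * c (insert v (insert u \<tau>))))"
      have anti: "g v u = - g u v" if "u \<in> ?V" "v \<in> ?V" "u < v" for u v
      proof -
        have "{w \<in> insert u \<tau>. w < v} = insert u {w \<in> \<tau>. w < v}" using that by auto
        then have "s (insert u \<tau>) v = - s \<tau> v" using True that by (simp add: s_def)
        moreover have "{w \<in> insert v \<tau>. w < u} = {w \<in> \<tau>. w < u}" using that by auto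
        then have "s (insert v \<tau>) u = s \<tau> u" by (simp add: s_def)
        ultimately show ?thesis unfolding g_def by (simp add: insert_commute[of u v])
      qed
      have "face_bdry (face_bdry c) \<tau> = (\<Sum>u\<in>?V. \<Sum>v\<in>?V - {u}. g u v)"
        unfolding face_bdry_m
      proof (intro sum.cong refl)
        fix u assume "u \<in> ?V"
        have "vertices K - insert u \<tau> = ?V - {u}" by blast
        then show "(-1) ^ card {w \<in> \<tau>. w < u} * face_bdry c (insert u \<tau>) = (\<Sum>v\<in>?V - {u}. g u v)"
          unfolding face_bdry_chain[OF K c] g_def s_def sum_distrib_left by (rule sum.cong) (rule refl)
      qed
      also have "\<dots> = (\<Sum>u\<in>?V. (\<Sum>v\<in>{v\<in>?V. u < v}. g u v) + (\<Sum>v\<in>{v\<in>?V. v < u}. g u v))"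
      proof (intro sum.cong refl)
        fix u assume "u \<in> ?V"
        have V: "?V - {u} = {v\<in>?V. u < v} \<union> {v\<in>?V. v < u}" by auto
        show "(\<Sum>v\<in>?V - {u}. g u v) = (\<Sum>v\<in>{v\<in>?V. u < v}. g u v) + (\<Sum>v\<in>{v\<in>?V. v < u}. g u v)"
          unfolding V by (rule sum.union_disjoint) (use finite_vertices[OF K] in auto)
      qed
      also have "\<dots> = (\<Sum>u\<in>?V. \<Sum>v\<in>{v\<in>?V. u < v}. g u v) + (\<Sum>u\<in>?V. \<Sum>v\<in>{v\<in>?V. v < u}. g u v)"
        by (rule sum.distrib)
      also have "(\<Sum>u\<in>?V. \<Sum>v\<in>{v\<in>?V. v < u}. g u v) = (\<Sum>u\<in>?V. \<Sum>v\<in>{v\<in>?V. u < v}. g v u)"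
        by (rule sum.swap_restrict[OF finV finV])
      also have "\<dots> = (\<Sum>u\<in>?V. \<Sum>v\<in>{v\<in>?V. u < v}. - g u v)"
        by (intro sum.cong refl) (simp add: anti)
      finally show ?thesis by (simp add: sum_negf)
    qed
  qed
qed

definition unit_chain :: "'v set \<Rightarrow> 'v set \<Rightarrow> 'f::field" where
  "unit_chain \<tau> = (\<lambda>\<sigma>. if \<sigma> = \<tau> then 1 else 0)"

lemma unit_chain_in_chains: "\<tau> \<in> K \<Longrightarrow> unit_chain \<tau> \<in> face_chains (card \<tau>) K"
  by (simp add: unit_chain_def face_chains_def)

lemma face_bdry_unit_chain_facet:
  assumes "v \<in> \<tau>" shows "face_bdry (unit_chain \<tau> :: _ \<Rightarrow> 'f::field) (\<tau> - {v}) \<noteq> 0"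
proof -
  have "{u. u \<notin> \<tau> - {v} \<and> unit_chain \<tau> (insert u (\<tau> - {v})) \<noteq> (0::'f)} = {v}"
    using assms by (auto simp: unit_chain_def split: if_splits)
  then show ?thesis using assms by (simp add: face_bdry_def unit_chain_def insert_absorb)
qed

lemma face_chains_span:
  assumes K: "simplicial_complex K"
  shows "face_chains n K \<subseteq> fv.span (unit_chain ` K)"
proof
  fix c :: "'a set \<Rightarrow> 'f::field" assume c: "c \<in> face_chains n K"
  have "c \<alpha> = (\<Sum>\<tau>\<in>K. fscale (c \<tau>) (unit_chain \<tau>)) \<alpha>" for \<alpha>
  proof -
    have "(\<Sum>\<tau>\<in>K. fscale (c \<tau>) (unit_chain \<tau>)) \<alpha> = (\<Sum>\<tau>\<in>K. c \<tau> * unit_chain \<tau> \<alpha>)"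
      using simplicial_finite[OF K] by (induction K rule: finite_induct) (auto simp: fscale_apply)
    also have "\<dots> = (\<Sum>\<tau>\<in>K. if \<tau> = \<alpha> then c \<alpha> else 0)"
      by (intro sum.cong) (auto simp: unit_chain_def)
    also have "\<dots> = c \<alpha>"
      using face_chains_D[OF c, of \<alpha>] simplicial_finite[OF K] by auto
    finally show ?thesis by simp
  qed
  then have "c = (\<Sum>\<tau>\<in>K. fscale (c \<tau>) (unit_chain \<tau>))" by blast
  also have "\<dots> \<in> fv.span (unit_chain ` K)"
    by (intro fv.span_sum fv.span_scale fv.span_base) auto
  finally show "c \<in> fv.span (unit_chain ` K)" .
qed

lemma subspace_face_cycles:
  assumes K: "simplicial_complex K" shows "fv.subspace (face_cycles n K)"
proof (rule fv.subspaceI)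
  note s = subspace_face_chains[of n K]
  show "0 \<in> face_cycles n K" by (simp add: face_cycles_def fv.subspace_0[OF s] face_bdry_zero)
  show "c + e \<in> face_cycles n K" if "c \<in> face_cycles n K" "e \<in> face_cycles n K" for c e
    using that by (auto simp: face_cycles_def fv.subspace_add[OF s] face_bdry_add[OF K])
  show "fscale a c \<in> face_cycles n K" if "c \<in> face_cycles n K" for a c
    using that by (auto simp: face_cycles_def fv.subspace_scale[OF s] face_bdry_scale[OF K])
qed

lemma subspace_face_boundaries:
  assumes K: "simplicial_complex K" shows "fv.subspace (face_boundaries n K)"
proof (rule fv.subspaceI)
  note s = subspace_face_chains[of "Suc n" K]
  show "0 \<in> face_boundaries n K"
    unfolding face_boundaries_def by (rule image_eqI[of _ _ 0]) (simp_all add: fv.subspace_0[OF s] face_bdry_zero)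
  show "c + e \<in> face_boundaries n K" if "c \<in> face_boundaries n K" "e \<in> face_boundaries n K" for c e
  proof -
    from that obtain c' e' where *: "c' \<in> face_chains (Suc n) K" "e' \<in> face_chains (Suc n) K"
      "c = face_bdry c'" "e = face_bdry e'" by (auto simp: face_boundaries_def)
    show ?thesis unfolding face_boundaries_def
      by (rule image_eqI[of _ _ "c' + e'"]) (simp_all add: * face_bdry_add[OF K *(1,2)] fv.subspace_add[OF s])
  qed
  show "fscale a c \<in> face_boundaries n K" if "c \<in> face_boundaries n K" for a c
  proof -
    from that obtain c' where *: "c' \<in> face_chains (Suc n) K" "c = face_bdry c'" by (auto simp: face_boundaries_def)
    show ?thesis unfolding face_boundaries_def
      by (rule image_eqI[of _ _ "fscale a c'"]) (simp_all add: * face_bdry_scale[OF K *(1) *(1)] fv.subspace_scale[OF s])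
  qed
qed

lemma face_boundaries_subset_cycles:
  assumes K: "simplicial_complex K" shows "face_boundaries n K \<subseteq> face_cycles n K"
  using face_bdry_in_chains[OF K] face_bdry_twice[OF K] by (auto simp: face_boundaries_def face_cycles_def)

lemma face_cycles_span:
  assumes K: "simplicial_complex K"
  shows "face_cycles n K \<subseteq> fv.span (unit_chain ` K)"
proof
  fix c :: "'a set \<Rightarrow> 'f::field" assume "c \<in> face_cycles n K"
  then have "c \<in> face_chains n K" by (simp add: face_cycles_def)
  with face_chains_span[OF K, of n] show "c \<in> fv.span (unit_chain ` K)" by (rule subsetD)
qed

lemma face_betti_add_dim:
  fixes K :: "'v::linorder set set"
  assumes K: "simplicial_complex K"
  shows "face_betti TYPE('f::field) n K + fv.dim (face_boundaries n K :: ('v set \<Rightarrow> 'f) set) = fv.dim (face_cycles n K :: ('v set \<Rightarrow> 'f) set)"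
proof -
  have "fv.dim (face_boundaries n K :: ('v set \<Rightarrow> 'f) set) \<le> fv.dim (face_cycles n K :: ('v set \<Rightarrow> 'f) set)"
  proof (rule dim_mono_finite)
    show "fv.subspace (face_cycles n K :: ('v set \<Rightarrow> 'f) set)" by (rule subspace_face_cycles[OF K])
    show "fv.subspace (face_boundaries n K :: ('v set \<Rightarrow> 'f) set)" by (rule subspace_face_boundaries[OF K])
    show "face_boundaries n K \<subseteq> (face_cycles n K :: ('v set \<Rightarrow> 'f) set)" by (rule face_boundaries_subset_cycles[OF K])
    show "finite (unit_chain ` K :: ('v set \<Rightarrow> 'f) set)" by (rule finite_imageI[OF simplicial_finite[OF K]])
    show "face_cycles n K \<subseteq> fv.span (unit_chain ` K :: ('v set \<Rightarrow> 'f) set)" by (rule face_cycles_span[OF K])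
  qed
  then show ?thesis by (simp add: face_betti_def)
qed

section \<open>Attaching one face\<close>

lemma face_chains_mono: "K \<subseteq> L \<Longrightarrow> face_chains n K \<subseteq> face_chains n L"
  unfolding face_chains_def by blast

lemma face_chains_insert_other: "n \<noteq> card \<tau> \<Longrightarrow> face_chains n (insert \<tau> K) = face_chains n K"
  unfolding face_chains_def by blast

lemma face_chains_insert_reduce:
  assumes c: "c \<in> face_chains n (insert \<tau> K)" and n: "n = card \<tau>"
  shows "c - fscale (c \<tau>) (unit_chain \<tau>) \<in> face_chains n K"
  unfolding face_chains_def
proof (intro CollectI allI impI)
  fix \<alpha> assume a: "(c - fscale (c \<tau>) (unit_chain \<tau>)) \<alpha> \<noteq> 0"
  then have "\<alpha> \<noteq> \<tau>" by (auto simp: fscale_apply unit_chain_def)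
  then have "c \<alpha> \<noteq> 0" using a by (auto simp: fscale_apply unit_chain_def)
  then show "\<alpha> \<in> K \<and> card \<alpha> = n" using face_chains_D[OF c] \<open>\<alpha> \<noteq> \<tau>\<close> by blast
qed

lemma face_chains_trivial:
  assumes "\<And>\<alpha>. \<alpha> \<in> K \<Longrightarrow> card \<alpha> \<noteq> n" shows "face_chains n K = {0}"
proof -
  have "c = 0" if "c \<in> face_chains n K" for c :: "'a set \<Rightarrow> 'b"
    using face_chains_D[OF that] assms by (fastforce simp: fun_eq_iff)
  moreover have "0 \<in> face_chains n K" by (rule fv.subspace_0[OF subspace_face_chains])
  ultimately show ?thesis by blast
qed

lemma face_boundaries_trivial:
  fixes K :: "'v::linorder set set"
  assumes "\<And>\<alpha>. \<alpha> \<in> K \<Longrightarrow> card \<alpha> \<noteq> Suc n"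
  shows "face_boundaries n K = ({0} :: ('v set \<Rightarrow> 'f::field) set)"
proof -
  have "face_chains (Suc n) K = ({0} :: ('v set \<Rightarrow> 'f) set)" by (rule face_chains_trivial) (rule assms)
  then show ?thesis unfolding face_boundaries_def by (simp add: face_bdry_zero)
qed

text \<open>If the boundary of \<open>\<tau>\<close> already bounds a chain \<open>b\<close> of \<open>K\<close>, then \<open>\<tau> - b\<close> is a new cycle, and
  the boundaries stay the same. Otherwise no new cycle can involve \<open>\<tau>\<close>, and the boundary of \<open>\<tau>\<close> is
  one new boundary.\<close>

lemma
  fixes K :: "'v::linorder set set"
  assumes K: "simplicial_complex K" and K': "simplicial_complex (insert \<tau> K)"
    and \<tau>: "\<tau> \<notin> K" "card \<tau> = Suc n"
  shows attach_creates: "face_bdry (unit_chain \<tau> :: _ \<Rightarrow> 'f::field) \<in> face_boundaries n K \<Longrightarrow>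
      face_betti TYPE('f) m (insert \<tau> K) = face_betti TYPE('f) m K + (if m = Suc n then 1 else 0)"
    and attach_kills: "face_bdry (unit_chain \<tau> :: _ \<Rightarrow> 'f::field) \<notin> face_boundaries n K \<Longrightarrow>
      face_betti TYPE('f) m (insert \<tau> K) + (if m = n then 1 else 0) = face_betti TYPE('f) m K"
proof -
  let ?L = "insert \<tau> K"
  let ?e = "unit_chain \<tau> :: 'v set \<Rightarrow> 'f"
  let ?C = "\<lambda>m K. face_chains m K :: ('v set \<Rightarrow> 'f) set"
  let ?Z = "\<lambda>m K. face_cycles m K :: ('v set \<Rightarrow> 'f) set"
  let ?B = "\<lambda>m K. face_boundaries m K :: ('v set \<Rightarrow> 'f) set"
  have e: "?e \<in> ?C (Suc n) ?L" using unit_chain_in_chains[of \<tau> ?L] \<tau> by simp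
  have CKL: "?C (Suc n) K \<subseteq> ?C (Suc n) ?L" by (rule face_chains_mono) blast
  have C: "?C m ?L = ?C m K" if "m \<noteq> Suc n" for m
    using face_chains_insert_other that \<tau> by metis
  have Z: "?Z m ?L = ?Z m K" if "m \<noteq> Suc n" for m
    unfolding face_cycles_def C[OF that] ..
  have B: "?B m ?L = ?B m K" if "m \<noteq> n" for m
    unfolding face_boundaries_def using C[of "Suc m"] that by simp
  have red: "c - fscale (c \<tau>) ?e \<in> ?C (Suc n) K" if "c \<in> ?C (Suc n) ?L" for c
    by (rule face_chains_insert_reduce[OF that]) (simp add: \<tau>)
  have delred: "face_bdry (c - fscale (c \<tau>) ?e) = face_bdry c - fscale (c \<tau>) (face_bdry ?e)" if "c \<in> ?C (Suc n) ?L" for c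
    using face_bdry_diff[OF K' that fv.subspace_scale[OF subspace_face_chains e]] face_bdry_scale[OF K' e e] by simp
  note dK = face_betti_add_dim[OF K, where 'f = 'f] and dL = face_betti_add_dim[OF K', where 'f = 'f]
  have fin: "finite (unit_chain ` K :: ('v set \<Rightarrow> 'f) set)"
    by (rule finite_imageI[OF simplicial_finite[OF K]])
  {
    assume x: "face_bdry ?e \<in> ?B n K"
    then obtain b where b: "b \<in> ?C (Suc n) K" "face_bdry ?e = face_bdry b" by (auto simp: face_boundaries_def)
    have B': "?B n ?L = ?B n K"
    proof
      show "?B n K \<subseteq> ?B n ?L" unfolding face_boundaries_def using CKL by blast
      show "?B n ?L \<subseteq> ?B n K"
      proof
        fix y assume "y \<in> ?B n ?L"
        then obtain c where c: "c \<in> ?C (Suc n) ?L" "y = face_bdry c" by (auto simp: face_boundaries_def)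
        have "y = face_bdry (c - fscale (c \<tau>) ?e) + fscale (c \<tau>) (face_bdry ?e)"
          unfolding delred[OF c(1)] c(2) by simp
        moreover have "face_bdry (c - fscale (c \<tau>) ?e) \<in> ?B n K"
          unfolding face_boundaries_def using red[OF c(1)] by blast
        ultimately show "y \<in> ?B n K"
          using fv.subspace_add[OF subspace_face_boundaries[OF K]] fv.subspace_scale[OF subspace_face_boundaries[OF K] x]
          by metis
      qed
    qed
    have Z': "fv.dim (?Z (Suc n) ?L) = Suc (fv.dim (?Z (Suc n) K))"
    proof (rule dim_one_more[where x = "?e - b"])
      show "fv.subspace (?Z (Suc n) K)" by (rule subspace_face_cycles[OF K])
      show "?Z (Suc n) K \<subseteq> ?Z (Suc n) ?L" unfolding face_cycles_def using CKL by blast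
      show "finite (unit_chain ` K :: ('v set \<Rightarrow> 'f) set)" by (rule fin)
      show "?Z (Suc n) K \<subseteq> fv.span (unit_chain ` K)" by (rule face_cycles_span[OF K])
      have bL: "b \<in> ?C (Suc n) ?L" using b CKL by blast
      have "face_bdry (?e - b) = 0" using face_bdry_diff[OF K' e bL] b by simp
      then show eb: "?e - b \<in> ?Z (Suc n) ?L"
        unfolding face_cycles_def using fv.subspace_diff[OF subspace_face_chains e bL] by blast
      have bt: "b \<tau> = 0" using face_chains_D[OF b(1), of \<tau>] \<tau> by blast
      then have "(?e - b) \<tau> \<noteq> 0" by (simp add: unit_chain_def)
      then show "?e - b \<notin> ?Z (Suc n) K"
        unfolding face_cycles_def using face_chains_D[of "?e - b" "Suc n" K \<tau>] \<tau> by blast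
      fix c assume c: "c \<in> ?Z (Suc n) ?L"
      then have c': "c \<in> ?C (Suc n) ?L" "face_bdry c = 0" by (auto simp: face_cycles_def)
      have "c - fscale (c \<tau>) (?e - b) = (c - fscale (c \<tau>) ?e) + fscale (c \<tau>) b"
        by (simp add: fv.scale_right_diff_distrib)
      also have "\<dots> \<in> ?C (Suc n) K"
        by (intro fv.subspace_add[OF subspace_face_chains] fv.subspace_scale[OF subspace_face_chains] red c' b)
      finally have "c - fscale (c \<tau>) (?e - b) \<in> ?C (Suc n) K" .
      moreover have "c - fscale (c \<tau>) (?e - b) \<in> ?Z (Suc n) ?L"
        by (intro fv.subspace_diff[OF subspace_face_cycles[OF K']] fv.subspace_scale[OF subspace_face_cycles[OF K']] c eb)
      ultimately show "\<exists>a. c - fscale a (?e - b) \<in> ?Z (Suc n) K"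
        unfolding face_cycles_def by blast
    qed
    have Bm: "?B m ?L = ?B m K" using B B' by metis
    show "face_betti TYPE('f) m ?L = face_betti TYPE('f) m K + (if m = Suc n then 1 else 0)"
    proof (cases "m = Suc n")
      case True
      then show ?thesis using dK[of m] dL[of m] Bm Z' by simp
    next
      case False
      then show ?thesis using dK[of m] dL[of m] Bm Z by simp
    qed
  }
  {
    assume x: "face_bdry ?e \<notin> ?B n K"
    have tau0: "c \<tau> = 0" if c: "c \<in> ?Z (Suc n) ?L" for c
    proof (rule ccontr)
      assume nz: "c \<tau> \<noteq> 0"
      have c': "c \<in> ?C (Suc n) ?L" "face_bdry c = 0" using c by (auto simp: face_cycles_def)
      have "face_bdry (c - fscale (c \<tau>) ?e) \<in> ?B n K"
        unfolding face_boundaries_def using red[OF c'(1)] by blast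
      then have "- fscale (c \<tau>) (face_bdry ?e) \<in> ?B n K" using delred[OF c'(1)] c' by simp
      from fv.subspace_scale[OF subspace_face_boundaries[OF K] this, of "- inverse (c \<tau>)"]
      show False using x nz by simp
    qed
    have Z': "?Z (Suc n) ?L = ?Z (Suc n) K"
    proof
      show "?Z (Suc n) K \<subseteq> ?Z (Suc n) ?L" unfolding face_cycles_def using CKL by blast
      show "?Z (Suc n) ?L \<subseteq> ?Z (Suc n) K"
      proof
        fix c assume c: "c \<in> ?Z (Suc n) ?L"
        then have c': "c \<in> ?C (Suc n) ?L" "face_bdry c = 0" by (auto simp: face_cycles_def)
        have "c = c - fscale (c \<tau>) ?e" using tau0[OF c] by simp
        also have "\<dots> \<in> ?C (Suc n) K" by (rule red[OF c'(1)])
        finally show "c \<in> ?Z (Suc n) K" using c' by (simp add: face_cycles_def)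
      qed
    qed
    have B': "fv.dim (?B n ?L) = Suc (fv.dim (?B n K))"
    proof (rule dim_one_more[where x = "face_bdry ?e"])
      show "fv.subspace (?B n K)" by (rule subspace_face_boundaries[OF K])
      show "?B n K \<subseteq> ?B n ?L" unfolding face_boundaries_def using CKL by blast
      show "finite (unit_chain ` K :: ('v set \<Rightarrow> 'f) set)" by (rule fin)
      show "?B n K \<subseteq> fv.span (unit_chain ` K)"
        using face_boundaries_subset_cycles[OF K] face_cycles_span[OF K] by (rule order_trans)
      show "face_bdry ?e \<in> ?B n ?L" unfolding face_boundaries_def using e by blast
      show "face_bdry ?e \<notin> ?B n K" by (rule x)
      fix y assume "y \<in> ?B n ?L"
      then obtain c where c: "c \<in> ?C (Suc n) ?L" "y = face_bdry c" by (auto simp: face_boundaries_def)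
      have "y - fscale (c \<tau>) (face_bdry ?e) = face_bdry (c - fscale (c \<tau>) ?e)"
        unfolding delred[OF c(1)] c(2) ..
      also have "\<dots> \<in> ?B n K"
        unfolding face_boundaries_def using red[OF c(1)] by blast
      finally show "\<exists>a. y - fscale a (face_bdry ?e) \<in> ?B n K" by blast
    qed
    have Zm: "?Z m ?L = ?Z m K" using Z Z' by metis
    show "face_betti TYPE('f) m ?L + (if m = n then 1 else 0) = face_betti TYPE('f) m K"
    proof (cases "m = n")
      case True
      then show ?thesis using dK[of m] dL[of m] Zm B' by simp
    next
      case False
      then show ?thesis using dK[of m] dL[of m] Zm B by simp
    qed
  }
qed

text \<open>An elementary expansion. The boundary of \<open>insert v \<sigma>\<close> is a cycle that involves \<open>\<sigma>\<close>, so
  attaching \<open>\<sigma>\<close> creates a class; it does not bound before \<open>insert v \<sigma>\<close> is there, so attaching that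
  kills a class again.\<close>

lemma face_betti_expansion:
  fixes K :: "'v::linorder set set"
  assumes K: "simplicial_complex K" and L: "simplicial_complex (insert (insert v \<sigma>) (insert \<sigma> K))"
    and \<sigma>: "\<sigma> \<notin> K" "v \<notin> \<sigma>"
  shows "face_betti TYPE('f::field) m (insert (insert v \<sigma>) (insert \<sigma> K)) = face_betti TYPE('f) m K"
proof -
  let ?t = "insert v \<sigma>" and ?M = "insert \<sigma> K"
  let ?x = "face_bdry (unit_chain ?t) :: 'v set \<Rightarrow> 'f"
  have fs: "finite \<sigma>" using simplicial_face_finite[OF L] by blast
  have ne: "\<sigma> \<noteq> {}" using \<sigma> simplicial_empty[OF K] by blast
  then obtain n where n: "card \<sigma> = Suc n" using fs by (metis card_eq_0_iff not0_implies_Suc)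
  have t: "?t \<notin> ?M" "card ?t = Suc (Suc n)"
    using \<sigma> fs n simplicial_subset[OF K, of ?t \<sigma>] by auto
  have M: "simplicial_complex ?M"
    unfolding simplicial_complex_def
  proof (intro conjI ballI allI impI)
    show "finite ?M" using simplicial_finite[OF K] by simp
    show "{} \<in> ?M" using simplicial_empty[OF K] by simp
    fix \<alpha> assume a: "\<alpha> \<in> ?M"
    then show "finite \<alpha>" using simplicial_face_finite[OF L] by blast
    fix \<beta> assume b: "\<beta> \<subseteq> \<alpha>"
    have "\<beta> \<in> insert ?t ?M" using simplicial_subset[OF L _ b] a by blast
    moreover have "\<beta> \<noteq> ?t" using a b t simplicial_subset[OF K, of \<alpha> ?t] \<sigma> by blast
    ultimately show "\<beta> \<in> ?M" by blast
  qed
  have xs: "?x \<sigma> \<noteq> 0" using face_bdry_unit_chain_facet[of v ?t] \<sigma> by auto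
  have "?x \<in> face_chains (Suc n) (insert ?t ?M)"
    using face_bdry_in_chains[OF L] unit_chain_in_chains[of ?t "insert ?t ?M"] t by simp
  moreover have "face_chains (Suc n) (insert ?t ?M) = (face_chains (Suc n) ?M :: ('v set \<Rightarrow> 'f) set)"
    by (rule face_chains_insert_other) (simp add: t)
  ultimately have "?x \<in> face_chains (Suc n) ?M" by (rule subst[rotated])
  moreover have "face_bdry ?x = 0"
    using face_bdry_twice[OF L unit_chain_in_chains[of ?t "insert ?t ?M"]] by simp
  ultimately have xZ: "?x \<in> face_cycles (Suc n) ?M" by (simp add: face_cycles_def)
  have cre: "(face_bdry (unit_chain \<sigma>) :: 'v set \<Rightarrow> 'f) \<in> face_boundaries n K"
  proof -
    have xM: "?x \<in> face_chains (Suc n) ?M" using xZ by (simp add: face_cycles_def)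
    have "?x - fscale (?x \<sigma>) (unit_chain \<sigma>) \<in> face_chains (Suc n) K"
      by (rule face_chains_insert_reduce[OF xM n[symmetric]])
    then have 1: "face_bdry (?x - fscale (?x \<sigma>) (unit_chain \<sigma>)) \<in> face_boundaries n K"
      unfolding face_boundaries_def by blast
    have eM: "unit_chain \<sigma> \<in> face_chains (Suc n) ?M" using unit_chain_in_chains[of \<sigma> ?M] n by simp
    have "face_bdry (?x - fscale (?x \<sigma>) (unit_chain \<sigma>)) = face_bdry ?x - fscale (?x \<sigma>) (face_bdry (unit_chain \<sigma>))"
      using face_bdry_diff[OF M xM fv.subspace_scale[OF subspace_face_chains eM]] face_bdry_scale[OF M eM eM] by simp
    also have "face_bdry ?x = 0" by fact
    finally have "- fscale (?x \<sigma>) (face_bdry (unit_chain \<sigma>)) \<in> face_boundaries n K"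
      using 1 by (simp only: diff_0)
    from fv.subspace_scale[OF subspace_face_boundaries[OF K] this, of "- inverse (?x \<sigma>)"]
    show ?thesis using xs by simp
  qed
  have C2: "(face_chains (Suc (Suc n)) ?M :: ('v set \<Rightarrow> 'f) set) = face_chains (Suc (Suc n)) K"
    by (rule face_chains_insert_other) (simp add: n)
  have kil: "?x \<notin> face_boundaries (Suc n) ?M"
  proof
    assume "?x \<in> face_boundaries (Suc n) ?M"
    then have "?x \<in> face_boundaries (Suc n) K"
      unfolding face_boundaries_def C2 .
    then have "?x \<in> face_chains (Suc n) K"
      using face_boundaries_subset_cycles[OF K] by (auto simp: face_cycles_def)
    then show False using face_chains_D[of ?x "Suc n" K \<sigma>] xs \<sigma> by blast
  qed
  show ?thesis
    using attach_creates[OF K M \<sigma>(1) n cre, of m] attach_kills[OF M L t kil, of m] by simp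
qed

lemma simplicial_Un_Pow: "simplicial_complex K \<Longrightarrow> finite W \<Longrightarrow> simplicial_complex (K \<union> Pow W)"
  unfolding simplicial_complex_def by (auto intro: finite_subset)

lemma simplicial_Pow: "finite W \<Longrightarrow> simplicial_complex (Pow W)"
  unfolding simplicial_complex_def by (auto intro: finite_subset)

text \<open>The faces of \<open>W\<close> that contain \<open>\<beta>\<close> can be paired by adding or removing a fixed vertex of
  \<open>W - \<beta>\<close>, and inserted pair by pair. The induction splits this interval of faces at a second vertex
  \<open>c\<close>: the faces without \<open>c\<close> come first.\<close>

lemma face_betti_Un_Pow:
  fixes K :: "'v::linorder set set"
  assumes "simplicial_complex K" "finite W" "\<beta> \<subset> W" "\<And>\<gamma>. \<gamma> \<subseteq> W \<Longrightarrow> \<gamma> \<in> K \<longleftrightarrow> \<not> \<beta> \<subseteq> \<gamma>"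
  shows "face_betti TYPE('f::field) m (K \<union> Pow W) = face_betti TYPE('f) m K"
  using assms
proof (induction "card (W - \<beta>)" arbitrary: K W \<beta> rule: less_induct)
  case less
  note K = less.prems(1) and W = less.prems(2) and \<beta> = less.prems(3) and mem = less.prems(4)
  obtain a where a: "a \<in> W" "a \<notin> \<beta>" using \<beta> by blast
  show ?case
  proof (cases "W = insert a \<beta>")
    case True
    have "\<gamma> = \<beta> \<or> \<gamma> = insert a \<beta>" if "\<gamma> \<subseteq> W" "\<beta> \<subseteq> \<gamma>" for \<gamma> using that True by blast
    then have eq: "K \<union> Pow W = insert (insert a \<beta>) (insert \<beta> K)" using mem True by blast
    have "simplicial_complex (insert (insert a \<beta>) (insert \<beta> K))"
      using simplicial_Un_Pow[OF K W] eq by simp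
    moreover have "\<beta> \<notin> K" using mem \<beta> by blast
    ultimately show ?thesis unfolding eq using face_betti_expansion[OF K] a by blast
  next
    case False
    then obtain c where c: "c \<in> W" "c \<notin> \<beta>" "c \<noteq> a" using a \<beta> by blast
    let ?W = "W - {c}" and ?K = "K \<union> Pow (W - {c})"
    have "?W - \<beta> \<subset> W - \<beta>" using c by blast
    then have l1: "card (?W - \<beta>) < card (W - \<beta>)" using W by (simp add: psubset_card_mono)
    have "W - insert c \<beta> \<subset> W - \<beta>" using c by blast
    then have l2: "card (W - insert c \<beta>) < card (W - \<beta>)" using W by (simp add: psubset_card_mono)
    have 1: "face_betti TYPE('f) m ?K = face_betti TYPE('f) m K"
    proof (rule less.hyps[OF l1 K])
      show "finite ?W" using W by simp
      show "\<beta> \<subset> ?W" using a c \<beta> by blast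
      show "\<And>\<gamma>. \<gamma> \<subseteq> ?W \<Longrightarrow> \<gamma> \<in> K \<longleftrightarrow> \<not> \<beta> \<subseteq> \<gamma>" using mem by blast
    qed
    have "face_betti TYPE('f) m (?K \<union> Pow W) = face_betti TYPE('f) m ?K"
    proof (rule less.hyps[OF l2 _ W])
      show "simplicial_complex ?K" using simplicial_Un_Pow[OF K] W by simp
      show "insert c \<beta> \<subset> W" using a c \<beta> by blast
      show "\<And>\<gamma>. \<gamma> \<subseteq> W \<Longrightarrow> \<gamma> \<in> ?K \<longleftrightarrow> \<not> insert c \<beta> \<subseteq> \<gamma>" using mem by blast
    qed
    moreover have "?K \<union> Pow W = K \<union> Pow W" by blast
    ultimately show ?thesis using 1 by simp
  qed
qed

lemma dim_zero: "fv.dim {0} = 0"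
  by (rule fv.dim_unique[of "{}"]) (auto simp: fv.independent_empty)

lemma simplicial_singleton: "simplicial_complex {{}}"
  by (simp add: simplicial_complex_def)

lemma vertex_exists:
  assumes K: "simplicial_complex K" and ne: "K \<noteq> {{}}"
  obtains v where "{v} \<in> K"
proof -
  obtain \<alpha> v where "\<alpha> \<in> K" "v \<in> \<alpha>" using ne simplicial_empty[OF K] by blast
  then have "{v} \<in> K" using simplicial_subset[OF K, of \<alpha> "{v}"] by blast
  then show thesis by (rule that)
qed

lemma face_chains_0_eq:
  assumes "simplicial_complex K" "c \<in> face_chains 0 K" shows "c = fscale (c {}) (unit_chain {})"
proof (rule ext)
  fix \<alpha> show "c \<alpha> = fscale (c {}) (unit_chain {}) \<alpha>"
    using face_chains_D[OF assms(2), of \<alpha>] simplicial_face_finite[OF assms(1), of \<alpha>]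
    by (auto simp: fscale_apply unit_chain_def)
qed

lemma face_betti_empty_complex: "face_betti TYPE('f::field) m {{} :: 'v::linorder set} = (if m = 0 then 1 else 0)"
proof -
  let ?K = "{{} :: 'v set}"
  have B: "face_boundaries m ?K = ({0} :: ('v set \<Rightarrow> 'f) set)" by (rule face_boundaries_trivial) auto
  have Z: "fv.dim (face_cycles m ?K :: ('v set \<Rightarrow> 'f) set) = (if m = 0 then 1 else 0)"
  proof (cases "m = 0")
    case False
    then have "face_chains m ?K = ({0} :: ('v set \<Rightarrow> 'f) set)" by (intro face_chains_trivial) auto
    then have "face_cycles m ?K = ({0} :: ('v set \<Rightarrow> 'f) set)"
      unfolding face_cycles_def using face_bdry_zero by auto
    then show ?thesis using False by (simp add: dim_zero)
  next
    case True
    have ee: "unit_chain {} \<in> (face_chains 0 ?K :: ('v set \<Rightarrow> 'f) set)" using unit_chain_in_chains[of "{}" ?K] by simp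
    have "fv.dim (face_cycles 0 ?K :: ('v set \<Rightarrow> 'f) set) = Suc (fv.dim ({0} :: ('v set \<Rightarrow> 'f) set))"
    proof (rule dim_one_more[where x = "unit_chain {}"])
      show "fv.subspace ({0} :: ('v set \<Rightarrow> 'f) set)" by (simp add: fv.subspace_single_0)
      show "{0} \<subseteq> (face_cycles 0 ?K :: ('v set \<Rightarrow> 'f) set)"
        using fv.subspace_0[OF subspace_face_cycles[OF simplicial_singleton]] by blast
      show "finite ({} :: ('v set \<Rightarrow> 'f) set)" by simp
      show "{0} \<subseteq> fv.span ({} :: ('v set \<Rightarrow> 'f) set)" by simp
      show "unit_chain {} \<in> (face_cycles 0 ?K :: ('v set \<Rightarrow> 'f) set)"
        unfolding face_cycles_def using ee face_bdry_chains_0[OF simplicial_singleton ee] by blast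
      have "(unit_chain {} :: 'v set \<Rightarrow> 'f) {} \<noteq> 0" by (simp add: unit_chain_def)
      then show "unit_chain {} \<notin> ({0} :: ('v set \<Rightarrow> 'f) set)" by force
      fix c :: "'v set \<Rightarrow> 'f" assume "c \<in> face_cycles 0 ?K"
      then have "c \<in> face_chains 0 ?K" by (simp add: face_cycles_def)
      from face_chains_0_eq[OF simplicial_singleton this] have "c - fscale (c {}) (unit_chain {}) = 0" by simp
      then show "\<exists>a. c - fscale a (unit_chain {}) \<in> {0}" by blast
    qed
    then show ?thesis using True by (simp add: dim_zero)
  qed
  show ?thesis using face_betti_add_dim[OF simplicial_singleton, where 'f = 'f and n = m and ?'v = 'v] B Z by (simp add: dim_zero)
qed

text \<open>A simplex grows from a point one vertex at a time; each new vertex \<open>x\<close> fills the interval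
  above \<open>{x}\<close>.\<close>

lemma face_betti_Pow:
  fixes A :: "'v::linorder set"
  assumes "finite A" "A \<noteq> {}" shows "face_betti TYPE('f::field) m (Pow A) = 0"
  using assms
proof (induction A rule: finite_ne_induct)
  case (singleton v)
  have eq: "Pow {v} = insert {v} {{}}" by auto
  have "face_bdry (unit_chain {v} :: _ \<Rightarrow> 'f) {} \<noteq> 0" using face_bdry_unit_chain_facet[of v "{v}"] by simp
  then have "face_bdry (unit_chain {v} :: _ \<Rightarrow> 'f) \<notin> face_boundaries 0 {{}}"
    by (subst face_boundaries_trivial) (auto simp: zero_fun_def)
  moreover have "simplicial_complex (insert {v} {{}})" using simplicial_Pow[of "{v}"] eq by simp
  ultimately have "face_betti TYPE('f) m (insert {v} {{}}) + (if m = 0 then 1 else 0) = face_betti TYPE('f) m {{} :: 'v set}"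
    using attach_kills[OF simplicial_singleton, of "{v}" 0 m, where 'f = 'f] by simp
  then show ?case unfolding eq by (simp add: face_betti_empty_complex split: if_splits)
next
  case (insert x F)
  have "face_betti TYPE('f) m (Pow F \<union> Pow (insert x F)) = face_betti TYPE('f) m (Pow F)"
  proof (rule face_betti_Un_Pow)
    show "simplicial_complex (Pow F)" by (rule simplicial_Pow) fact
    show "finite (insert x F)" using insert by simp
    show "{x} \<subset> insert x F" using insert by blast
    show "\<And>\<gamma>. \<gamma> \<subseteq> insert x F \<Longrightarrow> \<gamma> \<in> Pow F \<longleftrightarrow> \<not> {x} \<subseteq> \<gamma>" using insert by blast
  qed
  moreover have "Pow F \<union> Pow (insert x F) = Pow (insert x F)" by blast
  ultimately show ?case using insert by simp
qed

lemma simplicial_boundary: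
  assumes "finite A" "A \<noteq> {}" shows "simplicial_complex (simplex_boundary A)"
  unfolding simplicial_complex_def
proof (intro conjI ballI allI impI)
  show "finite (simplex_boundary A)"
    by (rule finite_subset[of _ "Pow A"]) (use assms in \<open>auto simp: simplex_boundary_def\<close>)
  show "{} \<in> simplex_boundary A" using assms by (auto simp: simplex_boundary_def)
  fix \<alpha> assume a: "\<alpha> \<in> simplex_boundary A"
  then show "finite \<alpha>" using assms(1) by (auto simp: simplex_boundary_def intro: finite_subset)
  show "\<beta> \<in> simplex_boundary A" if "\<beta> \<subseteq> \<alpha>" for \<beta>
    using a that by (auto simp: simplex_boundary_def)
qed

text \<open>Attaching the top face to the boundary yields an acyclic complex and kills a class, because
  nothing bounds in that degree; this is the only class there is.\<close>

lemma face_betti_simplex_boundary: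
  fixes A :: "'v::linorder set"
  assumes "finite A" "A \<noteq> {}"
  shows "face_betti TYPE('f::field) m (simplex_boundary A) = (if Suc m = card A then 1 else 0)"
proof -
  obtain n where n: "card A = Suc n" using assms by (metis card_eq_0_iff not0_implies_Suc)
  have eq: "Pow A = insert A (simplex_boundary A)" by (auto simp: simplex_boundary_def)
  have L: "simplicial_complex (insert A (simplex_boundary A))" using simplicial_Pow[OF assms(1)] eq by simp
  have A: "A \<notin> simplex_boundary A" by (simp add: simplex_boundary_def)
  obtain v where v: "v \<in> A" using assms by blast
  have "face_bdry (unit_chain A :: _ \<Rightarrow> 'f) (A - {v}) \<noteq> 0" by (rule face_bdry_unit_chain_facet[OF v])
  moreover have "face_boundaries n (simplex_boundary A) = ({0} :: ('v set \<Rightarrow> 'f) set)"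
  proof (rule face_boundaries_trivial)
    fix \<alpha> assume "\<alpha> \<in> simplex_boundary A"
    then show "card \<alpha> \<noteq> Suc n"
      using psubset_card_mono[OF assms(1), of \<alpha>] n by (simp add: simplex_boundary_def)
  qed
  ultimately have "face_bdry (unit_chain A :: _ \<Rightarrow> 'f) \<notin> face_boundaries n (simplex_boundary A)"
    by (auto simp: zero_fun_def)
  from attach_kills[OF simplicial_boundary[OF assms] L A n this, of m]
  show ?thesis unfolding eq[symmetric] face_betti_Pow[OF assms] using n by auto
qed

section \<open>The Euler characteristic\<close>

lemma face_betti_0:
  fixes K :: "'v::linorder set set"
  assumes K: "simplicial_complex K"
  shows "face_betti TYPE('f::field) 0 K = (if K = {{}} then 1 else 0)"
proof (cases "K = {{}}")
  case True then show ?thesis by (simp add: face_betti_empty_complex)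
next
  case False
  then obtain v where v: "{v} \<in> K" using vertex_exists[OF K] by blast
  define x where "x = (face_bdry (unit_chain {v}) :: 'v set \<Rightarrow> 'f)"
  have ev: "unit_chain {v} \<in> (face_chains (Suc 0) K :: ('v set \<Rightarrow> 'f) set)"
    using unit_chain_in_chains[OF v] by simp
  have x0: "x {} \<noteq> 0" using face_bdry_unit_chain_facet[of v "{v}", where 'f = 'f] by (simp add: x_def)
  have xC: "x \<in> face_chains 0 K" unfolding x_def by (rule face_bdry_in_chains[OF K ev])
  have xB: "x \<in> face_boundaries 0 K" unfolding face_boundaries_def x_def using ev by blast
  have "c \<in> face_boundaries 0 K" if c: "c \<in> face_cycles 0 K" for c :: "'v set \<Rightarrow> 'f"
  proof -
    have cC: "c \<in> face_chains 0 K" using c by (simp add: face_cycles_def)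
    have "c - fscale (c {} / x {}) x = 0"
      using face_chains_0_eq[OF K fv.subspace_diff[OF subspace_face_chains cC
          fv.subspace_scale[OF subspace_face_chains xC, of "c {} / x {}"]]] x0
      by (simp add: fscale_apply)
    then have "c = fscale (c {} / x {}) x" by simp
    also have "\<dots> \<in> face_boundaries 0 K" by (rule fv.subspace_scale[OF subspace_face_boundaries[OF K] xB])
    finally show ?thesis .
  qed
  then have "face_cycles 0 K = (face_boundaries 0 K :: ('v set \<Rightarrow> 'f) set)"
    using face_boundaries_subset_cycles[OF K] by blast
  then have "face_betti TYPE('f) 0 K = 0" by (simp add: face_betti_def)
  then show ?thesis using False by simp
qed

lemma attach_face:
  fixes K :: "'v::linorder set set"
  assumes "simplicial_complex K" "simplicial_complex (insert \<tau> K)" "\<tau> \<notin> K" "card \<tau> = Suc n"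
  obtains (creates) "\<And>m. face_betti TYPE('f::field) m (insert \<tau> K) = face_betti TYPE('f) m K + (if m = Suc n then 1 else 0)"
  | (kills) "\<And>m. face_betti TYPE('f) m (insert \<tau> K) + (if m = n then 1 else 0) = face_betti TYPE('f) m K"
  using attach_creates[OF assms, where 'f = 'f] attach_kills[OF assms, where 'f = 'f] by blast

text \<open>Remove a maximal face. Whether attaching it creates or kills a class, the right side changes
  by the sign of that face.\<close>

lemma euler_poincare:
  fixes K :: "'v::linorder set set"
  assumes "simplicial_complex K" "\<And>\<alpha>. \<alpha> \<in> K \<Longrightarrow> card \<alpha> \<le> N"
  shows "(\<Sum>\<alpha>\<in>K. (-1) ^ card \<alpha>) = (\<Sum>n\<le>N. (-1) ^ n * int (face_betti TYPE('f::field) n K))"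
  using assms
proof (induction "card K" arbitrary: K rule: less_induct)
  case less
  note K = less.prems(1)
  show ?case
  proof (cases "K = {{}}")
    case True
    have "(\<Sum>n\<le>N. (-1) ^ n * int (face_betti TYPE('f) n K)) = (\<Sum>n\<le>N. if n = 0 then 1 else 0)"
      unfolding True by (intro sum.cong) (auto simp: face_betti_empty_complex)
    then show ?thesis using True by simp
  next
    case False
    obtain \<tau> where \<tau>: "\<tau> \<in> K" "\<And>\<alpha>. \<alpha> \<in> K \<Longrightarrow> \<tau> \<subseteq> \<alpha> \<Longrightarrow> \<alpha> = \<tau>"
      using finite_has_maximal[of K] simplicial_finite[OF K] simplicial_empty[OF K] by blast
    have ne: "\<tau> \<noteq> {}" using False \<tau> simplicial_empty[OF K] by blast
    have fin: "finite \<tau>" using simplicial_face_finite[OF K \<tau>(1)] .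
    obtain n where n: "card \<tau> = Suc n" using fin ne by (metis card_eq_0_iff not0_implies_Suc)
    let ?L = "K - {\<tau>}"
    have L: "simplicial_complex ?L"
      unfolding simplicial_complex_def
    proof (intro conjI ballI allI impI)
      show "finite ?L" using simplicial_finite[OF K] by simp
      show "{} \<in> ?L" using simplicial_empty[OF K] ne by simp
      fix \<alpha> assume a: "\<alpha> \<in> ?L"
      then show "finite \<alpha>" using simplicial_face_finite[OF K] by blast
      show "\<beta> \<in> ?L" if "\<beta> \<subseteq> \<alpha>" for \<beta>
        using simplicial_subset[OF K _ that] a \<tau>(2)[of \<alpha>] that by blast
    qed
    have KL: "K = insert \<tau> ?L" using \<tau> by blast
    have "card ?L < card K" using \<tau> simplicial_finite[OF K] by (intro psubset_card_mono) auto
    then have IH: "(\<Sum>\<alpha>\<in>?L. (-1) ^ card \<alpha>) = (\<Sum>n\<le>N. (-1) ^ n * int (face_betti TYPE('f) n ?L))"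
      using less.hyps[OF _ L] less.prems(2) by blast
    have nN: "Suc n \<le> N" using less.prems(2)[OF \<tau>(1)] n by simp
    have "(\<Sum>\<alpha>\<in>K. (-1) ^ card \<alpha>) = (-1) ^ Suc n + (\<Sum>\<alpha>\<in>?L. (-1) ^ card \<alpha> :: int)"
      using sum.remove[OF simplicial_finite[OF K] \<tau>(1), of "\<lambda>\<alpha>. (-1) ^ card \<alpha> :: int"] n by simp
    moreover have "(\<Sum>k\<le>N. (-1) ^ k * int (face_betti TYPE('f) k K)) = (-1) ^ Suc n + (\<Sum>k\<le>N. (-1) ^ k * int (face_betti TYPE('f) k ?L))"
    proof (rule attach_face[OF L, of \<tau> n, where 'f = 'f])
      show "simplicial_complex (insert \<tau> ?L)" using K KL by simp
      show "\<tau> \<notin> ?L" by simp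
      show "card \<tau> = Suc n" by (rule n)
    next
      assume a: "\<And>m. face_betti TYPE('f) m (insert \<tau> ?L) = face_betti TYPE('f) m ?L + (if m = Suc n then 1 else 0)"
      have "(\<Sum>k\<le>N. (-1) ^ k * int (face_betti TYPE('f) k K)) = (\<Sum>k\<le>N. (-1) ^ k * int (face_betti TYPE('f) k ?L) + (if k = Suc n then (-1) ^ k else 0))"
        by (subst KL, unfold a) (intro sum.cong, auto simp: algebra_simps)
      then show ?thesis using nN by (simp add: sum.distrib)
    next
      assume a: "\<And>m. face_betti TYPE('f) m (insert \<tau> ?L) + (if m = n then 1 else 0) = face_betti TYPE('f) m ?L"
      have "(\<Sum>k\<le>N. (-1) ^ k * int (face_betti TYPE('f) k ?L)) = (\<Sum>k\<le>N. (-1) ^ k * int (face_betti TYPE('f) k K) + (if k = n then (-1) ^ k else 0))"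
        unfolding a[symmetric] using KL by (intro sum.cong) (auto simp: algebra_simps)
      then show ?thesis using nN by (simp add: sum.distrib)
    qed
    ultimately show ?thesis using IH by simp
  qed
qed

section \<open>From augmented to ordinary homology\<close>

lemma simplicial_chains_eq: "simplicial_chains i K = face_chains (Suc i) K"
  unfolding simplicial_chains_def face_chains_def face_dim_def
  by (intro Collect_cong all_cong1 imp_cong) auto

lemma chain_boundary_eq_face_bdry:
  assumes "simplicial_complex K" "c \<in> face_chains n K" "\<tau> \<noteq> {}"
  shows "chain_boundary K c \<tau> = face_bdry c \<tau>"
  using assms(3) by (simp add: chain_boundary_def face_bdry_chain[OF assms(1,2)])

lemma chain_boundary_empty: "chain_boundary K c {} = 0"
  by (simp add: chain_boundary_def)

lemma chain_boundary_eq_face_bdry_high: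
  assumes K: "simplicial_complex K" and c: "c \<in> face_chains (Suc (Suc n)) K"
  shows "chain_boundary K c = face_bdry c"
proof (rule ext)
  fix \<tau>
  show "chain_boundary K c \<tau> = face_bdry c \<tau>"
  proof (cases "\<tau> = {}")
    case True
    have "face_bdry c {} = 0" using face_chains_D[OF face_bdry_in_chains[OF K c], of "{}"] by fastforce
    then show ?thesis using True by (simp add: chain_boundary_empty)
  qed (rule chain_boundary_eq_face_bdry[OF K c])
qed

lemma boundaries_eq: "simplicial_complex K \<Longrightarrow> boundaries i K = face_boundaries (Suc i) K"
  unfolding boundaries_def face_boundaries_def simplicial_chains_eq
  by (intro image_cong refl) (rule chain_boundary_eq_face_bdry_high)

lemma cycles_eq_high:
  assumes "simplicial_complex K" shows "cycles (Suc i) K = face_cycles (Suc (Suc i)) K"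
  unfolding cycles_def face_cycles_def simplicial_chains_eq zero_fun_def
  by (intro Collect_cong conj_cong refl) (simp add: chain_boundary_eq_face_bdry_high[OF assms])

lemma cycles_0_eq:
  assumes K: "simplicial_complex K" shows "cycles 0 K = face_chains (Suc 0) K"
proof -
  have "chain_boundary K c = (\<lambda>_. 0)" if c: "c \<in> face_chains (Suc 0) K" for c :: "'a set \<Rightarrow> 'b"
  proof (rule ext)
    fix \<tau>
    show "chain_boundary K c \<tau> = 0"
    proof (cases "\<tau> = {}")
      case False
      have "face_bdry c \<tau> = 0"
        using face_chains_D[OF face_bdry_in_chains[OF K c], of \<tau>] simplicial_face_finite[OF K, of \<tau>] False by fastforce
      then show ?thesis using chain_boundary_eq_face_bdry[OF K c False] by simp
    qed (simp add: chain_boundary_empty)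
  qed
  then show ?thesis unfolding cycles_def simplicial_chains_eq by blast
qed

text \<open>The chains on vertices are the cycles of the unreduced theory in dimension \<open>0\<close>; the
  augmentation has rank one as soon as there is a vertex. This is the difference between reduced and
  unreduced homology.\<close>

lemma dim_vertex_chains:
  fixes K :: "'v::linorder set set"
  assumes K: "simplicial_complex K"
  shows "fv.dim (face_chains (Suc 0) K :: ('v set \<Rightarrow> 'f::field) set)
    = fv.dim (face_cycles (Suc 0) K :: ('v set \<Rightarrow> 'f) set) + (if K = {{}} then 0 else 1)"
proof (cases "K = {{}}")
  case True
  have "face_chains (Suc 0) K = ({0} :: ('v set \<Rightarrow> 'f) set)"
    unfolding True by (rule face_chains_trivial) simp
  then have "face_cycles (Suc 0) K = (face_chains (Suc 0) K :: ('v set \<Rightarrow> 'f) set)"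
    unfolding face_cycles_def using face_bdry_zero by auto
  then show ?thesis using True by simp
next
  case False
  then obtain v where v: "{v} \<in> K" using vertex_exists[OF K] by blast
  define e where "e = (unit_chain {v} :: 'v set \<Rightarrow> 'f)"
  have ev: "e \<in> face_chains (Suc 0) K"
    using unit_chain_in_chains[OF v] by (simp add: e_def)
  have x0: "face_bdry e {} \<noteq> 0" using face_bdry_unit_chain_facet[of v "{v}", where 'f = 'f] by (simp add: e_def)
  have "fv.dim (face_chains (Suc 0) K :: ('v set \<Rightarrow> 'f) set) = Suc (fv.dim (face_cycles (Suc 0) K :: ('v set \<Rightarrow> 'f) set))"
  proof (rule dim_one_more[where x = e])
    show "fv.subspace (face_cycles (Suc 0) K :: ('v set \<Rightarrow> 'f) set)" by (rule subspace_face_cycles[OF K])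
    show "face_cycles (Suc 0) K \<subseteq> (face_chains (Suc 0) K :: ('v set \<Rightarrow> 'f) set)"
      unfolding face_cycles_def by blast
    show "finite (unit_chain ` K :: ('v set \<Rightarrow> 'f) set)" by (rule finite_imageI[OF simplicial_finite[OF K]])
    show "face_cycles (Suc 0) K \<subseteq> fv.span (unit_chain ` K :: ('v set \<Rightarrow> 'f) set)" by (rule face_cycles_span[OF K])
    show "e \<in> face_chains (Suc 0) K" by (rule ev)
    show "e \<notin> face_cycles (Suc 0) K"
    proof
      assume "e \<in> face_cycles (Suc 0) K"
      then have "face_bdry e = 0" by (simp add: face_cycles_def)
      then show False using x0 by simp
    qed
    fix c :: "'v set \<Rightarrow> 'f" assume c: "c \<in> face_chains (Suc 0) K"
    define a where "a = face_bdry c {} / face_bdry e {}"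
    have d: "c - fscale a e \<in> face_chains (Suc 0) K"
      by (intro fv.subspace_diff[OF subspace_face_chains] fv.subspace_scale[OF subspace_face_chains] c ev)
    have "face_bdry (c - fscale a e) = face_bdry c - fscale a (face_bdry e)"
      using face_bdry_diff[OF K c fv.subspace_scale[OF subspace_face_chains ev]] face_bdry_scale[OF K ev ev] by simp
    then have "face_bdry (c - fscale a e) {} = 0" using x0 by (simp add: fscale_apply a_def)
    then have "face_bdry (c - fscale a e) = 0"
      using face_chains_0_eq[OF K face_bdry_in_chains[OF K d]] by simp
    then show "\<exists>a. c - fscale a e \<in> face_cycles (Suc 0) K" using d unfolding face_cycles_def by blast
  qed
  then show ?thesis using False by simp
qed

lemma betti_eq_face_betti:
  fixes K :: "'v::linorder set set"
  assumes K: "simplicial_complex K"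
  shows "betti TYPE('f::field) i K = face_betti TYPE('f) (Suc i) K + (if i = 0 \<and> K \<noteq> {{}} then 1 else 0)"
proof -
  have Z: "face_cycles (Suc i) K \<subseteq> (cycles i K :: ('v set \<Rightarrow> 'f) set)"
    by (cases i) (auto simp: cycles_0_eq[OF K] cycles_eq_high[OF K] face_cycles_def)
  have CC: "(cycles i K :: ('v set \<Rightarrow> 'f) set) \<subseteq> face_chains (Suc i) K"
    by (auto simp: cycles_def simplicial_chains_eq)
  have "betti TYPE('f) i K + fv.dim (boundaries i K :: ('v set \<Rightarrow> 'f) set) = fv.dim (cycles i K :: ('v set \<Rightarrow> 'f) set)"
  proof (rule betti_eq_dim_diff)
    show "boundaries i K \<subseteq> (cycles i K :: ('v set \<Rightarrow> 'f) set)"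
      unfolding boundaries_eq[OF K] using face_boundaries_subset_cycles[OF K] Z by (rule order_trans)
    show "finite (unit_chain ` K :: ('v set \<Rightarrow> 'f) set)" by (rule finite_imageI[OF simplicial_finite[OF K]])
    show "(cycles i K :: ('v set \<Rightarrow> 'f) set) \<subseteq> fv.span (unit_chain ` K)"
      using CC face_chains_span[OF K] by (rule order_trans)
  qed
  moreover note face_betti_add_dim[OF K, where 'f = 'f and n = "Suc i"]
  moreover have "fv.dim (cycles i K :: ('v set \<Rightarrow> 'f) set) = fv.dim (face_cycles (Suc i) K :: ('v set \<Rightarrow> 'f) set)
      + (if i = 0 \<and> K \<noteq> {{}} then 1 else 0)"
  proof (cases i)
    case 0
    then show ?thesis using dim_vertex_chains[OF K, where 'f = 'f] by (simp add: cycles_0_eq[OF K])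
  next
    case (Suc j)
    then show ?thesis by (simp add: cycles_eq_high[OF K])
  qed
  ultimately show ?thesis unfolding boundaries_eq[OF K] by simp
qed

text \<open>Unreduced Betti numbers determine the augmented ones, including degree \<open>0\<close>: they recognise
  \<open>{{}}\<close> as the only complex without homology.\<close>

lemma same_homology_iff:
  assumes K: "simplicial_complex K" and L: "simplicial_complex L"
  shows "same_homology TYPE('f::field) K L \<longleftrightarrow> (\<forall>n. face_betti TYPE('f) n K = face_betti TYPE('f) n L)"
proof
  assume "same_homology TYPE('f) K L"
  then have b: "betti TYPE('f) i K = betti TYPE('f) i L" for i by (simp add: same_homology_def)
  have h: "face_betti TYPE('f) (Suc 0) K = 0" if "K = {{}}" using that by (simp add: face_betti_empty_complex)
  have h': "face_betti TYPE('f) (Suc 0) L = 0" if "L = {{}}" using that by (simp add: face_betti_empty_complex)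
  have e: "K = {{}} \<longleftrightarrow> L = {{}}"
    using b[of 0] h h' unfolding betti_eq_face_betti[OF K] betti_eq_face_betti[OF L] by (auto split: if_splits)
  show "\<forall>n. face_betti TYPE('f) n K = face_betti TYPE('f) n L"
  proof
    fix n show "face_betti TYPE('f) n K = face_betti TYPE('f) n L"
    proof (cases n)
      case 0 then show ?thesis using e by (simp add: face_betti_0[OF K] face_betti_0[OF L])
    next
      case (Suc i) then show ?thesis
        using b[of i] e unfolding betti_eq_face_betti[OF K] betti_eq_face_betti[OF L] by (auto split: if_splits)
    qed
  qed
next
  assume a: "\<forall>n. face_betti TYPE('f) n K = face_betti TYPE('f) n L"
  have "K = {{}} \<longleftrightarrow> L = {{}}"
    using a[rule_format, of 0] unfolding face_betti_0[OF K] face_betti_0[OF L] by (auto split: if_splits)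
  then show "same_homology TYPE('f) K L"
    using a by (simp add: same_homology_def betti_eq_face_betti[OF K] betti_eq_face_betti[OF L])
qed

lemma has_point_homology_iff:
  assumes "simplicial_complex K"
  shows "has_point_homology TYPE('f::field) K \<longleftrightarrow> (\<forall>n. face_betti TYPE('f) n K = 0)"
proof -
  have P: "full_simplex {0::nat} = Pow {0}" by (auto simp: full_simplex_def)
  have "simplicial_complex (Pow {0::nat})" by (rule simplicial_Pow) simp
  from same_homology_iff[OF assms this] show ?thesis
    unfolding has_point_homology_def P by (simp add: face_betti_Pow)
qed

lemma has_sphere_homology_iff:
  assumes "simplicial_complex K" "k \<ge> - 1"
  shows "has_sphere_homology TYPE('f::field) k K \<longleftrightarrow> (\<forall>n. face_betti TYPE('f) n K = (if n = nat (k + 1) then 1 else 0))"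
proof -
  have "nat (k + 2) = Suc (nat (k + 1))" using assms(2) by simp
  moreover from this have ne: "{..<nat (k + 2)} \<noteq> {}" by auto
  ultimately show ?thesis
    using same_homology_iff[OF assms(1) simplicial_boundary[OF _ ne]]
    unfolding has_sphere_homology_def by (simp add: face_betti_simplex_boundary)
qed

text \<open>With the convention that the reduced Betti number of \<open>{{}}\<close> in dimension \<open>0\<close> is \<open>-1\<close>, the
  alternating sum picks up its class of dimension \<open>-1\<close>.\<close>

lemma alternating_reduced_betti:
  assumes K: "simplicial_complex K"
  shows "(\<Sum>i = 0..l. (-1) ^ (l - i) * real_of_int (reduced_betti TYPE('f::field) i K))
    = (\<Sum>n\<le>Suc l. (-1) ^ (Suc l - n) * real (face_betti TYPE('f) n K))"
proof -
  have r: "real_of_int (reduced_betti TYPE('f) i K) = real (face_betti TYPE('f) (Suc i) K) - (if i = 0 then real (face_betti TYPE('f) 0 K) else 0)" for i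
    by (simp add: reduced_betti_def betti_eq_face_betti[OF K] face_betti_0[OF K])
  have "(\<Sum>i = 0..l. (-1) ^ (l - i) * real_of_int (reduced_betti TYPE('f) i K))
     = (\<Sum>i\<le>l. (-1) ^ (l - i) * real (face_betti TYPE('f) (Suc i) K) - (if i = 0 then (-1) ^ l * real (face_betti TYPE('f) 0 K) else 0))"
    unfolding r atLeast0AtMost by (intro sum.cong) (auto simp: algebra_simps)
  also have "\<dots> = (\<Sum>i\<le>l. (-1) ^ (l - i) * real (face_betti TYPE('f) (Suc i) K)) - (-1) ^ l * real (face_betti TYPE('f) 0 K)"
    by (simp add: sum_subtractf)
  also have "\<dots> = (\<Sum>n\<le>Suc l. (-1) ^ (Suc l - n) * real (face_betti TYPE('f) n K))"
    unfolding sum.atMost_Suc_shift by simp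
  finally show ?thesis .
qed

section \<open>Filling in a simplex\<close>

lemma simplicial_link:
  assumes K: "simplicial_complex K" and g: "\<gamma> \<in> K" shows "simplicial_complex (link K \<gamma>)"
  unfolding simplicial_complex_def
proof (intro conjI ballI allI impI)
  show "finite (link K \<gamma>)" using simplicial_finite[OF K] by (simp add: link_def)
  show "{} \<in> link K \<gamma>" using g simplicial_empty[OF K] by (simp add: link_def)
  fix \<alpha> assume a: "\<alpha> \<in> link K \<gamma>"
  then show "finite \<alpha>" using simplicial_face_finite[OF K] by (auto simp: link_def)
  fix \<beta> assume b: "\<beta> \<subseteq> \<alpha>"
  then have "\<beta> \<union> \<gamma> \<subseteq> \<alpha> \<union> \<gamma>" by blast
  then show "\<beta> \<in> link K \<gamma>"
    using a b simplicial_subset[OF K, of \<alpha> \<beta>] simplicial_subset[OF K, of "\<alpha> \<union> \<gamma>" "\<beta> \<union> \<gamma>"]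
    by (auto simp: link_def)
qed

lemma simplicial_induced: "simplicial_complex K \<Longrightarrow> simplicial_complex (induced K A)"
  unfolding simplicial_complex_def induced_def by auto

lemma mem_link_iff:
  assumes K: "simplicial_complex K" shows "\<delta> \<in> link K \<gamma> \<longleftrightarrow> \<delta> \<inter> \<gamma> = {} \<and> \<delta> \<union> \<gamma> \<in> K"
  using simplicial_subset[OF K, of "\<delta> \<union> \<gamma>" \<delta>] by (auto simp: link_def)

text \<open>One half of a bistellar move: in \<open>K\<close> the simplex on \<open>U\<close> is present up to the faces containing
  \<open>\<beta>\<close>, and these are filled in. The other half is the same situation with \<open>U - \<beta>\<close> in place of \<open>\<beta>\<close>.\<close>

locale simplex_filling =
  fixes K :: "'v::linorder set set" and U \<beta> :: "'v set"
  assumes K: "simplicial_complex K" and U: "finite U" and \<beta>: "\<beta> \<subseteq> U" "\<beta> \<noteq> {}"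
    and mem: "\<And>\<gamma>. \<gamma> \<subseteq> U \<Longrightarrow> \<gamma> \<in> K \<longleftrightarrow> \<not> \<beta> \<subseteq> \<gamma>"
begin

lemma simplicial_filled: "simplicial_complex (K \<union> Pow U)"
  using K U by (rule simplicial_Un_Pow)

lemma link_outside:
  assumes "\<not> \<gamma> \<subseteq> U" shows "link (K \<union> Pow U) \<gamma> = link K \<gamma>"
  using assms by (auto simp: mem_link_iff[OF K] mem_link_iff[OF simplicial_filled])

lemma link_inside:
  assumes "\<gamma> \<subseteq> U" shows "link (K \<union> Pow U) \<gamma> = link K \<gamma> \<union> Pow (U - \<gamma>)"
  using assms by (auto simp: mem_link_iff[OF K] mem_link_iff[OF simplicial_filled])

lemma link_filling:
  assumes "\<gamma> \<subseteq> U" "\<not> \<beta> \<subseteq> \<gamma>" "\<delta> \<subseteq> U - \<gamma>"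
  shows "\<delta> \<in> link K \<gamma> \<longleftrightarrow> \<not> \<beta> - \<gamma> \<subseteq> \<delta>"
proof -
  have "\<delta> \<union> \<gamma> \<subseteq> U" "\<delta> \<inter> \<gamma> = {}" using assms by auto
  then have "\<delta> \<in> link K \<gamma> \<longleftrightarrow> \<not> \<beta> \<subseteq> \<delta> \<union> \<gamma>" using mem by (simp add: mem_link_iff[OF K])
  then show ?thesis by blast
qed

text \<open>The new faces of the link are those containing \<open>\<beta> - \<gamma>\<close>. They cancel in pairs, since the third
  hypothesis leaves a vertex of \<open>U - \<gamma>\<close> outside \<open>\<beta>\<close>.\<close>

lemma face_betti_link_same:
  assumes g: "\<gamma> \<subseteq> U" "\<not> \<beta> \<subseteq> \<gamma>" "\<not> U - \<beta> \<subseteq> \<gamma>"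
  shows "face_betti TYPE('f::field) n (link (K \<union> Pow U) \<gamma>) = face_betti TYPE('f) n (link K \<gamma>)"
  unfolding link_inside[OF g(1)]
proof (rule face_betti_Un_Pow)
  show "simplicial_complex (link K \<gamma>)" using simplicial_link[OF K] mem g by blast
  show "finite (U - \<gamma>)" using U by simp
  show "\<beta> - \<gamma> \<subset> U - \<gamma>" using g \<beta> by blast
  show "\<And>\<delta>. \<delta> \<subseteq> U - \<gamma> \<Longrightarrow> \<delta> \<in> link K \<gamma> \<longleftrightarrow> \<not> \<beta> - \<gamma> \<subseteq> \<delta>" by (rule link_filling[OF g(1,2)])
qed

lemma link_opposite:
  assumes g: "\<gamma> \<subseteq> U" "\<not> \<beta> \<subseteq> \<gamma>" "U - \<beta> \<subseteq> \<gamma>"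
  shows "link (K \<union> Pow U) \<gamma> = insert (U - \<gamma>) (link K \<gamma>)" "U - \<gamma> \<notin> link K \<gamma>"
proof -
  have e: "\<beta> - \<gamma> = U - \<gamma>" using g \<beta> by blast
  show "U - \<gamma> \<notin> link K \<gamma>" using link_filling[OF g(1,2), of "U - \<gamma>"] e by simp
  have "\<delta> \<in> link K \<gamma> \<or> \<delta> = U - \<gamma>" if "\<delta> \<subseteq> U - \<gamma>" for \<delta>
    using link_filling[OF g(1,2) that] that e by blast
  then show "link (K \<union> Pow U) \<gamma> = insert (U - \<gamma>) (link K \<gamma>)"
    unfolding link_inside[OF g(1)] by blast
qed

lemma link_new:
  assumes g: "\<gamma> \<subseteq> U" "\<beta> \<subseteq> \<gamma>" shows "link (K \<union> Pow U) \<gamma> = Pow (U - \<gamma>)"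
proof -
  have "\<beta> \<notin> K" using mem \<beta> by blast
  then have "\<delta> \<union> \<gamma> \<notin> K" for \<delta> using simplicial_subset[OF K, of "\<delta> \<union> \<gamma>" \<beta>] g by blast
  then have "link K \<gamma> = {}" by (auto simp: mem_link_iff[OF K])
  then show ?thesis unfolding link_inside[OF g(1)] by simp
qed

lemma induced_filled: "induced (K \<union> Pow U) A = induced K A \<union> Pow (A \<inter> U)"
  by (auto simp: induced_def)

text \<open>Either \<open>A\<close> does not contain \<open>\<beta>\<close> and nothing changes, or \<open>A \<inter> U\<close> has a vertex outside \<open>\<beta>\<close> and the
  new faces cancel in pairs.\<close>

lemma face_betti_induced_same:
  assumes "A \<inter> U \<noteq> \<beta>"
  shows "face_betti TYPE('f::field) n (induced (K \<union> Pow U) A) = face_betti TYPE('f) n (induced K A)"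
proof (cases "\<beta> \<subseteq> A")
  case False
  have "induced K A \<union> Pow (A \<inter> U) = induced K A"
    using False mem by (auto simp: induced_def)
  then show ?thesis unfolding induced_filled by simp
next
  case True
  show ?thesis
    unfolding induced_filled
  proof (rule face_betti_Un_Pow)
    show "simplicial_complex (induced K A)" by (rule simplicial_induced[OF K])
    show "finite (A \<inter> U)" using U by simp
    show "\<beta> \<subset> A \<inter> U" using True assms \<beta> by blast
    show "\<And>\<gamma>. \<gamma> \<subseteq> A \<inter> U \<Longrightarrow> \<gamma> \<in> induced K A \<longleftrightarrow> \<not> \<beta> \<subseteq> \<gamma>" using mem by (auto simp: induced_def)
  qed
qed

lemma induced_attach:
  assumes "A \<inter> U = \<beta>"
  shows "induced (K \<union> Pow U) A = insert \<beta> (induced K A)" "\<beta> \<notin> induced K A"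
proof -
  show "\<beta> \<notin> induced K A" using mem \<beta> by (auto simp: induced_def)
  have "\<gamma> \<in> induced K A" if "\<gamma> \<subset> \<beta>" for \<gamma>
    using that mem[of \<gamma>] assms \<beta> by (auto simp: induced_def)
  then show "induced (K \<union> Pow U) A = insert \<beta> (induced K A)"
    unfolding induced_filled assms by blast
qed

end

section \<open>Alternating sums of Betti numbers\<close>

definition alt_betti :: "'f::field itself \<Rightarrow> nat \<Rightarrow> 'v::linorder set set \<Rightarrow> real" where
  "alt_betti F k K = (\<Sum>n\<le>k. (-1) ^ (k - n) * real (face_betti F n K))"

text \<open>A class created in degree \<open>n + 1\<close> enters with the same sign with which a class killed in degree \<open>n\<close>
  leaves, so both alternatives agree as long as the sum is not cut off between these two degrees.\<close>

lemma alt_betti_attach: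
  fixes K :: "'v::linorder set set"
  assumes "simplicial_complex K" "simplicial_complex (insert \<tau> K)" "\<tau> \<notin> K" "card \<tau> = Suc n"
  shows alt_betti_attach_low: "Suc n \<le> k \<Longrightarrow> alt_betti TYPE('f::field) k (insert \<tau> K) = alt_betti TYPE('f) k K + (-1) ^ (k - Suc n)"
    and alt_betti_attach_mid: "n = k \<Longrightarrow> alt_betti TYPE('f) k (insert \<tau> K) \<le> alt_betti TYPE('f) k K"
    and alt_betti_attach_high: "k < n \<Longrightarrow> alt_betti TYPE('f) k (insert \<tau> K) = alt_betti TYPE('f) k K"
proof -
  let ?L = "insert \<tau> K"
  have "(Suc n \<le> k \<longrightarrow> alt_betti TYPE('f::field) k ?L = alt_betti TYPE('f) k K + (-1) ^ (k - Suc n))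
      \<and> (n = k \<longrightarrow> alt_betti TYPE('f) k ?L \<le> alt_betti TYPE('f) k K)
      \<and> (k < n \<longrightarrow> alt_betti TYPE('f) k ?L = alt_betti TYPE('f) k K)"
    using assms
  proof (cases rule: attach_face[where 'f = 'f])
    case creates
    have "alt_betti TYPE('f) k ?L = (\<Sum>m\<le>k. (-1) ^ (k - m) * real (face_betti TYPE('f) m K) + (if m = Suc n then (-1) ^ (k - m) else 0))"
      unfolding alt_betti_def creates by (intro sum.cong) (auto simp: algebra_simps)
    also have "\<dots> = alt_betti TYPE('f) k K + (if Suc n \<le> k then (-1) ^ (k - Suc n) else 0)"
      by (simp add: sum.distrib alt_betti_def)
    finally show ?thesis by auto
  next
    case kills
    have "alt_betti TYPE('f) k K = (\<Sum>m\<le>k. (-1) ^ (k - m) * real (face_betti TYPE('f) m ?L) + (if m = n then (-1) ^ (k - m) else 0))"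
      unfolding alt_betti_def kills[symmetric] by (intro sum.cong) (auto simp: algebra_simps)
    also have "\<dots> = alt_betti TYPE('f) k ?L + (if n \<le> k then (-1) ^ (k - n) else 0)"
      by (simp add: sum.distrib alt_betti_def)
    finally have *: "alt_betti TYPE('f) k K = alt_betti TYPE('f) k ?L + (if n \<le> k then (-1) ^ (k - n) else 0)" .
    have "(-1) ^ (k - n) = - ((-1) ^ (k - Suc n) :: real)" if "Suc n \<le> k"
      using that by (simp add: Suc_diff_Suc[symmetric])
    then show ?thesis using * by auto
  qed
  then show "Suc n \<le> k \<Longrightarrow> alt_betti TYPE('f::field) k ?L = alt_betti TYPE('f) k K + (-1) ^ (k - Suc n)"
    "n = k \<Longrightarrow> alt_betti TYPE('f) k ?L \<le> alt_betti TYPE('f) k K"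
    "k < n \<Longrightarrow> alt_betti TYPE('f) k ?L = alt_betti TYPE('f) k K" by blast+
qed

section \<open>Averages over vertex subsets\<close>

text \<open>The integral of \<open>x ^ a * (1 - x) ^ (m - a)\<close> over the unit interval.\<close>

definition subset_weight :: "nat \<Rightarrow> nat \<Rightarrow> real" where
  "subset_weight m a = 1 / (real (Suc m) * real (m choose a))"

lemma subset_weight_pos: "a \<le> m \<Longrightarrow> subset_weight m a > 0"
  by (simp add: subset_weight_def)

text \<open>Under the integral this is \<open>x + (1 - x) = 1\<close>.\<close>

lemma subset_weight_rec:
  assumes "a \<le> m" shows "subset_weight (Suc m) a + subset_weight (Suc m) (Suc a) = subset_weight m a"
proof -
  define c where "c = real (m choose a)"
  have c: "c > 0" using assms by (simp add: c_def)
  have 1: "real (Suc m choose Suc a) = real (Suc m) * c / real (Suc a)"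
  proof -
    have "real (Suc m) * c = real (Suc m choose Suc a) * real (Suc a)"
      unfolding c_def of_nat_mult[symmetric] Suc_times_binomial_eq ..
    then show ?thesis by (simp add: field_simps del: of_nat_Suc binomial_Suc_Suc)
  qed
  have 2: "real (Suc m choose a) = real (Suc m) * c / real (Suc m - a)"
  proof -
    have "(Suc m - a) * (Suc m choose a) = Suc m * (m choose a)"
      using binomial_absorb_comp[of "Suc m" a] by simp
    then have "real (Suc m - a) * real (Suc m choose a) = real (Suc m) * c"
      unfolding c_def of_nat_mult[symmetric] by simp
    then show ?thesis using assms by (simp add: field_simps)
  qed
  have "subset_weight (Suc m) a + subset_weight (Suc m) (Suc a) = (real (Suc m - a) + real (Suc a)) / (real (Suc (Suc m)) * (real (Suc m) * c))"
    unfolding subset_weight_def 1 2 by (simp add: add_divide_distrib del: of_nat_Suc)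
  also have "real (Suc m - a) + real (Suc a) = real (Suc (Suc m))" using assms by simp
  also have "real (Suc (Suc m)) / (real (Suc (Suc m)) * (real (Suc m) * c)) = subset_weight m a"
    unfolding subset_weight_def c_def by (simp del: of_nat_Suc)
  finally show ?thesis .
qed

definition weighted_sum :: "'v set \<Rightarrow> ('v set \<Rightarrow> real) \<Rightarrow> real" where
  "weighted_sum V \<phi> = (\<Sum>A\<in>Pow V. subset_weight (card V) (card A) * \<phi> A)"

lemma sum_Pow_insert:
  assumes "finite V" "e \<notin> V"
  shows "(\<Sum>A\<in>Pow (insert e V). f A) = (\<Sum>A\<in>Pow V. f A + f (insert e A) :: real)"
proof -
  have "(\<Sum>A\<in>Pow (insert e V). f A) = (\<Sum>A\<in>Pow V. f A) + (\<Sum>A\<in>insert e ` Pow V. f A)"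
    unfolding Pow_insert by (rule sum.union_disjoint) (use assms in auto)
  also have "(\<Sum>A\<in>insert e ` Pow V. f A) = (\<Sum>A\<in>Pow V. f (insert e A))"
  proof (rule sum.reindex[unfolded comp_def])
    show "inj_on (insert e) (Pow V)" using assms(2) by (auto intro!: inj_onI)
  qed
  finally show ?thesis by (simp add: sum.distrib)
qed

text \<open>A function that ignores a point has the same average with and without this point, by
  \<open>subset_weight_rec\<close>. This is what makes complexes with different vertex sets comparable.\<close>

lemma weighted_sum_extend:
  assumes "finite W" "V \<subseteq> W" "\<And>A. A \<subseteq> W \<Longrightarrow> \<phi> A = \<phi> (A \<inter> V)"
  shows "weighted_sum W \<phi> = weighted_sum V \<phi>"
proof -
  have fV: "finite V" using assms finite_subset by blast
  have "weighted_sum (V \<union> E) \<phi> = weighted_sum V \<phi>" if "finite E" "E \<inter> V = {}" "\<And>A. A \<subseteq> V \<union> E \<Longrightarrow> \<phi> A = \<phi> (A \<inter> V)" for E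
    using that
  proof (induction E rule: finite_induct)
    case empty then show ?case by simp
  next
    case (insert e E)
    let ?V = "V \<union> E"
    have fin: "finite ?V" and e: "e \<notin> ?V" using insert fV by auto
    have inv: "\<phi> (insert e A) = \<phi> A" if "A \<subseteq> ?V" for A
    proof -
      have "insert e A \<inter> V = A \<inter> V" using e by blast
      then show ?thesis using insert.prems(2)[of A] insert.prems(2)[of "insert e A"] that by (simp add: subset_insertI2)
    qed
    have "weighted_sum (V \<union> insert e E) \<phi> = (\<Sum>A\<in>Pow (insert e ?V). subset_weight (Suc (card ?V)) (card A) * \<phi> A)"
      unfolding weighted_sum_def using fin e by simp
    also have "\<dots> = (\<Sum>A\<in>Pow ?V. subset_weight (Suc (card ?V)) (card A) * \<phi> A + subset_weight (Suc (card ?V)) (card (insert e A)) * \<phi> (insert e A))"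
      by (rule sum_Pow_insert[OF fin e])
    also have "\<dots> = (\<Sum>A\<in>Pow ?V. subset_weight (card ?V) (card A) * \<phi> A)"
    proof (rule sum.cong[OF refl])
      fix A assume "A \<in> Pow ?V"
      then have A: "A \<subseteq> ?V" by blast
      then have "card (insert e A) = Suc (card A)" using e fin by (meson card_insert_disjoint finite_subset subsetD)
      moreover have "card A \<le> card ?V" using A fin by (rule card_mono[rotated])
      ultimately show "subset_weight (Suc (card ?V)) (card A) * \<phi> A + subset_weight (Suc (card ?V)) (card (insert e A)) * \<phi> (insert e A)
          = subset_weight (card ?V) (card A) * \<phi> A"
        using inv[OF A] subset_weight_rec[of "card A" "card ?V"] by (simp add: distrib_right[symmetric])
    qed
    also have "\<dots> = weighted_sum ?V \<phi>" unfolding weighted_sum_def ..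
    also have "\<dots> = weighted_sum V \<phi>"
    proof (rule insert.IH)
      show "E \<inter> V = {}" using insert.prems by blast
      show "\<phi> A = \<phi> (A \<inter> V)" if "A \<subseteq> ?V" for A using insert.prems(2)[of A] that by blast
    qed
    finally show ?case .
  qed
  moreover have "V \<union> (W - V) = W" "(W - V) \<inter> V = {}" using assms(2) by blast+
  ultimately show ?thesis using assms(1,3) by (metis finite_Diff)
qed

lemma weighted_sum_trace:
  assumes "finite V" "U \<subseteq> V" "\<beta> \<subseteq> U"
  shows "weighted_sum V (\<lambda>A. if A \<inter> U = \<beta> then c else 0) = subset_weight (card U) (card \<beta>) * c"
proof -
  have fU: "finite U" using assms finite_subset by blast
  have "weighted_sum V (\<lambda>A. if A \<inter> U = \<beta> then c else 0) = weighted_sum U (\<lambda>A. if A \<inter> U = \<beta> then c else 0)"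
    by (rule weighted_sum_extend) (use assms in auto)
  also have "\<dots> = (\<Sum>A\<in>Pow U. if A = \<beta> then subset_weight (card U) (card \<beta>) * c else 0)"
    unfolding weighted_sum_def by (intro sum.cong) (auto simp: Int_absorb2)
  also have "\<dots> = subset_weight (card U) (card \<beta>) * c" using assms fU by simp
  finally show ?thesis .
qed

lemma weighted_sum_add: "weighted_sum V (\<lambda>A. \<phi> A + \<psi> A) = weighted_sum V \<phi> + weighted_sum V \<psi>"
  by (simp add: weighted_sum_def algebra_simps sum.distrib)

context simplex_filling
begin

text \<open>Only the subsets with \<open>A \<inter> U = \<beta>\<close> contribute, each by the effect of attaching \<open>\<beta>\<close>. The strict
  inequality comes from \<open>A = \<beta>\<close>: the boundary of \<open>\<beta>\<close> carries a class of the top degree \<open>k\<close>, which the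
  face \<open>\<beta>\<close> kills.\<close>

lemma
  assumes V: "finite V" "U \<subseteq> V" and b: "card \<beta> = Suc n"
  shows weighted_sum_fill_low: "Suc n \<le> k \<Longrightarrow> weighted_sum V (\<lambda>A. alt_betti TYPE('f::field) k (induced (K \<union> Pow U) A))
      = weighted_sum V (\<lambda>A. alt_betti TYPE('f) k (induced K A)) + (-1) ^ (k - Suc n) * subset_weight (card U) (Suc n)"
    and weighted_sum_fill_mid: "n = k \<Longrightarrow> weighted_sum V (\<lambda>A. alt_betti TYPE('f::field) k (induced (K \<union> Pow U) A))
      < weighted_sum V (\<lambda>A. alt_betti TYPE('f) k (induced K A))"
    and weighted_sum_fill_high: "k < n \<Longrightarrow> weighted_sum V (\<lambda>A. alt_betti TYPE('f::field) k (induced (K \<union> Pow U) A))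
      = weighted_sum V (\<lambda>A. alt_betti TYPE('f) k (induced K A))"
proof -
  let ?\<phi> = "\<lambda>A. alt_betti TYPE('f) k (induced (K \<union> Pow U) A)" and ?\<psi> = "\<lambda>A. alt_betti TYPE('f) k (induced K A)"
  have same: "?\<phi> A = ?\<psi> A" if "A \<inter> U \<noteq> \<beta>" for A
    unfolding alt_betti_def face_betti_induced_same[OF that] ..
  have simp1: "simplicial_complex (insert \<beta> (induced K A))" if "A \<inter> U = \<beta>" for A
    using simplicial_induced[OF simplicial_filled, of A] induced_attach[OF that] by simp
  have tr: "?\<phi> A = ?\<psi> A + (if A \<inter> U = \<beta> then c else 0)"
    if "\<And>A. A \<inter> U = \<beta> \<Longrightarrow> ?\<phi> A = ?\<psi> A + c" for c A using that same by auto
  show "weighted_sum V ?\<phi> = weighted_sum V ?\<psi> + (-1) ^ (k - Suc n) * subset_weight (card U) (Suc n)" if "Suc n \<le> k"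
  proof -
    have "?\<phi> A = ?\<psi> A + (-1) ^ (k - Suc n)" if "A \<inter> U = \<beta>" for A
      unfolding induced_attach(1)[OF that]
      by (rule alt_betti_attach_low[OF simplicial_induced[OF K] simp1 induced_attach(2) b]) fact+
    from tr[OF this] have "?\<phi> = (\<lambda>A. ?\<psi> A + (if A \<inter> U = \<beta> then (-1) ^ (k - Suc n) else 0))" by (rule ext)
    then show ?thesis using weighted_sum_trace[OF V \<beta>(1), of "(-1) ^ (k - Suc n)"] b by (simp only: weighted_sum_add mult.commute)
  qed
  show "weighted_sum V ?\<phi> = weighted_sum V ?\<psi>" if "k < n"
  proof -
    have "?\<phi> A = ?\<psi> A + 0" if "A \<inter> U = \<beta>" for A
      unfolding induced_attach(1)[OF that] add_0_right
      by (rule alt_betti_attach_high[OF simplicial_induced[OF K] simp1 induced_attach(2) b]) fact+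
    from tr[OF this] have "?\<phi> = ?\<psi>" by (simp add: fun_eq_iff)
    then show ?thesis by simp
  qed
  show "weighted_sum V ?\<phi> < weighted_sum V ?\<psi>" if "n = k"
    unfolding weighted_sum_def
  proof (rule sum_strict_mono_ex1)
    show "finite (Pow V)" using V by simp
    show "\<forall>A\<in>Pow V. subset_weight (card V) (card A) * ?\<phi> A \<le> subset_weight (card V) (card A) * ?\<psi> A"
    proof
      fix A assume "A \<in> Pow V"
      then have "subset_weight (card V) (card A) > 0" using V by (intro subset_weight_pos card_mono) auto
      moreover have "?\<phi> A \<le> ?\<psi> A"
      proof (cases "A \<inter> U = \<beta>")
        case True
        show ?thesis unfolding induced_attach(1)[OF True]
          by (rule alt_betti_attach_mid[OF simplicial_induced[OF K] simp1 induced_attach(2) b]) fact+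
      qed (simp add: same)
      ultimately show "subset_weight (card V) (card A) * ?\<phi> A \<le> subset_weight (card V) (card A) * ?\<psi> A" by simp
    qed
    show "\<exists>A\<in>Pow V. subset_weight (card V) (card A) * ?\<phi> A < subset_weight (card V) (card A) * ?\<psi> A"
    proof
      show bV: "\<beta> \<in> Pow V" using \<beta> V by blast
      have fb: "finite \<beta>" using \<beta> U finite_subset by blast
      have 1: "induced (K \<union> Pow U) \<beta> = Pow \<beta>" using \<beta> simplicial_subset[OF K]
        by (auto simp: induced_def)
      have 2: "induced K \<beta> = simplex_boundary \<beta>"
        using mem \<beta> by (auto simp: induced_def simplex_boundary_def)
      have "?\<phi> \<beta> = 0" unfolding 1 alt_betti_def face_betti_Pow[OF fb \<beta>(2)] by simp
      moreover have "?\<psi> \<beta> = (\<Sum>m\<le>k. if m = k then 1 else 0)"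
        unfolding 2 alt_betti_def face_betti_simplex_boundary[OF fb \<beta>(2)] b using that by (intro sum.cong) auto
      moreover have "subset_weight (card V) (card \<beta>) > 0" using V bV by (intro subset_weight_pos card_mono) auto
      ultimately show "subset_weight (card V) (card \<beta>) * ?\<phi> \<beta> < subset_weight (card V) (card \<beta>) * ?\<psi> \<beta>" by simp
    qed
  qed
qed

end

section \<open>The h-polynomial\<close>

text \<open>The h-polynomial \<open>(1 - x) ^ D * f (x / (1 - x))\<close> of a complex whose facets have \<open>D\<close> vertices,
  where \<open>f\<close> counts faces by their number of vertices. For a \<open>d\<close>-sphere and \<open>D = d + 2\<close>, one more than
  its facets have, the coefficients form the g-vector.\<close>

definition hpoly :: "nat \<Rightarrow> 'v set set \<Rightarrow> int poly" where
  "hpoly D K = (\<Sum>\<gamma>\<in>K. [:0, 1:] ^ card \<gamma> * [:1, -1:] ^ (D - card \<gamma>))"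

lemma coeff_hpoly_term:
  "coeff ([:0, 1:] ^ c * [:1, -1:] ^ e) j = (if c \<le> j then (-1) ^ (j - c) * int (e choose (j - c)) else (0::int))"
proof -
  have "coeff ([:1, -1:] ^ e) i = (-1) ^ i * int (e choose i)" for i :: nat
  proof (cases "i \<le> e")
    case True then show ?thesis by (simp add: coeff_linear_poly_power)
  next
    case False
    have "degree ([:1, -1:] ^ e :: int poly) \<le> e"
      using degree_power_le[of "[:1, -1:] :: int poly" e] by simp
    then show ?thesis using False by (simp add: coeff_eq_0 binomial_eq_0)
  qed
  moreover have "[:0, 1:] ^ c = (monom 1 c :: int poly)" by (simp add: monom_altdef)
  ultimately show ?thesis by (simp add: coeff_monom_mult)
qed

lemma g_num_eq_coeff:
  assumes K: "finite K"
  shows "g_num d j K = coeff (hpoly (d + 2) K) j"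
proof -
  let ?t = "\<lambda>c. (-1) ^ (j - c) * int ((d + 2 - c) choose (j - c))"
  let ?Kj = "{\<gamma>\<in>K. card \<gamma> \<le> j}"
  have "g_num d j K = (\<Sum>c\<in>{0..j}. ?t c * int (card {\<gamma>\<in>K. card \<gamma> = c}))"
    unfolding g_num_def
  proof (rule sum.reindex_bij_witness[where i = "\<lambda>c. int c - 1" and j = "\<lambda>i. nat (i + 1)"])
    fix i assume i: "i \<in> {-1..int j - 1}"
    define c where "c = nat (i + 1)"
    have ic: "i = int c - 1" "c \<le> j" using i by (auto simp: c_def)
    have e: "nat (int j - i - 1) = j - c" "nat (int d - i + 1) = d + 2 - c" using ic by auto
    have "{\<alpha> \<in> K. face_dim \<alpha> = i} = {\<gamma>\<in>K. card \<gamma> = c}" by (auto simp: face_dim_def ic)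
    then show "?t (nat (i + 1)) * int (card {\<gamma>\<in>K. card \<gamma> = nat (i + 1)}) = (-1) ^ nat (int j - i - 1) *
        int (nat (int d - i + 1) choose nat (int j - i - 1)) * int (f_num i K)"
      unfolding e f_num_def c_def[symmetric] by simp
  qed auto
  also have "\<dots> = (\<Sum>c\<in>{0..j}. \<Sum>\<gamma>\<in>{\<gamma>\<in>?Kj. card \<gamma> = c}. ?t (card \<gamma>))"
  proof (rule sum.cong[OF refl])
    fix c assume "c \<in> {0..j}"
    then have "{\<gamma>\<in>?Kj. card \<gamma> = c} = {\<gamma>\<in>K. card \<gamma> = c}" by auto
    then show "?t c * int (card {\<gamma>\<in>K. card \<gamma> = c}) = (\<Sum>\<gamma>\<in>{\<gamma>\<in>?Kj. card \<gamma> = c}. ?t (card \<gamma>))" by simp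
  qed
  also have "\<dots> = (\<Sum>\<gamma>\<in>?Kj. ?t (card \<gamma>))"
    by (rule sum.group) (use K in auto)
  also have "\<dots> = (\<Sum>\<gamma>\<in>K. if card \<gamma> \<le> j then ?t (card \<gamma>) else 0)"
    by (rule sum.inter_filter[OF K])
  also have "\<dots> = coeff (hpoly (d + 2) K) j"
    unfolding hpoly_def coeff_sum coeff_hpoly_term ..
  finally show ?thesis .
qed

lemma sum_Pow_powers:
  fixes p q :: "'a::comm_ring_1"
  assumes "finite E" shows "(\<Sum>\<delta>\<in>Pow E. p ^ card \<delta> * q ^ (card E - card \<delta>)) = (p + q) ^ card E"
proof -
  have "(p + q) ^ card E = (\<Prod>x\<in>E. p + q)" by simp
  also have "\<dots> = (\<Sum>\<delta>\<in>Pow E. (\<Prod>x\<in>\<delta>. p) * (\<Prod>x\<in>E - \<delta>. q))" by (rule prod_add[OF assms])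
  also have "\<dots> = (\<Sum>\<delta>\<in>Pow E. p ^ card \<delta> * q ^ (card E - card \<delta>))"
    using assms by (intro sum.cong refl) (auto simp: card_Diff_subset finite_subset)
  finally show ?thesis by simp
qed

text \<open>By the binomial theorem: the faces between \<open>\<beta>\<close> and \<open>U\<close> contribute \<open>x\<close> to the power \<open>card \<beta>\<close> times
  a power of \<open>x + (1 - x)\<close>. Here it matters that \<open>U\<close> has exactly \<open>D\<close> elements.\<close>

lemma hpoly_interval:
  assumes U: "finite U" "card U = D" and \<beta>: "\<beta> \<subseteq> U"
  shows "hpoly D {\<gamma>. \<gamma> \<subseteq> U \<and> \<beta> \<subseteq> \<gamma>} = [:0, 1:] ^ card \<beta>"
proof -
  let ?E = "U - \<beta>"
  have fb: "finite \<beta>" using U \<beta> finite_subset by blast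
  have E: "finite ?E" "card ?E = D - card \<beta>" using U \<beta> fb by (auto simp: card_Diff_subset)
  have "hpoly D {\<gamma>. \<gamma> \<subseteq> U \<and> \<beta> \<subseteq> \<gamma>} = (\<Sum>\<delta>\<in>Pow ?E. [:0, 1:] ^ card \<beta> * ([:0, 1:] ^ card \<delta> * [:1, -1:] ^ (card ?E - card \<delta>)))"
    unfolding hpoly_def
  proof (rule sum.reindex_bij_witness[where i = "\<lambda>\<delta>. \<beta> \<union> \<delta>" and j = "\<lambda>\<gamma>. \<gamma> - \<beta>"])
    fix \<gamma> assume g: "\<gamma> \<in> {\<gamma>. \<gamma> \<subseteq> U \<and> \<beta> \<subseteq> \<gamma>}"
    then have "finite \<gamma>" using U finite_subset by blast
    then have "card \<gamma> = card \<beta> + card (\<gamma> - \<beta>)" using g fb by (simp add: card_Diff_subset card_mono)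
    then show "[:0, 1:] ^ card \<beta> * ([:0, 1:] ^ card (\<gamma> - \<beta>) * [:1, -1:] ^ (card ?E - card (\<gamma> - \<beta>)))
      = [:0, 1:] ^ card \<gamma> * [:1, -1:] ^ (D - card \<gamma>)"
      by (simp add: power_add E(2) mult.assoc)
  qed (use \<beta> in auto)
  also have "\<dots> = [:0, 1:] ^ card \<beta> * ([:0, 1:] + [:1, -1:]) ^ card ?E"
    unfolding sum_distrib_left[symmetric] sum_Pow_powers[OF E(1)] ..
  also have "[:0, 1:] + [:1, -1:] = (1 :: int poly)" by (simp add: one_pCons)
  finally show ?thesis by simp
qed

lemma hpoly_Un: "finite A \<Longrightarrow> finite B \<Longrightarrow> A \<inter> B = {} \<Longrightarrow> hpoly D (A \<union> B) = hpoly D A + hpoly D B"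
  unfolding hpoly_def by (rule sum.union_disjoint)

lemma hpoly_Pow: "finite U \<Longrightarrow> card U = D \<Longrightarrow> hpoly D (Pow U) = 1"
  using hpoly_interval[of U D "{}"] by (simp add: Pow_def)

lemma hpoly_fill:
  assumes K: "finite K" and U: "finite U" "card U = D" and \<beta>: "\<beta> \<subseteq> U"
    and mem: "\<And>\<gamma>. \<gamma> \<subseteq> U \<Longrightarrow> \<gamma> \<in> K \<longleftrightarrow> \<not> \<beta> \<subseteq> \<gamma>"
  shows "hpoly D (K \<union> Pow U) = hpoly D K + [:0, 1:] ^ card \<beta>"
proof -
  have eq: "K \<union> Pow U = K \<union> {\<gamma>. \<gamma> \<subseteq> U \<and> \<beta> \<subseteq> \<gamma>}" using mem by blast
  have "finite {\<gamma>. \<gamma> \<subseteq> U \<and> \<beta> \<subseteq> \<gamma>}" by (rule finite_subset[of _ "Pow U"]) (use U in auto)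
  moreover have "K \<inter> {\<gamma>. \<gamma> \<subseteq> U \<and> \<beta> \<subseteq> \<gamma>} = {}" using mem by blast
  ultimately show ?thesis unfolding eq using hpoly_Un[OF K] hpoly_interval[OF U \<beta>] by metis
qed

lemma coeff_X_power: "coeff ([:0, 1:] ^ c) j = (if j = c then 1 else (0::int))"
  using coeff_monom[of "1::int" c j] by (simp add: monom_altdef)

section \<open>Bistellar moves\<close>

lemma join_eq:
  assumes "\<alpha> \<inter> \<beta> = {}"
  shows "join (full_simplex \<alpha>) (simplex_boundary \<beta>) = {\<gamma>. \<gamma> \<subseteq> \<alpha> \<union> \<beta> \<and> \<not> \<beta> \<subseteq> \<gamma>}"
proof (intro Set.set_eqI iffI)
  fix \<gamma> assume "\<gamma> \<in> join (full_simplex \<alpha>) (simplex_boundary \<beta>)"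
  then obtain a b where "\<gamma> = a \<union> b" "a \<subseteq> \<alpha>" "b \<subset> \<beta>"
    by (auto simp: join_def full_simplex_def simplex_boundary_def)
  then show "\<gamma> \<in> {\<gamma>. \<gamma> \<subseteq> \<alpha> \<union> \<beta> \<and> \<not> \<beta> \<subseteq> \<gamma>}" using assms by blast
next
  fix \<gamma> assume g: "\<gamma> \<in> {\<gamma>. \<gamma> \<subseteq> \<alpha> \<union> \<beta> \<and> \<not> \<beta> \<subseteq> \<gamma>}"
  have "\<gamma> = (\<gamma> \<inter> \<alpha>) \<union> (\<gamma> \<inter> \<beta>)" "\<gamma> \<inter> \<alpha> \<subseteq> \<alpha>" "\<gamma> \<inter> \<beta> \<subset> \<beta>" using g by blast+
  then show "\<gamma> \<in> join (full_simplex \<alpha>) (simplex_boundary \<beta>)"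
    unfolding join_def full_simplex_def simplex_boundary_def by blast
qed

text \<open>That the result of the move is a complex again is assumed: it would fail if \<open>\<alpha>\<close> were contained in
  a face of \<open>X\<close> outside \<open>\<alpha> \<union> \<beta>\<close>, which \<open>admits_move\<close> alone does not exclude.\<close>

locale bistellar =
  fixes d :: nat and X :: "'v::linorder set set" and \<alpha> \<beta> :: "'v set"
  assumes admits: "admits_move d X \<alpha> \<beta>" and simplicial_Y: "simplicial_complex (bistellar_move X \<alpha> \<beta>)"
begin

abbreviation "U \<equiv> \<alpha> \<union> \<beta>"
abbreviation "Y \<equiv> bistellar_move X \<alpha> \<beta>"

lemma basic: "simplicial_complex X" "finite \<alpha>" "finite \<beta>" "\<alpha> \<noteq> {}" "\<beta> \<noteq> {}" "\<alpha> \<inter> \<beta> = {}"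
    "card \<alpha> + card \<beta> = d + 2"
  using admits by (auto simp: admits_move_def complex_of_dim_def)

lemma card_U: "card U = d + 2"
  using basic by (simp add: card_Un_disjoint)

lemma mem_X: "\<gamma> \<subseteq> U \<Longrightarrow> \<gamma> \<in> X \<longleftrightarrow> \<not> \<beta> \<subseteq> \<gamma>"
  using admits basic(6) by (auto simp: admits_move_def join_eq induced_def)

lemma Y_eq: "Y = {\<gamma>\<in>X. \<not> \<gamma> \<subseteq> U} \<union> {\<gamma>. \<gamma> \<subseteq> U \<and> \<not> \<alpha> \<subseteq> \<gamma>}"
proof -
  have "\<beta> \<inter> \<alpha> = {}" using basic(6) by blast
  then show ?thesis unfolding bistellar_move_def join_eq[OF basic(6)] join_eq[OF \<open>\<beta> \<inter> \<alpha> = {}\<close>]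
    using mem_X by blast
qed

lemma mem_Y: "\<gamma> \<subseteq> U \<Longrightarrow> \<gamma> \<in> Y \<longleftrightarrow> \<not> \<alpha> \<subseteq> \<gamma>"
  unfolding Y_eq by blast

lemma mem_Y_outside: "\<not> \<gamma> \<subseteq> U \<Longrightarrow> \<gamma> \<in> Y \<longleftrightarrow> \<gamma> \<in> X"
  unfolding Y_eq by blast

lemma filling_X: "simplex_filling X U \<beta>"
  by unfold_locales (use basic mem_X in auto)

lemma filling_Y: "simplex_filling Y U \<alpha>"
  by unfold_locales (use basic simplicial_Y mem_Y in auto)

lemma Un_Pow_eq: "Y \<union> Pow U = X \<union> Pow U"
  unfolding Y_eq by blast

text \<open>Both complexes become the same one after filling in \<open>U\<close>, at the cost of the faces above \<open>\<beta>\<close>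
  and of the faces above \<open>\<alpha>\<close>, respectively.\<close>

lemma hpoly_move: "hpoly (d + 2) Y = hpoly (d + 2) X + [:0, 1:] ^ card \<beta> - [:0, 1:] ^ card \<alpha>"
proof -
  have U: "finite U" using basic by simp
  have "hpoly (d + 2) (X \<union> Pow U) = hpoly (d + 2) X + [:0, 1:] ^ card \<beta>"
    by (rule hpoly_fill[OF simplicial_finite[OF basic(1)] U card_U _ mem_X]) blast+
  moreover have "hpoly (d + 2) (Y \<union> Pow U) = hpoly (d + 2) Y + [:0, 1:] ^ card \<alpha>"
    by (rule hpoly_fill[OF simplicial_finite[OF simplicial_Y] U card_U _ mem_Y]) blast+
  ultimately show ?thesis unfolding Un_Pow_eq by simp
qed

lemma g_num_move:
  "g_num d j Y = g_num d j X + (if j = card \<beta> then 1 else 0) - (if j = card \<alpha> then 1 else 0)"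
  unfolding g_num_eq_coeff[OF simplicial_finite[OF basic(1)]] g_num_eq_coeff[OF simplicial_finite[OF simplicial_Y]]
    hpoly_move by (simp add: coeff_X_power)

end

lemma g_num_simplex_boundary:
  assumes "finite \<sigma>" "card \<sigma> = d + 2"
  shows "g_num d j (simplex_boundary \<sigma>) = (if j = 0 then 1 else 0) - (if j = d + 2 then 1 else 0)"
proof -
  have fin: "finite (simplex_boundary \<sigma>)"
    by (rule finite_subset[of _ "Pow \<sigma>"]) (use assms in \<open>auto simp: simplex_boundary_def\<close>)
  have "simplex_boundary \<sigma> \<union> Pow \<sigma> = Pow \<sigma>" by (auto simp: simplex_boundary_def)
  moreover have "hpoly (d + 2) (simplex_boundary \<sigma> \<union> Pow \<sigma>) = hpoly (d + 2) (simplex_boundary \<sigma>) + [:0, 1:] ^ card \<sigma>"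
    by (rule hpoly_fill[OF fin assms]) (auto simp: simplex_boundary_def)
  ultimately have "hpoly (d + 2) (simplex_boundary \<sigma>) = 1 - [:0, 1:] ^ (d + 2)"
    using hpoly_Pow[OF assms] by (simp only: assms(2) eq_diff_eq)
  then show ?thesis unfolding g_num_eq_coeff[OF fin] by (simp only: coeff_diff coeff_1 coeff_X_power of_bool_def)
qed

section \<open>Homology spheres from bistellar moves\<close>

text \<open>The link of the empty face is \<open>X\<close> itself, so the condition on links includes that \<open>X\<close> has the
  homology of a \<open>d\<close>-sphere. Treating the empty face like the others keeps the induction uniform.\<close>

definition spherical :: "'f::field itself \<Rightarrow> nat \<Rightarrow> 'v::linorder set set \<Rightarrow> bool" where
  "spherical F d X \<longleftrightarrow> simplicial_complex X \<and> (\<forall>\<gamma>\<in>X. \<exists>\<phi>\<in>X. \<gamma> \<subseteq> \<phi> \<and> card \<phi> = d + 1) \<and> (\<forall>\<gamma>\<in>X. card \<gamma> \<le> d + 1)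
     \<and> (\<forall>\<gamma>\<in>X. \<forall>n. face_betti F n (link X \<gamma>) = (if n = d + 1 - card \<gamma> then 1 else 0))"

lemma link_simplex_boundary:
  assumes "\<gamma> \<in> simplex_boundary \<sigma>" shows "link (simplex_boundary \<sigma>) \<gamma> = simplex_boundary (\<sigma> - \<gamma>)"
  using assms by (auto simp: link_def simplex_boundary_def)

lemma link_Pow: "\<gamma> \<subseteq> \<sigma> \<Longrightarrow> link (Pow \<sigma>) \<gamma> = Pow (\<sigma> - \<gamma>)"
  by (auto simp: link_def)

lemma face_betti_boundary_of_complement:
  fixes \<sigma> :: "'v::linorder set"
  assumes "finite \<sigma>" "card \<sigma> = d + 2" "\<gamma> \<subset> \<sigma>"
  shows "face_betti TYPE('f::field) n (simplex_boundary (\<sigma> - \<gamma>)) = (if n = d + 1 - card \<gamma> then 1 else 0)"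
proof -
  have "card \<gamma> < card \<sigma>" "finite \<gamma>" using assms psubset_card_mono finite_subset by blast+
  then have "card (\<sigma> - \<gamma>) = d + 2 - card \<gamma>" "card \<gamma> < d + 2" using assms by (auto simp: card_Diff_subset)
  then show ?thesis using assms by (subst face_betti_simplex_boundary) auto
qed

lemma spherical_simplex_boundary:
  assumes s: "finite \<sigma>" "card \<sigma> = d + 2" shows "spherical TYPE('f::field) d (simplex_boundary \<sigma>)"
  unfolding spherical_def
proof (intro conjI ballI allI)
  have ne: "\<sigma> \<noteq> {}" using s by auto
  show "simplicial_complex (simplex_boundary \<sigma>)" by (rule simplicial_boundary[OF s(1) ne])
  fix \<gamma> assume g: "\<gamma> \<in> simplex_boundary \<sigma>"
  then have gs: "\<gamma> \<subset> \<sigma>" by (simp add: simplex_boundary_def)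
  then obtain v where v: "v \<in> \<sigma>" "v \<notin> \<gamma>" by blast
  show "\<exists>\<phi>\<in>simplex_boundary \<sigma>. \<gamma> \<subseteq> \<phi> \<and> card \<phi> = d + 1"
    by (rule bexI[of _ "\<sigma> - {v}"]) (use v gs s in \<open>auto simp: simplex_boundary_def\<close>)
  show "card \<gamma> \<le> d + 1" using psubset_card_mono[OF s(1) gs] s by simp
  show "face_betti TYPE('f) n (link (simplex_boundary \<sigma>) \<gamma>) = (if n = d + 1 - card \<gamma> then 1 else 0)" for n
    unfolding link_simplex_boundary[OF g] by (rule face_betti_boundary_of_complement[OF s gs])
qed

lemma (in bistellar) facet_in_Y:
  assumes "\<gamma> \<subseteq> U" "\<not> \<alpha> \<subseteq> \<gamma>"
  shows "\<exists>\<phi>\<in>Y. \<gamma> \<subseteq> \<phi> \<and> card \<phi> = d + 1"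
proof -
  obtain a where a: "a \<in> \<alpha>" "a \<notin> \<gamma>" using assms by blast
  have "\<not> \<alpha> \<subseteq> U - {a}" using a by blast
  then have "U - {a} \<in> Y" using mem_Y[of "U - {a}"] by blast
  moreover have "card (U - {a}) = d + 1" using a card_U by simp
  moreover have "\<gamma> \<subseteq> U - {a}" using a assms by blast
  ultimately show ?thesis by (intro bexI[of _ "U - {a}"]) simp_all
qed

text \<open>A face inside \<open>U\<close> that contains neither \<open>\<alpha>\<close> nor \<open>\<beta>\<close> has, up to cancelling pairs, the same
  link in \<open>X\<close>, in \<open>Y\<close> and in their common filling. A face inside \<open>U\<close> that contains \<open>\<beta>\<close> is new, and its
  link in \<open>Y\<close> is the boundary of the simplex on \<open>U - \<gamma>\<close>.\<close>

lemma (in bistellar) spherical_Y: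
  assumes X: "spherical TYPE('f::field) d X" shows "spherical TYPE('f) d Y"
proof -
  have pure: "\<exists>\<phi>\<in>X. \<gamma> \<subseteq> \<phi> \<and> card \<phi> = d + 1" and cX: "card \<gamma> \<le> d + 1"
    and hX: "face_betti TYPE('f) n (link X \<gamma>) = (if n = d + 1 - card \<gamma> then 1 else 0)" if "\<gamma> \<in> X" for \<gamma> n
    using X that unfolding spherical_def by blast+
  interpret FX: simplex_filling X U \<beta> by (rule filling_X)
  interpret FY: simplex_filling Y U \<alpha> by (rule filling_Y)
  have fU: "finite U" using basic by simp
  have UX: "U - \<beta> = \<alpha>" and UY: "U - \<alpha> = \<beta>" using basic(6) by blast+
  show ?thesis
    unfolding spherical_def
  proof (intro conjI ballI allI)
    show "simplicial_complex Y" by (rule simplicial_Y)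
    fix \<gamma> assume g: "\<gamma> \<in> Y"
    show "\<exists>\<phi>\<in>Y. \<gamma> \<subseteq> \<phi> \<and> card \<phi> = d + 1"
    proof (cases "\<gamma> \<subseteq> U")
      case True
      then have "\<not> \<alpha> \<subseteq> \<gamma>" using mem_Y[OF True] g by simp
      with True show ?thesis by (rule facet_in_Y)
    next
      case False
      then have "\<gamma> \<in> X" using mem_Y_outside[OF False] g by simp
      from pure[OF this] obtain \<phi> where p: "\<phi> \<in> X" "\<gamma> \<subseteq> \<phi>" "card \<phi> = d + 1" by blast
      then have "\<not> \<phi> \<subseteq> U" using False by blast
      then have "\<phi> \<in> Y" using mem_Y_outside p(1) by simp
      then show ?thesis using p by blast
    qed
    show "card \<gamma> \<le> d + 1"
    proof (cases "\<gamma> \<subseteq> U")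
      case True
      then have "\<gamma> \<subset> U" using mem_Y[OF True] g by blast
      from psubset_card_mono[OF fU this] show ?thesis using card_U by simp
    next
      case False then show ?thesis using cX mem_Y_outside[OF False] g by simp
    qed
    fix n
    show "face_betti TYPE('f) n (link Y \<gamma>) = (if n = d + 1 - card \<gamma> then 1 else 0)"
    proof (cases "\<gamma> \<subseteq> U")
      case False
      have "link Y \<gamma> = link X \<gamma>"
        using FX.link_outside[OF False] FY.link_outside[OF False] Un_Pow_eq by simp
      then show ?thesis using hX False mem_Y_outside g by simp
    next
      case True
      have na: "\<not> \<alpha> \<subseteq> \<gamma>" using mem_Y[OF True] g by simp
      show ?thesis
      proof (cases "\<beta> \<subseteq> \<gamma>")
        case False
        have "face_betti TYPE('f) n (link Y \<gamma>) = face_betti TYPE('f) n (link (X \<union> Pow U) \<gamma>)"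
          using FY.face_betti_link_same[OF True na, where 'f = 'f and n = n] False UY Un_Pow_eq by simp
        also have "\<dots> = face_betti TYPE('f) n (link X \<gamma>)"
          using FX.face_betti_link_same[OF True False, where 'f = 'f and n = n] na UX by simp
        finally show ?thesis using hX mem_X[OF True] False by simp
      next
        case b: True
        have e: "\<alpha> - \<gamma> = U - \<gamma>" using b True by blast
        have sub: "link Y \<gamma> \<subseteq> Pow (U - \<gamma>)"
          using FX.link_new[OF True b] FY.link_inside[OF True] unfolding Un_Pow_eq by (metis Un_upper1)
        have "link Y \<gamma> = simplex_boundary (U - \<gamma>)"
        proof (rule Set.set_eqI)
          fix \<delta> show "\<delta> \<in> link Y \<gamma> \<longleftrightarrow> \<delta> \<in> simplex_boundary (U - \<gamma>)"
          proof (cases "\<delta> \<subseteq> U - \<gamma>")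
            case d: True
            have "\<delta> \<in> simplex_boundary (U - \<gamma>) \<longleftrightarrow> \<not> U - \<gamma> \<subseteq> \<delta>"
              using d by (auto simp: simplex_boundary_def)
            then show ?thesis using FY.link_filling[OF True na d] unfolding e by simp
          next
            case False
            then have "\<delta> \<notin> link Y \<gamma>" using sub by blast
            moreover have "\<delta> \<notin> simplex_boundary (U - \<gamma>)" using False by (auto simp: simplex_boundary_def)
            ultimately show ?thesis by simp
          qed
        qed
        moreover have "\<gamma> \<subset> U" using True na by blast
        ultimately show ?thesis using face_betti_boundary_of_complement[OF fU card_U, where 'f = 'f] by simp
      qed
    qed
  qed
qed

section \<open>Balls from bistellar moves\<close>

text \<open>A ball together with its boundary: a move with \<open>card \<beta> \<le> k\<close> on the boundary glues the simplex
  on \<open>\<alpha> \<union> \<beta>\<close> onto the ball.\<close>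

inductive flip_ball :: "nat \<Rightarrow> nat \<Rightarrow> 'v::linorder set set \<Rightarrow> 'v set set \<Rightarrow> bool" for d k :: nat where
  simplex: "finite \<sigma> \<Longrightarrow> card \<sigma> = d + 2 \<Longrightarrow> flip_ball d k (Pow \<sigma>) (simplex_boundary \<sigma>)"
| flip: "flip_ball d k \<Delta> X \<Longrightarrow> admits_move d X \<alpha> \<beta> \<Longrightarrow> simplicial_complex (bistellar_move X \<alpha> \<beta>) \<Longrightarrow> card \<beta> \<le> k \<Longrightarrow>
    flip_ball d k (\<Delta> \<union> Pow (\<alpha> \<union> \<beta>)) (bistellar_move X \<alpha> \<beta>)"

lemma flip_ball_spherical: "flip_ball d k \<Delta> X \<Longrightarrow> spherical TYPE('f::field) d X"
proof (induction rule: flip_ball.induct)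
  case (simplex \<sigma>) then show ?case by (rule spherical_simplex_boundary)
next
  case (flip \<Delta> X \<alpha> \<beta>)
  interpret bistellar d X \<alpha> \<beta> using flip by unfold_locales
  show ?case by (rule spherical_Y) fact
qed

text \<open>Links of faces in \<open>X\<close> are acyclic, those of the other faces are spheres; for the empty face this
  says that \<open>\<Delta>\<close> is acyclic. The last condition bounds the missing faces of \<open>\<Delta>\<close>: a set whose proper
  subsets are all faces is itself a face once it has more than \<open>k + 1\<close> elements.\<close>

definition thin_ball :: "'f::field itself \<Rightarrow> nat \<Rightarrow> nat \<Rightarrow> 'v::linorder set set \<Rightarrow> 'v set set \<Rightarrow> bool" where
  "thin_ball F d k \<Delta> X \<longleftrightarrow> simplicial_complex \<Delta> \<and> X \<subseteq> \<Delta>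
     \<and> (\<forall>\<gamma>\<in>\<Delta>. card \<gamma> \<le> d + 1 - k \<longrightarrow> \<gamma> \<in> X)
     \<and> (\<forall>\<gamma>\<in>\<Delta>. \<exists>\<phi>\<in>\<Delta>. \<gamma> \<subseteq> \<phi> \<and> card \<phi> = d + 2) \<and> (\<forall>\<gamma>\<in>\<Delta>. card \<gamma> \<le> d + 2)
     \<and> (\<forall>\<gamma>\<in>\<Delta>. \<forall>n. face_betti F n (link \<Delta> \<gamma>) = (if \<gamma> \<notin> X \<and> n = d + 2 - card \<gamma> then 1 else 0))
     \<and> (\<forall>T. finite T \<and> k + 2 \<le> card T \<and> (\<forall>v\<in>T. T - {v} \<in> \<Delta>) \<longrightarrow> T \<in> \<Delta>)"

lemma thin_ball_simplex:
  assumes s: "finite \<sigma>" "card \<sigma> = d + 2" shows "thin_ball TYPE('f::field) d k (Pow \<sigma>) (simplex_boundary \<sigma>)"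
  unfolding thin_ball_def
proof (intro conjI ballI allI impI)
  show "simplicial_complex (Pow \<sigma>)" using s by (simp add: simplicial_Pow)
  show "simplex_boundary \<sigma> \<subseteq> Pow \<sigma>" by (auto simp: simplex_boundary_def)
  fix \<gamma> assume g: "\<gamma> \<in> Pow \<sigma>"
  show "\<gamma> \<in> simplex_boundary \<sigma>" if "card \<gamma> \<le> d + 1 - k"
    using g that s by (auto simp: simplex_boundary_def)
  show "\<exists>\<phi>\<in>Pow \<sigma>. \<gamma> \<subseteq> \<phi> \<and> card \<phi> = d + 2" using g s by blast
  show "card \<gamma> \<le> d + 2" using g s card_mono[of \<sigma> \<gamma>] by auto
  fix n
  show "face_betti TYPE('f) n (link (Pow \<sigma>) \<gamma>) = (if \<gamma> \<notin> simplex_boundary \<sigma> \<and> n = d + 2 - card \<gamma> then 1 else 0)"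
  proof (cases "\<gamma> = \<sigma>")
    case True
    then show ?thesis using s by (simp add: link_Pow face_betti_empty_complex simplex_boundary_def)
  next
    case False
    then have "\<gamma> \<subset> \<sigma>" "\<sigma> - \<gamma> \<noteq> {}" using g by auto
    then show ?thesis using s by (simp add: link_Pow face_betti_Pow simplex_boundary_def psubset_imp_subset)
  qed
next
  fix T assume T: "finite T \<and> k + 2 \<le> card T \<and> (\<forall>v\<in>T. T - {v} \<in> Pow \<sigma>)"
  then have "\<not> card T \<le> Suc 0" "finite T" by auto
  then obtain u v where uv: "u \<in> T" "v \<in> T" "u \<noteq> v"
    using card_le_Suc0_iff_eq[of T] by blast
  have "T \<subseteq> (T - {u}) \<union> (T - {v})" using uv by blast
  then show "T \<in> Pow \<sigma>" using T uv by blast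
qed

text \<open>Since \<open>\<beta>\<close> has at most \<open>k\<close> vertices, it is not an interior face of \<open>\<Delta>\<close> either, so gluing on the
  simplex adds exactly the faces above \<open>\<beta>\<close>. The faces of \<open>U\<close> above \<open>\<alpha>\<close> become interior: their acyclic
  links receive one further face, which has to create a class.\<close>

lemma thin_ball_flip:
  fixes X :: "'v::linorder set set"
  assumes k: "2 * k \<le> d" and F: "thin_ball TYPE('f::field) d k \<Delta> X" and m: "admits_move d X \<alpha> \<beta>"
    and simY: "simplicial_complex (bistellar_move X \<alpha> \<beta>)" and b: "card \<beta> \<le> k"
  shows "thin_ball TYPE('f) d k (\<Delta> \<union> Pow (\<alpha> \<union> \<beta>)) (bistellar_move X \<alpha> \<beta>)"
proof -
  interpret bistellar d X \<alpha> \<beta> using m simY by unfold_locales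
  have \<Delta>: "simplicial_complex \<Delta>" and sub: "X \<subseteq> \<Delta>"
    and low: "\<And>\<gamma>. \<gamma> \<in> \<Delta> \<Longrightarrow> card \<gamma> \<le> d + 1 - k \<Longrightarrow> \<gamma> \<in> X"
    and pure: "\<And>\<gamma>. \<gamma> \<in> \<Delta> \<Longrightarrow> \<exists>\<phi>\<in>\<Delta>. \<gamma> \<subseteq> \<phi> \<and> card \<phi> = d + 2"
    and crd: "\<And>\<gamma>. \<gamma> \<in> \<Delta> \<Longrightarrow> card \<gamma> \<le> d + 2"
    and lnk: "\<And>\<gamma> n. \<gamma> \<in> \<Delta> \<Longrightarrow> face_betti TYPE('f) n (link \<Delta> \<gamma>) = (if \<gamma> \<notin> X \<and> n = d + 2 - card \<gamma> then 1 else 0)"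
    and mis: "\<And>T. finite T \<Longrightarrow> k + 2 \<le> card T \<Longrightarrow> (\<forall>v\<in>T. T - {v} \<in> \<Delta>) \<Longrightarrow> T \<in> \<Delta>"
    using F unfolding thin_ball_def by blast+
  have fU: "finite U" using basic by simp
  have UX: "U - \<beta> = \<alpha>" using basic(6) by blast
  have bD: "\<beta> \<notin> \<Delta>"
  proof
    assume "\<beta> \<in> \<Delta>"
    then have "\<beta> \<in> X" using low b k by simp
    then show False using mem_X[of \<beta>] by blast
  qed
  have mem: "\<gamma> \<in> \<Delta> \<longleftrightarrow> \<not> \<beta> \<subseteq> \<gamma>" if "\<gamma> \<subseteq> U" for \<gamma>
    using mem_X[OF that] sub simplicial_subset[OF \<Delta>, of \<gamma> \<beta>] bD by blast
  interpret F: simplex_filling \<Delta> U \<beta> using \<Delta> fU basic mem by unfold_locales auto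
  show ?thesis
    unfolding thin_ball_def
  proof (intro conjI ballI allI impI)
    show "simplicial_complex (\<Delta> \<union> Pow U)" by (rule F.simplicial_filled)
    show "Y \<subseteq> \<Delta> \<union> Pow U" using sub unfolding Y_eq by blast
    fix \<gamma> assume g: "\<gamma> \<in> \<Delta> \<union> Pow U"
    show "\<gamma> \<in> Y" if c: "card \<gamma> \<le> d + 1 - k"
    proof (cases "\<gamma> \<subseteq> U")
      case True
      have "\<not> \<alpha> \<subseteq> \<gamma>"
      proof
        assume "\<alpha> \<subseteq> \<gamma>"
        then have "card \<alpha> \<le> card \<gamma>" using True fU by (meson card_mono finite_subset)
        then show False using c b basic(7) k by linarith
      qed
      then show ?thesis using mem_Y[OF True] by simp
    next
      case False
      then have "\<gamma> \<in> X" using g low c by blast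
      then show ?thesis using mem_Y_outside[OF False] by simp
    qed
    show "\<exists>\<phi>\<in>\<Delta> \<union> Pow U. \<gamma> \<subseteq> \<phi> \<and> card \<phi> = d + 2"
    proof (cases "\<gamma> \<subseteq> U")
      case True
      then show ?thesis using card_U by (intro bexI[of _ U]) simp_all
    next
      case False
      then have "\<gamma> \<in> \<Delta>" using g by simp
      then show ?thesis using pure by (meson UnI1)
    qed
    show "card \<gamma> \<le> d + 2" using g crd card_mono[OF fU, of \<gamma>] card_U by auto
    fix n
    show "face_betti TYPE('f) n (link (\<Delta> \<union> Pow U) \<gamma>) = (if \<gamma> \<notin> Y \<and> n = d + 2 - card \<gamma> then 1 else 0)"
    proof (cases "\<gamma> \<subseteq> U")
      case False
      then show ?thesis using g lnk mem_Y_outside[OF False] F.link_outside[OF False] by auto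
    next
      case True
      show ?thesis
      proof (cases "\<beta> \<subseteq> \<gamma>")
        case bg: True
        show ?thesis
        proof (cases "\<gamma> = U")
          case eq: True
          then show ?thesis using F.link_new[OF True bg] mem_Y[OF True] card_U by (simp add: face_betti_empty_complex)
        next
          case False
          then have "\<not> \<alpha> \<subseteq> \<gamma>" "U - \<gamma> \<noteq> {}" using bg True by blast+
          then show ?thesis using F.link_new[OF True bg] mem_Y[OF True] fU by (simp add: face_betti_Pow)
        qed
      next
        case nb: False
        have gX: "\<gamma> \<in> X" "\<gamma> \<in> \<Delta>" using mem_X[OF True] mem[OF True] nb by auto
        show ?thesis
        proof (cases "\<alpha> \<subseteq> \<gamma>")
          case False
          then show ?thesis using F.face_betti_link_same[OF True nb, where 'f = 'f and n = n] UX lnk[OF gX(2)] gX mem_Y[OF True] by simp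
        next
          case ag: True
          let ?L = "link \<Delta> \<gamma>"
          have l: "link (\<Delta> \<union> Pow U) \<gamma> = insert (U - \<gamma>) ?L" "U - \<gamma> \<notin> ?L"
            using F.link_opposite[OF True nb] ag UX by auto
          have fg: "finite \<gamma>" using True fU finite_subset by blast
          have cU: "card (U - \<gamma>) = d + 2 - card \<gamma>" using True fg card_U by (simp add: card_Diff_subset)
          have "U - \<gamma> \<noteq> {}" using nb True basic by blast
          then obtain p where p: "card (U - \<gamma>) = Suc p" using fU by (metis card_eq_0_iff finite_Diff not0_implies_Suc)
          have z: "face_betti TYPE('f) n ?L = 0" for n using lnk[OF gX(2)] gX by simp
          have sL: "simplicial_complex ?L" by (rule simplicial_link[OF \<Delta> gX(2)])
          have "simplicial_complex (link (\<Delta> \<union> Pow U) \<gamma>)" by (rule simplicial_link[OF F.simplicial_filled g])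
          then have sL': "simplicial_complex (insert (U - \<gamma>) ?L)" unfolding l(1) .
          show ?thesis
          proof (rule attach_face[OF sL sL' l(2) p, where 'f = 'f])
            assume "\<And>m. face_betti TYPE('f) m (insert (U - \<gamma>) ?L) = face_betti TYPE('f) m ?L + (if m = Suc p then 1 else 0)"
            then show ?thesis using z p cU l(1) ag mem_Y[OF True] by simp
          next
            assume "\<And>m. face_betti TYPE('f) m (insert (U - \<gamma>) ?L) + (if m = p then 1 else 0) = face_betti TYPE('f) m ?L"
            from this[of p] show ?thesis using z by simp
          qed
        qed
      qed
    qed
  next
    fix T assume "finite T \<and> k + 2 \<le> card T \<and> (\<forall>v\<in>T. T - {v} \<in> \<Delta> \<union> Pow U)"
    then have T: "finite T" "k + 2 \<le> card T" "\<And>v. v \<in> T \<Longrightarrow> T - {v} \<in> \<Delta> \<union> Pow U" by blast+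
    show "T \<in> \<Delta> \<union> Pow U"
    proof (cases "\<forall>v\<in>T. T - {v} \<in> \<Delta>")
      case True
      then show ?thesis using mis T by blast
    next
      case False
      then obtain v where v: "v \<in> T" "T - {v} \<notin> \<Delta>" by blast
      then have vU: "T - {v} \<subseteq> U" using T(3) by blast
      then have bv: "\<beta> \<subseteq> T - {v}" using v mem by blast
      \<comment> \<open>\<open>T\<close> has more elements than \<open>insert v \<beta>\<close>; a further element \<open>u\<close> gives a second
        subset of \<open>T\<close> above \<open>\<beta>\<close>, and the two together cover \<open>T\<close>.\<close>
      have "card (insert v \<beta>) \<le> k + 1" using b card_insert_le_m1[of "k + 1" \<beta> v] by simp
      then have "\<not> T \<subseteq> insert v \<beta>" using T(2) card_mono[of "insert v \<beta>" T] basic(3) by auto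
      then obtain u where u: "u \<in> T" "u \<noteq> v" "u \<notin> \<beta>" by blast
      then have "\<beta> \<subseteq> T - {u}" using bv by blast
      then have "T - {u} \<notin> \<Delta>" using bD simplicial_subset[OF \<Delta>, of "T - {u}" \<beta>] by blast
      then have "T - {u} \<subseteq> U" using T(3) u by blast
      then have "T \<subseteq> U" using vU u by blast
      then show ?thesis by blast
    qed
  qed
qed

lemma flip_ball_thin_ball:
  assumes "2 * k \<le> d" "flip_ball d k \<Delta> X" shows "thin_ball TYPE('f::field) d k \<Delta> X"
  using assms(2)
proof (induction rule: flip_ball.induct)
  case (simplex \<sigma>) then show ?case by (rule thin_ball_simplex)
next
  case (flip \<Delta> X \<alpha> \<beta>) then show ?case using thin_ball_flip[OF assms(1)] by blast
qed

section \<open>Stackedness\<close>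

lemma manifold_boundary_eq:
  assumes "simplicial_complex K"
  shows "manifold_boundary TYPE('f::field) K = {{}} \<union> {\<gamma>\<in>K. \<gamma> \<noteq> {} \<and> (\<forall>n. face_betti TYPE('f) n (link K \<gamma>) = 0)}"
  unfolding manifold_boundary_def
  using has_point_homology_iff[OF simplicial_link[OF assms], where 'f = 'f] by auto

lemma link_empty_face: "link K {} = K"
  by (simp add: link_def)

lemma pure_complex_of_dimI:
  assumes "simplicial_complex K" "\<And>\<gamma>. \<gamma> \<in> K \<Longrightarrow> card \<gamma> \<le> Suc n" "\<And>\<gamma>. \<gamma> \<in> K \<Longrightarrow> \<exists>\<phi>\<in>K. \<gamma> \<subseteq> \<phi> \<and> card \<phi> = Suc n"
  shows "pure_complex_of_dim (int n) K"
proof -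
  have "\<exists>\<phi>\<in>K. card \<phi> = Suc n" using assms(3)[OF simplicial_empty[OF assms(1)]] by blast
  moreover have "face_dim \<phi> = int n \<longleftrightarrow> card \<phi> = Suc n" "face_dim \<phi> \<le> int n \<longleftrightarrow> card \<phi> \<le> Suc n" for \<phi> :: "'a set"
    unfolding face_dim_def by linarith+
  ultimately show ?thesis
    using assms by (simp add: pure_complex_of_dim_def complex_of_dim_def)
qed

lemma spherical_homology_sphere:
  assumes "spherical TYPE('f::field) d X"
  shows "homology_sphere TYPE('f) (int d) X"
proof -
  have X: "simplicial_complex X" and pure: "\<And>\<gamma>. \<gamma> \<in> X \<Longrightarrow> \<exists>\<phi>\<in>X. \<gamma> \<subseteq> \<phi> \<and> card \<phi> = d + 1"
    and crd: "\<And>\<gamma>. \<gamma> \<in> X \<Longrightarrow> card \<gamma> \<le> d + 1"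
    and lnk: "\<And>\<gamma> n. \<gamma> \<in> X \<Longrightarrow> face_betti TYPE('f) n (link X \<gamma>) = (if n = d + 1 - card \<gamma> then 1 else 0)"
    using assms unfolding spherical_def by blast+
  have sph: "has_sphere_homology TYPE('f) (int d - int (card \<gamma>)) (link X \<gamma>)" if g: "\<gamma> \<in> X" for \<gamma>
  proof -
    have "nat (int d - int (card \<gamma>) + 1) = d + 1 - card \<gamma>" "int d - int (card \<gamma>) \<ge> -1"
      using crd[OF g] by auto
    then show ?thesis using has_sphere_homology_iff[OF simplicial_link[OF X g], where 'f = 'f] lnk[OF g] by simp
  qed
  have "pure_complex_of_dim (int d) X"
    using pure crd by (intro pure_complex_of_dimI[OF X]) auto
  moreover have "manifold_links TYPE('f) (int d) X"
    using sph by (simp add: manifold_links_def)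
  moreover have "manifold_boundary TYPE('f) X = {{}}"
  proof -
    have "\<not> (\<forall>n. face_betti TYPE('f) n (link X \<gamma>) = 0)" if "\<gamma> \<in> X" for \<gamma>
    proof
      assume "\<forall>n. face_betti TYPE('f) n (link X \<gamma>) = 0"
      then show False using lnk[OF that, of "d + 1 - card \<gamma>"] by simp
    qed
    then have "\<forall>\<gamma>\<in>X. \<not> (\<forall>n. face_betti TYPE('f) n (link X \<gamma>) = 0)" by (rule ballI)
    then have "{\<gamma>\<in>X. \<gamma> \<noteq> {} \<and> (\<forall>n. face_betti TYPE('f) n (link X \<gamma>) = 0)} = {}" by blast
    then show ?thesis unfolding manifold_boundary_eq[OF X] by (simp only: Un_empty_right)
  qed
  moreover have "has_sphere_homology TYPE('f) (int d) X"
    using sph[OF simplicial_empty[OF X]] by (simp add: link_empty_face)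
  ultimately show ?thesis by (simp add: homology_sphere_def closed_homology_manifold_def)
qed

lemma flip_ball_k_stacked:
  assumes k: "2 * k \<le> d" and F: "flip_ball d k \<Delta> X"
  shows "k_stacked TYPE('f::field) d k X"
proof -
  have S: "homology_sphere TYPE('f) (int d) X"
    by (rule spherical_homology_sphere[OF flip_ball_spherical[OF F]])
  have \<Delta>: "simplicial_complex \<Delta>" and sub: "X \<subseteq> \<Delta>"
    and low: "\<And>\<gamma>. \<gamma> \<in> \<Delta> \<Longrightarrow> card \<gamma> \<le> d + 1 - k \<Longrightarrow> \<gamma> \<in> X"
    and pure: "\<And>\<gamma>. \<gamma> \<in> \<Delta> \<Longrightarrow> \<exists>\<phi>\<in>\<Delta>. \<gamma> \<subseteq> \<phi> \<and> card \<phi> = d + 2"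
    and crd: "\<And>\<gamma>. \<gamma> \<in> \<Delta> \<Longrightarrow> card \<gamma> \<le> d + 2"
    and lnk: "\<And>\<gamma> n. \<gamma> \<in> \<Delta> \<Longrightarrow> face_betti TYPE('f) n (link \<Delta> \<gamma>) = (if \<gamma> \<notin> X \<and> n = d + 2 - card \<gamma> then 1 else 0)"
    using flip_ball_thin_ball[OF k F, where 'f = 'f] unfolding thin_ball_def by blast+
  have X: "simplicial_complex X" using flip_ball_spherical[OF F, where 'f = 'f] by (simp add: spherical_def)
  have e: "{} \<in> X" "{} \<in> \<Delta>" using simplicial_empty[OF X] sub by blast+
  have pt: "has_point_homology TYPE('f) (link \<Delta> \<gamma>)" if "\<gamma> \<in> X" "\<gamma> \<in> \<Delta>" for \<gamma>
    using has_point_homology_iff[OF simplicial_link[OF \<Delta> that(2)], where 'f = 'f] lnk[OF that(2)] that by simp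
  have sph: "has_sphere_homology TYPE('f) (int d + 1 - int (card \<gamma>)) (link \<Delta> \<gamma>)" if g: "\<gamma> \<in> \<Delta>" "\<gamma> \<notin> X" for \<gamma>
  proof -
    have "nat (int d + 1 - int (card \<gamma>) + 1) = d + 2 - card \<gamma>" "int d + 1 - int (card \<gamma>) \<ge> -1"
      using crd[OF g(1)] by auto
    then show ?thesis using has_sphere_homology_iff[OF simplicial_link[OF \<Delta> g(1)], where 'f = 'f] lnk[OF g(1)] g by simp
  qed
  have bd: "manifold_boundary TYPE('f) \<Delta> = X"
  proof -
    have "(\<forall>n. face_betti TYPE('f) n (link \<Delta> \<gamma>) = 0) \<longleftrightarrow> \<gamma> \<in> X" if "\<gamma> \<in> \<Delta>" for \<gamma>
      using lnk[OF that] by auto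
    then show ?thesis unfolding manifold_boundary_eq[OF \<Delta>] using e sub by auto
  qed
  have "pure_complex_of_dim (int (d + 1)) \<Delta>"
    using pure crd by (intro pure_complex_of_dimI[OF \<Delta>]) auto
  moreover have "manifold_links TYPE('f) (int d + 1) \<Delta>"
    using pt sph unfolding manifold_links_def by blast
  moreover have "has_point_homology TYPE('f) \<Delta>" using pt[OF e] by (simp add: link_empty_face)
  ultimately have ball: "homology_ball TYPE('f) (int d + 1) \<Delta>"
    using S by (simp add: homology_ball_def homology_manifold_def bd homology_sphere_def add.commute)
  have "skeleton (int d - int k) \<Delta> = skeleton (int d - int k) X"
  proof -
    have "\<gamma> \<in> X" if "\<gamma> \<in> \<Delta>" "face_dim \<gamma> \<le> int d - int k" for \<gamma>
    proof (rule low[OF that(1)])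
      show "card \<gamma> \<le> d + 1 - k" using that(2) k unfolding face_dim_def by linarith
    qed
    then show ?thesis using sub by (auto simp: skeleton_def)
  qed
  then show ?thesis using S ball bd k by (auto simp: k_stacked_def)
qed

text \<open>Expand \<open>x = 1 - (1 - x)\<close> in every term and collect, for each face \<open>F\<close>, the faces that contain
  it: the coefficient of \<open>(1 - x) ^ (D - card F)\<close> is the reduced Euler characteristic of the link of
  \<open>F\<close>, up to sign.\<close>

lemma hpoly_links:
  assumes K: "simplicial_complex K" and c: "\<And>\<gamma>. \<gamma> \<in> K \<Longrightarrow> card \<gamma> \<le> D"
  shows "hpoly D K = (\<Sum>F\<in>K. Polynomial.smult (\<Sum>H\<in>link K F. (-1) ^ card H) ([:1, -1:] ^ (D - card F)))"
proof -
  let ?q = "[:1, -1:] :: int poly"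
  have fin: "finite K" by (rule simplicial_finite[OF K])
  have expand: "[:0, 1:] ^ card G * ?q ^ (D - card G) = (\<Sum>F\<in>{F\<in>K. F \<subseteq> G}. Polynomial.smult ((-1) ^ (card G - card F)) (?q ^ (D - card F)))"
    if G: "G \<in> K" for G
  proof -
    have fG: "finite G" by (rule simplicial_face_finite[OF K G])
    have P: "Pow G = {F\<in>K. F \<subseteq> G}" using simplicial_subset[OF K G] by blast
    have "[:0, 1:] = 1 + Polynomial.smult (-1) ?q" by (simp add: one_pCons)
    then have "[:0, 1:] ^ card G * ?q ^ (D - card G) = (\<Sum>F\<in>Pow G. 1 ^ card F * Polynomial.smult (-1) ?q ^ (card G - card F)) * ?q ^ (D - card G)"
      by (simp only: sum_Pow_powers[OF fG])
    also have "\<dots> = (\<Sum>F\<in>Pow G. Polynomial.smult ((-1) ^ (card G - card F)) (?q ^ (D - card F)))"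
      unfolding sum_distrib_right
    proof (rule sum.cong[OF refl])
      fix F assume "F \<in> Pow G"
      then have "card F \<le> card G" using fG by (simp add: card_mono)
      then have "D - card F = (card G - card F) + (D - card G)" using c[OF G] by simp
      then show "1 ^ card F * Polynomial.smult (-1) ?q ^ (card G - card F) * ?q ^ (D - card G) = Polynomial.smult ((-1) ^ (card G - card F)) (?q ^ (D - card F))"
        by (simp only: power_one mult_1 smult_power power_add mult_smult_left)
    qed
    finally show ?thesis unfolding P .
  qed
  have "hpoly D K = (\<Sum>G\<in>K. \<Sum>F\<in>{F\<in>K. F \<subseteq> G}. Polynomial.smult ((-1) ^ (card G - card F)) (?q ^ (D - card F)))"
    unfolding hpoly_def using expand by (intro sum.cong refl) simp
  also have "\<dots> = (\<Sum>F\<in>K. \<Sum>G\<in>{G\<in>K. F \<subseteq> G}. Polynomial.smult ((-1) ^ (card G - card F)) (?q ^ (D - card F)))"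
    by (rule sum.swap_restrict[OF fin fin])
  also have "\<dots> = (\<Sum>F\<in>K. Polynomial.smult (\<Sum>H\<in>link K F. (-1) ^ card H) (?q ^ (D - card F)))"
  proof (rule sum.cong[OF refl])
    fix F assume F: "F \<in> K"
    have fF: "finite F" by (rule simplicial_face_finite[OF K F])
    have "(\<Sum>G\<in>{G\<in>K. F \<subseteq> G}. Polynomial.smult ((-1) ^ (card G - card F)) (?q ^ (D - card F)))
        = Polynomial.smult (\<Sum>G\<in>{G\<in>K. F \<subseteq> G}. (-1) ^ (card G - card F)) (?q ^ (D - card F))"
      by (rule smult_sum[symmetric])
    also have "(\<Sum>G\<in>{G\<in>K. F \<subseteq> G}. (-1) ^ (card G - card F)) = (\<Sum>H\<in>link K F. (-1) ^ card H :: int)"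
    proof (rule sum.reindex_bij_witness[where i = "\<lambda>H. H \<union> F" and j = "\<lambda>G. G - F"])
      fix G assume "G \<in> {G\<in>K. F \<subseteq> G}"
      then have G: "G \<in> K" "F \<subseteq> G" by blast+
      then show "G - F \<union> F = G" by blast
      show "G - F \<in> link K F" using G by (simp add: mem_link_iff[OF K] Un_absorb2 Int_commute)
      show "(-1) ^ card (G - F) = ((-1) ^ (card G - card F) :: int)" using fF G by (simp add: card_Diff_subset)
    next
      fix H assume "H \<in> link K F"
      then have H: "H \<inter> F = {}" "H \<union> F \<in> K" by (simp_all add: mem_link_iff[OF K])
      then show "(H \<union> F) - F = H" by blast
      show "H \<union> F \<in> {G\<in>K. F \<subseteq> G}" using H by blast
    qed
    finally show "(\<Sum>G\<in>{G\<in>K. F \<subseteq> G}. Polynomial.smult ((-1) ^ (card G - card F)) (?q ^ (D - card F)))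
        = Polynomial.smult (\<Sum>H\<in>link K F. (-1) ^ card H) (?q ^ (D - card F))" .
  qed
  finally show ?thesis .
qed

text \<open>In \<open>hpoly_links\<close> for the ball, the boundary faces drop out because their links are acyclic.
  The interior faces have more than \<open>d + 1 - k\<close> vertices and contribute polynomials of degree at most
  \<open>k\<close>. The coefficient of index \<open>k + 1\<close> involves only faces with at most \<open>k + 1 \<le> d + 1 - k\<close> vertices,
  and these are the same for the sphere.\<close>

lemma k_stacked_g_num_zero:
  assumes k: "2 * k \<le> d" and st: "k_stacked TYPE('f::field) d k S"
  shows "g_num d (k + 1) S = 0"
proof -
  obtain \<Delta> where ball: "homology_ball TYPE('f) (int d + 1) \<Delta>" and bd: "manifold_boundary TYPE('f) \<Delta> = S"
    and sk: "skeleton (int d - int k) \<Delta> = skeleton (int d - int k) S"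
    using st unfolding k_stacked_def by blast
  have pure: "pure_complex_of_dim (int d + 1) \<Delta>" and lnk: "manifold_links TYPE('f) (int d + 1) \<Delta>"
    and pt: "has_point_homology TYPE('f) \<Delta>"
    using ball unfolding homology_ball_def homology_manifold_def by blast+
  have \<Delta>: "simplicial_complex \<Delta>" and crd: "card \<gamma> \<le> d + 2" if "\<gamma> \<in> \<Delta>" for \<gamma>
    using pure that unfolding pure_complex_of_dim_def complex_of_dim_def face_dim_def by fastforce+
  have \<Delta>: "simplicial_complex \<Delta>" using pure unfolding pure_complex_of_dim_def complex_of_dim_def by blast
  have S: "S \<subseteq> \<Delta>" using simplicial_empty[OF \<Delta>] bd unfolding manifold_boundary_def by blast
  have low: "\<gamma> \<in> S \<longleftrightarrow> \<gamma> \<in> \<Delta>" if "card \<gamma> \<le> d + 1 - k" for \<gamma>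
  proof -
    have "face_dim \<gamma> \<le> int d - int k" using that k unfolding face_dim_def by linarith
    then show ?thesis using sk unfolding skeleton_def by blast
  qed
  have euler: "(\<Sum>H\<in>link \<Delta> F. (-1) ^ card H) = (\<Sum>n\<le>d + 2. (-1) ^ n * int (face_betti TYPE('f) n (link \<Delta> F)))" if "F \<in> \<Delta>" for F
  proof (rule euler_poincare[OF simplicial_link[OF \<Delta> that]])
    show "card \<alpha> \<le> d + 2" if "\<alpha> \<in> link \<Delta> F" for \<alpha> using that crd by (simp add: link_def)
  qed
  have zero: "(\<Sum>H\<in>link \<Delta> F. (-1) ^ card H) = (0::int)" if F: "F \<in> S" for F
  proof -
    have FD: "F \<in> \<Delta>" using F S by blast
    have "has_point_homology TYPE('f) (link \<Delta> F)"
    proof (cases "F = {}")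
      case True then show ?thesis using pt by (simp add: link_empty_face)
    next
      case False then show ?thesis using F bd unfolding manifold_boundary_def by blast
    qed
    then show ?thesis
      unfolding euler[OF FD] has_point_homology_iff[OF simplicial_link[OF \<Delta> FD]] by simp
  qed
  have vanish: "coeff (Polynomial.smult (\<Sum>H\<in>link \<Delta> F. (-1) ^ card H) ([:1, -1:] ^ (d + 2 - card F))) (k + 1) = (0::int)" if F: "F \<in> \<Delta>" for F
  proof (cases "F \<in> S")
    case True then show ?thesis using zero by simp
  next
    case False
    then have "\<not> card F \<le> d + 1 - k" using low F by blast
    then have e: "d + 2 - card F \<le> k" by simp
    have "degree ([:1, -1:] ^ (d + 2 - card F) :: int poly) \<le> d + 2 - card F"
      using degree_power_le[of "[:1, -1:] :: int poly" "d + 2 - card F"] by simp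
    then have "coeff ([:1, -1:] ^ (d + 2 - card F)) (k + 1) = (0::int)"
      using e by (intro coeff_eq_0) simp
    then show ?thesis by simp
  qed
  have expansion: "hpoly (d + 2) \<Delta> = (\<Sum>F\<in>\<Delta>. Polynomial.smult (\<Sum>H\<in>link \<Delta> F. (-1) ^ card H) ([:1, -1:] ^ (d + 2 - card F)))"
    by (rule hpoly_links[OF \<Delta> crd])
  have "coeff (hpoly (d + 2) \<Delta>) (k + 1) = 0"
    unfolding expansion coeff_sum by (rule sum.neutral) (use vanish in blast)
  moreover have "coeff (hpoly (d + 2) S) (k + 1) = coeff (hpoly (d + 2) \<Delta>) (k + 1)"
    unfolding hpoly_def coeff_sum coeff_hpoly_term
  proof (rule sum.mono_neutral_left[OF simplicial_finite[OF \<Delta>] S], intro ballI)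
    fix \<gamma> assume "\<gamma> \<in> \<Delta> - S"
    then have "\<not> card \<gamma> \<le> d + 1 - k" using low by blast
    then have "\<not> card \<gamma> \<le> k + 1" using k by linarith
    then show "(if card \<gamma> \<le> k + 1 then (-1) ^ (k + 1 - card \<gamma>) * int (d + 2 - card \<gamma> choose (k + 1 - card \<gamma>)) else 0) = 0"
      by simp
  qed
  ultimately show ?thesis
    using g_num_eq_coeff[OF finite_subset[OF S simplicial_finite[OF \<Delta>]]] by simp
qed

section \<open>Following both sides along a tame sequence\<close>

text \<open>The left side of the inequality divided by \<open>m + 1\<close>, with \<open>k = l + 1\<close>.\<close>

definition sigma_side :: "'f::field itself \<Rightarrow> nat \<Rightarrow> 'v::linorder set set \<Rightarrow> real" where
  "sigma_side F k X = weighted_sum (vertices X) (\<lambda>A. alt_betti F k (induced X A))"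

text \<open>The right side of the inequality divided by \<open>m + 1\<close>, with \<open>k = l + 1\<close>.\<close>

definition g_side :: "nat \<Rightarrow> nat \<Rightarrow> 'v set set \<Rightarrow> real" where
  "g_side d k X = (\<Sum>i\<le>k. (-1) ^ (k - i) * real_of_int (g_num d i X) * subset_weight (d + 2) i)"

lemma sigma_side_superset:
  assumes "finite V" "vertices X \<subseteq> V"
  shows "sigma_side F k X = weighted_sum V (\<lambda>A. alt_betti F k (induced X A))"
  unfolding sigma_side_def
proof (rule weighted_sum_extend[OF assms, symmetric])
  fix A
  have "induced X A = induced X (A \<inter> vertices X)" by (auto simp: induced_def vertices_def)
  then show "alt_betti F k (induced X A) = alt_betti F k (induced X (A \<inter> vertices X))" by simp
qed

lemma sigma_side_simplex_boundary:
  fixes \<sigma> :: "'v::linorder set"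
  assumes s: "finite \<sigma>" "card \<sigma> = d + 2" and k: "k \<le> d"
  shows "sigma_side TYPE('f::field) k (simplex_boundary \<sigma>) = (-1) ^ k * subset_weight (d + 2) 0"
proof -
  have ne: "\<sigma> \<noteq> {}" using s by auto
  have "vertices (simplex_boundary \<sigma>) \<subseteq> \<sigma>" by (auto simp: vertices_def simplex_boundary_def)
  from sigma_side_superset[OF s(1) this]
  have "sigma_side TYPE('f) k (simplex_boundary \<sigma>) = weighted_sum \<sigma> (\<lambda>A. alt_betti TYPE('f) k (induced (simplex_boundary \<sigma>) A))" .
  also have "\<dots> = (\<Sum>A\<in>Pow \<sigma>. if A = {} then subset_weight (d + 2) 0 * (-1) ^ k else 0)"
    unfolding weighted_sum_def s(2)
  proof (rule sum.cong[OF refl])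
    fix A assume A: "A \<in> Pow \<sigma>"
    have fA: "finite A" using A s finite_subset by blast
    have "alt_betti TYPE('f) k (induced (simplex_boundary \<sigma>) A) = (if A = {} then (-1) ^ k else 0)"
    proof (cases "A = {}")
      case True
      have "induced (simplex_boundary \<sigma>) A = {{}}"
        using ne True by (auto simp: induced_def simplex_boundary_def)
      then have "alt_betti TYPE('f) k (induced (simplex_boundary \<sigma>) A) = (\<Sum>n\<le>k. if n = 0 then (-1) ^ k else 0)"
        unfolding alt_betti_def by (intro sum.cong) (auto simp: face_betti_empty_complex)
      then show ?thesis using True by simp
    next
      case False
      show ?thesis
      proof (cases "A = \<sigma>")
        case True
        have "induced (simplex_boundary \<sigma>) A = simplex_boundary \<sigma>"
          unfolding True by (auto simp: induced_def simplex_boundary_def)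
        then show ?thesis using False s k ne by (simp add: alt_betti_def face_betti_simplex_boundary)
      next
        case False
        then have "induced (simplex_boundary \<sigma>) A = Pow A"
          using A by (auto simp: induced_def simplex_boundary_def)
        then show ?thesis using \<open>A \<noteq> {}\<close> fA by (simp add: alt_betti_def face_betti_Pow)
      qed
    qed
    then show "subset_weight (d + 2) (card A) * alt_betti TYPE('f) k (induced (simplex_boundary \<sigma>) A)
        = (if A = {} then subset_weight (d + 2) 0 * (-1) ^ k else 0)" by simp
  qed
  also have "\<dots> = (-1) ^ k * subset_weight (d + 2) 0" using s(1) by simp
  finally show ?thesis .
qed

lemma g_side_simplex_boundary:
  assumes "finite \<sigma>" "card \<sigma> = d + 2" "k \<le> d"
  shows "g_side d k (simplex_boundary \<sigma>) = (-1) ^ k * subset_weight (d + 2) 0"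
proof -
  have "g_side d k (simplex_boundary \<sigma>) = (\<Sum>i\<le>k. if i = 0 then (-1) ^ k * subset_weight (d + 2) 0 else 0)"
    unfolding g_side_def g_num_simplex_boundary[OF assms(1,2)] using assms(3) by (intro sum.cong) auto
  then show ?thesis by simp
qed

context bistellar
begin

lemma g_side_move:
  assumes "k < card \<alpha>"
  shows "g_side d k Y = g_side d k X + (if card \<beta> \<le> k then (-1) ^ (k - card \<beta>) * subset_weight (d + 2) (card \<beta>) else 0)"
proof -
  have "g_side d k Y = (\<Sum>i\<le>k. (-1) ^ (k - i) * real_of_int (g_num d i X) * subset_weight (d + 2) i
      + (if i = card \<beta> then (-1) ^ (k - i) * subset_weight (d + 2) i else 0))"
    unfolding g_side_def g_num_move using assms by (intro sum.cong refl) (auto simp: algebra_simps)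
  also have "\<dots> = g_side d k X + (if card \<beta> \<le> k then (-1) ^ (k - card \<beta>) * subset_weight (d + 2) (card \<beta>) else 0)"
    unfolding g_side_def sum.distrib by simp
  finally show ?thesis .
qed

lemma
  assumes k: "2 * k \<le> d" and t: "2 * card \<beta> < d + 2"
  shows sigma_side_move_low: "card \<beta> \<le> k \<Longrightarrow> sigma_side TYPE('f::field) k Y = sigma_side TYPE('f) k X + (-1) ^ (k - card \<beta>) * subset_weight (d + 2) (card \<beta>)"
    and sigma_side_move_mid: "card \<beta> = k + 1 \<Longrightarrow> sigma_side TYPE('f) k Y < sigma_side TYPE('f) k X"
    and sigma_side_move_high: "k + 1 < card \<beta> \<Longrightarrow> sigma_side TYPE('f) k Y = sigma_side TYPE('f) k X"
proof -
  interpret FX: simplex_filling X U \<beta> by (rule filling_X)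
  interpret FY: simplex_filling Y U \<alpha> by (rule filling_Y)
  define V where "V = vertices X \<union> U"
  have V: "finite V" "U \<subseteq> V" using finite_vertices[OF basic(1)] basic by (auto simp: V_def)
  have "vertices Y \<subseteq> vertices (X \<union> Pow U)" unfolding Y_eq vertices_def by blast
  also have "\<dots> \<subseteq> V" unfolding V_def vertices_def by blast
  finally have VY: "vertices Y \<subseteq> V" .
  have VX: "vertices X \<subseteq> V" by (simp add: V_def)
  note sX = sigma_side_superset[OF V(1) VX, of "TYPE('f)" k] and sY = sigma_side_superset[OF V(1) VY, of "TYPE('f)" k]
  obtain a where a: "card \<alpha> = Suc a" using basic by (metis card_eq_0_iff not0_implies_Suc)
  obtain b where b: "card \<beta> = Suc b" using basic by (metis card_eq_0_iff not0_implies_Suc)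
  have "k < a" using a b k t basic(7) by linarith
  then have Z: "weighted_sum V (\<lambda>A. alt_betti TYPE('f) k (induced (X \<union> Pow U) A)) = sigma_side TYPE('f) k Y"
    using FY.weighted_sum_fill_high[OF V a, where 'f = 'f and k = k] unfolding sY Un_Pow_eq by simp
  show "card \<beta> \<le> k \<Longrightarrow> sigma_side TYPE('f) k Y = sigma_side TYPE('f) k X + (-1) ^ (k - card \<beta>) * subset_weight (d + 2) (card \<beta>)"
    using FX.weighted_sum_fill_low[OF V b, where 'f = 'f and k = k] unfolding Z sX b card_U by simp
  show "card \<beta> = k + 1 \<Longrightarrow> sigma_side TYPE('f) k Y < sigma_side TYPE('f) k X"
    using FX.weighted_sum_fill_mid[OF V b, where 'f = 'f and k = k] unfolding Z sX b by simp
  show "k + 1 < card \<beta> \<Longrightarrow> sigma_side TYPE('f) k Y = sigma_side TYPE('f) k X"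
    using FX.weighted_sum_fill_high[OF V b, where 'f = 'f and k = k] unfolding Z sX b by simp
qed

text \<open>All proper subsets of \<open>\<beta>\<close> are faces of the ball, so a large \<open>\<beta>\<close> would be a face of it; having few
  enough vertices, \<open>\<beta>\<close> would then lie on the boundary \<open>X\<close>.\<close>

lemma no_high_move_if_thin_ball:
  assumes k: "2 * k \<le> d" and t: "2 * card \<beta> < d + 2" and F: "thin_ball TYPE('f::field) d k \<Delta> X"
  shows "card \<beta> \<le> k + 1"
proof (rule ccontr)
  assume "\<not> card \<beta> \<le> k + 1"
  then have b: "k + 2 \<le> card \<beta>" by simp
  have "\<forall>v\<in>\<beta>. \<beta> - {v} \<in> \<Delta>"
  proof
    fix v assume "v \<in> \<beta>"
    then have "\<beta> - {v} \<in> X" using mem_X[of "\<beta> - {v}"] by blast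
    then show "\<beta> - {v} \<in> \<Delta>" using F unfolding thin_ball_def by blast
  qed
  then have "\<beta> \<in> \<Delta>" using F b basic(3) unfolding thin_ball_def by blast
  moreover have "card \<beta> \<le> d + 1 - k" using k t by linarith
  ultimately have "\<beta> \<in> X" using F unfolding thin_ball_def by blast
  then show False using mem_X[of \<beta>] by blast
qed

end

text \<open>As long as the moves have \<open>card \<beta> \<le> k\<close>, the ball grows and both sides change equally. A move
  with \<open>card \<beta> = k + 1\<close> leads into the second case for good, and a move with a larger \<open>\<beta>\<close> is possible
  only in the second case, which it does not affect. The entry of the g-vector at \<open>k + 1\<close> tells the
  two cases apart, as it vanishes for \<open>k\<close>-stacked spheres.\<close>

lemma tame_dichotomy:
  fixes X :: "'v::linorder set set"
  assumes "tamely_obtainable d X" "simplicial_complex X" and k: "2 * k \<le> d"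
  shows "((\<exists>\<Delta>. flip_ball d k \<Delta> X) \<and> sigma_side TYPE('f::field) k X = g_side d k X)
    \<or> (sigma_side TYPE('f) k X < g_side d k X \<and> g_num d (k + 1) X > 0)"
  using assms(1,2)
proof (induction rule: tamely_obtainable.induct)
  case (standard \<sigma>)
  then show ?case
    using flip_ball.simplex[of \<sigma> d k] sigma_side_simplex_boundary[of \<sigma> d k, where 'f = 'f] g_side_simplex_boundary[of \<sigma> d k] k by auto
next
  case (move X \<alpha> \<beta>)
  interpret bistellar d X \<alpha> \<beta> using move by unfold_locales
  have "card \<beta> \<noteq> 0" using basic by simp
  then have t: "2 * card \<beta> < d + 2" using move.hyps(3) by (auto simp: move_index_def)
  have ka: "k + 1 < card \<alpha>" using k t basic(7) by linarith
  note IH = move.IH[OF basic(1)]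
  have kg: "g_side d k Y = g_side d k X + (if card \<beta> \<le> k then (-1) ^ (k - card \<beta>) * subset_weight (d + 2) (card \<beta>) else 0)"
    using g_side_move[of k] ka by simp
  have g: "g_num d (k + 1) Y = g_num d (k + 1) X + (if card \<beta> = k + 1 then 1 else 0)"
    using g_num_move[of "k + 1"] ka by simp
  consider (low) "card \<beta> \<le> k" | (mid) "card \<beta> = k + 1" | (high) "k + 1 < card \<beta>" by linarith
  then show ?case
  proof cases
    case low
    have s: "sigma_side TYPE('f) k Y - g_side d k Y = sigma_side TYPE('f) k X - g_side d k X"
      using sigma_side_move_low[OF k t low, where 'f = 'f] kg low by simp
    have "\<exists>\<Delta>'. flip_ball d k \<Delta>' Y" if "flip_ball d k \<Delta> X" for \<Delta>
      using flip_ball.flip[OF that admits simplicial_Y low] by blast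
    then show ?thesis using IH s g low by auto
  next
    case mid
    \<comment> \<open>The entry is zero in the first case of the dichotomy and positive in the second.\<close>
    have gX: "g_num d (k + 1) X \<ge> 0"
    proof -
      have "g_num d (k + 1) X = 0" if "flip_ball d k \<Delta> X" for \<Delta>
        by (rule k_stacked_g_num_zero[OF k flip_ball_k_stacked[OF k that, where 'f = 'f]])
      then show ?thesis using IH by force
    qed
    have "sigma_side TYPE('f) k Y < g_side d k Y"
      using sigma_side_move_mid[OF k t mid, where 'f = 'f] kg mid IH by auto
    then show ?thesis using g mid gX by simp
  next
    case high
    have "\<not> flip_ball d k \<Delta> X" for \<Delta>
    proof
      assume "flip_ball d k \<Delta> X"
      from no_high_move_if_thin_ball[OF k t flip_ball_thin_ball[OF k this, where 'f = 'f]] show False using high by simp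
    qed
    then show ?thesis using IH sigma_side_move_high[OF k t high, where 'f = 'f] kg g high by auto
  qed
qed

lemma f_num_0_eq: "f_num 0 X = card (vertices X)" if "simplicial_complex X"
proof -
  have "{\<alpha> \<in> X. face_dim \<alpha> = 0} = (\<lambda>v. {v}) ` vertices X"
  proof (intro Set.set_eqI iffI)
    fix \<alpha> assume "\<alpha> \<in> {\<alpha> \<in> X. face_dim \<alpha> = 0}"
    then have "\<alpha> \<in> X" "card \<alpha> = 1" by (auto simp: face_dim_def)
    then obtain v where "\<alpha> = {v}" using card_1_singletonE by blast
    then show "\<alpha> \<in> (\<lambda>v. {v}) ` vertices X" using \<open>\<alpha> \<in> X\<close> by (auto simp: vertices_def)
  next
    fix \<alpha> assume "\<alpha> \<in> (\<lambda>v. {v}) ` vertices X"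
    then obtain v \<gamma> where "\<alpha> = {v}" "\<gamma> \<in> X" "v \<in> \<gamma>" by (auto simp: vertices_def)
    then show "\<alpha> \<in> {\<alpha> \<in> X. face_dim \<alpha> = 0}"
      using simplicial_subset[OF that, of \<gamma> "{v}"] by (auto simp: face_dim_def)
  qed
  then show ?thesis by (simp add: f_num_def card_image)
qed

lemma alternating_sigma_eq_sigma_side:
  fixes S :: "'v::linorder set set"
  assumes S: "simplicial_complex S"
  shows "(\<Sum>i = 0..l. (-1) ^ (l - i) * sigma_num TYPE('f::field) i S) = (real (f_num 0 S) + 1) * sigma_side TYPE('f) (l + 1) S"
proof -
  let ?V = "vertices S"
  have m: "f_num 0 S = card ?V" by (rule f_num_0_eq[OF S])
  have "(\<Sum>i = 0..l. (-1) ^ (l - i) * sigma_num TYPE('f) i S)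
      = (\<Sum>i = 0..l. \<Sum>A\<in>Pow ?V. (-1) ^ (l - i) * real_of_int (reduced_betti TYPE('f) i (induced S A)) / real (card ?V choose card A))"
    unfolding sigma_num_def m by (simp add: sum_distrib_left)
  also have "\<dots> = (\<Sum>A\<in>Pow ?V. (\<Sum>i = 0..l. (-1) ^ (l - i) * real_of_int (reduced_betti TYPE('f) i (induced S A))) / real (card ?V choose card A))"
    unfolding sum_divide_distrib by (rule sum.swap)
  also have "\<dots> = (\<Sum>A\<in>Pow ?V. (real (card ?V) + 1) * (subset_weight (card ?V) (card A) * alt_betti TYPE('f) (l + 1) (induced S A)))"
  proof (rule sum.cong[OF refl])
    fix A
    have "x / c = (real (card ?V) + 1) * (1 / (real (Suc (card ?V)) * c) * x)" for x c :: real
      by (simp add: add.commute)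
    then show "(\<Sum>i = 0..l. (-1) ^ (l - i) * real_of_int (reduced_betti TYPE('f) i (induced S A))) / real (card ?V choose card A)
      = (real (card ?V) + 1) * (subset_weight (card ?V) (card A) * alt_betti TYPE('f) (l + 1) (induced S A))"
      unfolding alternating_reduced_betti[OF simplicial_induced[OF S]] alt_betti_def subset_weight_def Suc_eq_plus1[symmetric]
      by blast
  qed
  also have "\<dots> = (real (f_num 0 S) + 1) * sigma_side TYPE('f) (l + 1) S"
    unfolding sigma_side_def weighted_sum_def m sum_distrib_left ..
  finally show ?thesis .
qed

lemma alternating_g_eq_g_side:
  "(\<Sum>i = 0..k. (-1) ^ (k - i) * real_of_int (g_num d i S) / real (d + 2 choose i)) = (real d + 3) * g_side d k S"
proof -
  have r: "real (Suc (d + 2)) = real d + 3" by simp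
  have "x / c = (real d + 3) * (x * (1 / ((real d + 3) * c)))" for x c :: real
    by simp
  then show ?thesis
    unfolding g_side_def sum_distrib_left atLeast0AtMost subset_weight_def r by (rule sum.cong[OF refl])
qed

theorem theorem1p3:
  fixes S :: "'v::linorder set set" and d l m :: nat
  assumes "tame_sphere d S"
    and "real l \<le> real d / 2 - 1"
    and "m = f_num 0 S"
  shows "(\<Sum>i = 0..l. (-1) ^ (l - i) * sigma_num TYPE('f::field) i S)
           \<le> (real m + 1) / (real d + 3) *
              (\<Sum>i = 0..l + 1. (-1) ^ (l + 1 - i) * real_of_int (g_num d i S) / real (d + 2 choose i))
       \<and> ((\<Sum>i = 0..l. (-1) ^ (l - i) * sigma_num TYPE('f) i S)
           = (real m + 1) / (real d + 3) *
              (\<Sum>i = 0..l + 1. (-1) ^ (l + 1 - i) * real_of_int (g_num d i S) / real (d + 2 choose i))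
          \<longleftrightarrow> k_stacked TYPE('f) d (l + 1) S)"
proof -
  have "real (2 * (l + 1)) \<le> real d" using assms(2) by simp
  then have k: "2 * (l + 1) \<le> d" by (simp only: of_nat_le_iff)
  have S: "simplicial_complex S" and T: "tamely_obtainable d S"
    using assms(1) by (auto simp: tame_sphere_def complex_of_dim_def)
  have L: "(\<Sum>i = 0..l. (-1) ^ (l - i) * sigma_num TYPE('f) i S) = (real m + 1) * sigma_side TYPE('f) (l + 1) S"
    unfolding assms(3) by (rule alternating_sigma_eq_sigma_side[OF S])
  have "(real m + 1) / (real d + 3) * ((real d + 3) * g_side d (l + 1) S) = (real m + 1) * g_side d (l + 1) S"
    by (simp add: field_simps)
  then have R: "(real m + 1) / (real d + 3) *
      (\<Sum>i = 0..l + 1. (-1) ^ (l + 1 - i) * real_of_int (g_num d i S) / real (d + 2 choose i)) = (real m + 1) * g_side d (l + 1) S"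
    unfolding alternating_g_eq_g_side .
  have le: "sigma_side TYPE('f) (l + 1) S \<le> g_side d (l + 1) S"
    and eq: "sigma_side TYPE('f) (l + 1) S = g_side d (l + 1) S \<longleftrightarrow> k_stacked TYPE('f) d (l + 1) S"
    using tame_dichotomy[OF T S k, where 'f = 'f] flip_ball_k_stacked[OF k, where 'f = 'f and X = S]
      k_stacked_g_num_zero[OF k, where 'f = 'f and S = S] by (auto simp del: One_nat_def)
  have "real m + 1 > 0" by simp
  then show ?thesis unfolding L R using le eq by simp
qed

end
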